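(* Let $\gamma_1,\gamma_2\in(-1,-1/2)$ with $\gamma_1+\gamma_2>-3/2$. Let $$Z_{\gamma_1,\gamma_2}(1)=\frac{A}{2}\int_{\mathbb{R}^2}'\int_0^1\big[(s-x_1)_+^{\gamma_1}(s-x_2)_+^{\gamma_2}+(s-x_1)_+^{\gamma_2}(s-x_2)_+^{\gamma_1}\big]\,ds\;B(dx_1)B(dx_2)$$ be the double Wiener-Itô integral with respect to a Brownian random measure $B(\cdot)$ on $\mathbb{R}$, standardized by choosing the constant $$A=A(\gamma_1,\gamma_2)=\left(\frac{(\gamma_1+\gamma_2+2)(2(\gamma_1+\gamma_2)+3)}{\mathrm{B}(\gamma_1+1,-\gamma_1-\gamma_2-1)\,\mathrm{B}(\gamma_2+1,-\gamma_1-\gamma_2-1)+\mathrm{B}(\gamma_1+1,-2\gamma_1-1)\,\mathrm{B}(\gamma_2+1,-2\gamma_2-1)}\right)^{1/2},$$ for which $\mathbb{E}[Z_{\gamma_1,\gamma_2}(1)^2]=1$. Then the third moment $M_3(\gamma_1,\gamma_2)=\mathbb{E}[Z_{\gamma_1,\gamma_2}(1)^3]$ of this standardized random variable is $$M_3(\gamma_1,\gamma_2)=F_1(\gamma_1,\gamma_2)\,F_2(\gamma_1,\gamma_2)\,F_3(\gamma_1,\gamma_2),$$ where $$F_1(\gamma_1,\gamma_2)=2(\gamma_1+\gamma_2+2)^{1/2}(2(\gamma_1+\gamma_2)+3)^{3/2}(3(\gamma_1+\gamma_2)+5)^{-1},$$ $$F_2(\gamma_1,\gamma_2)=\sum_{\sigma\in\{1,2\}^3}\mathrm{B}(\gamma_{\sigma_1}+1,-\gamma_{\sigma_1}-\gamma_{\sigma_3'}-1)\,\mathrm{B}(\gamma_{\sigma_1'}+1,-\gamma_{\sigma_1'}-\gamma_{\sigma_2}-1)\,\mathrm{B}(\gamma_{\sigma_2'}+1,-\gamma_{\sigma_2'}-\gamma_{\sigma_3}-1)\,\mathrm{B}(\gamma_{\sigma_1'}+\gamma_{\sigma_2}+2,\gamma_{\sigma_2'}+\gamma_{\sigma_3}+2),$$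 $$F_3(\gamma_1,\gamma_2)=\Big[\mathrm{B}(\gamma_1+1,-\gamma_1-\gamma_2-1)\,\mathrm{B}(\gamma_2+1,-\gamma_1-\gamma_2-1)+\mathrm{B}(\gamma_1+1,-2\gamma_1-1)\,\mathrm{B}(\gamma_2+1,-2\gamma_2-1)\Big]^{-3/2},$$ with $\sigma=(\sigma_1,\sigma_2,\sigma_3)$, $\sigma_i\in\{1,2\}$, and $\sigma_i'=3-\sigma_i$.
   Context: $\mathrm{B}(x,y)=\int_0^1u^{x-1}(1-u)^{y-1}\,du=\Gamma(x)\Gamma(y)/\Gamma(x+y)$ for $x,y>0$ is the beta function (not to be confused with the random measure $B(dx)$). For real $x$ and exponent $p$, $x_+^p=x^p$ if $x>0$ and $x_+^p=0$ otherwise. $B(\cdot)$ is a Brownian random measure on $\mathbb{R}$, i.e. a Gaussian random measure (white noise) with Lebesgue control measure. For $f\in L^2(\mathbb{R}^2)$, $\int_{\mathbb{R}^2}'f(x_1,x_2)\,B(dx_1)B(dx_2)$ is the double Wiener-Itô integral, the prime indicating exclusion of the diagonal $x_1=x_2$; the normalization is the usual one: the integral has mean $0$, and for symmetric $f$ its variance is $2\|f\|_{L^2(\mathbb{R}^2)}^2$. *)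

theory Defs
  imports "HOL-Probability.Probability"
begin

definition pos_powr :: "real \<Rightarrow> real \<Rightarrow> real" where
  "pos_powr x p = (if 0 < x then x powr p else 0)"

definition finite_borel_sets :: "real set set" where
  "finite_borel_sets = {A \<in> sets borel. emeasure lborel A < \<infinity>}"

text \<open>
  A Brownian random measure: an independently scattered, almost surely countably additive
  family \<open>W A\<close> of centred Gaussian variables with variance the Lebesgue measure of \<open>A\<close>.
  The variance-zero case is a separate axiom because the degenerate Gaussian law has no density.
\<close>

locale brownian_random_measure = prob_space M
  for M :: "'a measure" +
  fixes W :: "real set \<Rightarrow> 'a \<Rightarrow> real"
  assumes random_variable_W:
      "A \<in> finite_borel_sets \<Longrightarrow> W A \<in> borel_measurable M"
    and gaussian_W:
      "A \<in> finite_borel_sets \<Longrightarrow> 0 < measure lborel A \<Longrightarrow>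
        distributed M lborel (W A) (normal_density 0 (sqrt (measure lborel A)))"
    and null_W:
      "A \<in> finite_borel_sets \<Longrightarrow> measure lborel A = 0 \<Longrightarrow> AE \<omega> in M. W A \<omega> = 0"
    and independently_scattered_W:
      "\<And>(A :: nat \<Rightarrow> real set) n.
        (\<And>i. i < n \<Longrightarrow> A i \<in> finite_borel_sets) \<Longrightarrow> disjoint_family_on A {..<n} \<Longrightarrow>
        indep_vars (\<lambda>_. borel) (\<lambda>i. W (A i)) {..<n}"
    and countably_additive_W:
      "\<And>A :: nat \<Rightarrow> real set.
        range A \<subseteq> finite_borel_sets \<Longrightarrow> disjoint_family A \<Longrightarrow>
        (\<Union>i. A i) \<in> finite_borel_sets \<Longrightarrow>
        AE \<omega> in M. (\<lambda>i. W (A i) \<omega>) sums W (\<Union>i. A i) \<omega>"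

text \<open>
  An off-diagonal step function is represented by a number \<open>n\<close> of cells, the cells \<open>A i\<close>,
  and a coefficient array \<open>a\<close> which vanishes on the diagonal.
\<close>

type_synonym off_diag_step = "nat \<times> (nat \<Rightarrow> real set) \<times> (nat \<Rightarrow> nat \<Rightarrow> real)"

definition off_diag_steps :: "off_diag_step set" where
  "off_diag_steps = {(n, A, a).
     (\<forall>i<n. A i \<in> finite_borel_sets) \<and> disjoint_family_on A {..<n} \<and> (\<forall>i<n. a i i = 0)}"

fun step_fun :: "off_diag_step \<Rightarrow> real \<times> real \<Rightarrow> real" where
  "step_fun (n, A, a) (x, y) =
     (\<Sum>i<n. \<Sum>j<n. a i j * indicator (A i) x * indicator (A j) y)"

fun step_integral :: "(real set \<Rightarrow> 'a \<Rightarrow> real) \<Rightarrow> off_diag_step \<Rightarrow> 'a \<Rightarrow> real" where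
  "step_integral W (n, A, a) \<omega> = (\<Sum>i<n. \<Sum>j<n. a i j * W (A i) \<omega> * W (A j) \<omega>)"

text \<open>
  The integral of \<open>f\<close> is the limit in \<open>L\<^sup>2\<close> of the underlying probability space of the
  integrals of off-diagonal step functions converging to \<open>f\<close> in \<open>L\<^sup>2\<close> of the plane.
  Squared distances are nonnegative integrals, so they cannot be spuriously zero.
\<close>

definition has_double_wiener_ito ::
    "'a measure \<Rightarrow> (real set \<Rightarrow> 'a \<Rightarrow> real) \<Rightarrow> (real \<times> real \<Rightarrow> real) \<Rightarrow> ('a \<Rightarrow> real) \<Rightarrow> bool" where
  "has_double_wiener_ito M W f Z \<longleftrightarrow>
     f \<in> borel_measurable lborel \<and> Z \<in> borel_measurable M \<and>
     (\<exists>h :: nat \<Rightarrow> off_diag_step. range h \<subseteq> off_diag_steps \<and>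
        (\<lambda>k. \<integral>\<^sup>+z. ennreal ((step_fun (h k) z - f z)\<^sup>2) \<partial>lborel) \<longlonglongrightarrow> 0 \<and>
        (\<lambda>k. \<integral>\<^sup>+\<omega>. ennreal ((step_integral W (h k) \<omega> - Z \<omega>)\<^sup>2) \<partial>M) \<longlonglongrightarrow> 0)"

text \<open>The integral is determined up to almost sure equality; a version is chosen.\<close>

definition double_wiener_ito ::
    "'a measure \<Rightarrow> (real set \<Rightarrow> 'a \<Rightarrow> real) \<Rightarrow> (real \<times> real \<Rightarrow> real) \<Rightarrow> 'a \<Rightarrow> real" where
  "double_wiener_ito M W f = (SOME Z. has_double_wiener_ito M W f Z)"

text \<open>
  At points \<open>x\<^sub>1 = x\<^sub>2\<close> of the diagonal with \<open>x\<^sub>1\<close> between 0 and 1 the integral over \<open>s\<close> diverges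
  and is 0 by convention; this is a null set of the plane.
\<close>

definition rosenblatt_kernel :: "real \<Rightarrow> real \<Rightarrow> real \<times> real \<Rightarrow> real" where
  "rosenblatt_kernel \<gamma>\<^sub>1 \<gamma>\<^sub>2 = (\<lambda>(x\<^sub>1, x\<^sub>2).
     LBINT s:{0..1}. pos_powr (s - x\<^sub>1) \<gamma>\<^sub>1 * pos_powr (s - x\<^sub>2) \<gamma>\<^sub>2
                   + pos_powr (s - x\<^sub>1) \<gamma>\<^sub>2 * pos_powr (s - x\<^sub>2) \<gamma>\<^sub>1)"

definition beta_bracket :: "real \<Rightarrow> real \<Rightarrow> real" where
  "beta_bracket \<gamma>\<^sub>1 \<gamma>\<^sub>2 =
     Beta (\<gamma>\<^sub>1 + 1) (- \<gamma>\<^sub>1 - \<gamma>\<^sub>2 - 1) * Beta (\<gamma>\<^sub>2 + 1) (- \<gamma>\<^sub>1 - \<gamma>\<^sub>2 - 1)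
   + Beta (\<gamma>\<^sub>1 + 1) (- 2 * \<gamma>\<^sub>1 - 1) * Beta (\<gamma>\<^sub>2 + 1) (- 2 * \<gamma>\<^sub>2 - 1)"

definition rosenblatt_const :: "real \<Rightarrow> real \<Rightarrow> real" where
  "rosenblatt_const \<gamma>\<^sub>1 \<gamma>\<^sub>2 =
     ((\<gamma>\<^sub>1 + \<gamma>\<^sub>2 + 2) * (2 * (\<gamma>\<^sub>1 + \<gamma>\<^sub>2) + 3) / beta_bracket \<gamma>\<^sub>1 \<gamma>\<^sub>2) powr (1 / 2)"

definition rosenblatt_rv ::
    "'a measure \<Rightarrow> (real set \<Rightarrow> 'a \<Rightarrow> real) \<Rightarrow> real \<Rightarrow> real \<Rightarrow> 'a \<Rightarrow> real" where
  "rosenblatt_rv M W \<gamma>\<^sub>1 \<gamma>\<^sub>2 \<omega> =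
     rosenblatt_const \<gamma>\<^sub>1 \<gamma>\<^sub>2 / 2 * double_wiener_ito M W (rosenblatt_kernel \<gamma>\<^sub>1 \<gamma>\<^sub>2) \<omega>"

definition F\<^sub>1 :: "real \<Rightarrow> real \<Rightarrow> real" where
  "F\<^sub>1 \<gamma>\<^sub>1 \<gamma>\<^sub>2 =
     2 * (\<gamma>\<^sub>1 + \<gamma>\<^sub>2 + 2) powr (1 / 2) * (2 * (\<gamma>\<^sub>1 + \<gamma>\<^sub>2) + 3) powr (3 / 2)
       * inverse (3 * (\<gamma>\<^sub>1 + \<gamma>\<^sub>2) + 5)"

text \<open>Below, \<open>\<gamma> i\<close> and \<open>\<gamma>' i\<close> stand for the exponents with index \<open>i\<close> and \<open>3 - i\<close>.\<close>

definition F\<^sub>2 :: "real \<Rightarrow> real \<Rightarrow> real" where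
  "F\<^sub>2 \<gamma>\<^sub>1 \<gamma>\<^sub>2 =
     (let \<gamma> = (\<lambda>i :: nat. if i = 1 then \<gamma>\<^sub>1 else \<gamma>\<^sub>2); \<gamma>' = (\<lambda>i. \<gamma> (3 - i)) in
      \<Sum>(\<sigma>\<^sub>1, \<sigma>\<^sub>2, \<sigma>\<^sub>3) \<in> {1, 2} \<times> {1, 2} \<times> {1, 2}.
          Beta (\<gamma> \<sigma>\<^sub>1 + 1) (- \<gamma> \<sigma>\<^sub>1 - \<gamma>' \<sigma>\<^sub>3 - 1)
        * Beta (\<gamma>' \<sigma>\<^sub>1 + 1) (- \<gamma>' \<sigma>\<^sub>1 - \<gamma> \<sigma>\<^sub>2 - 1)
        * Beta (\<gamma>' \<sigma>\<^sub>2 + 1) (- \<gamma>' \<sigma>\<^sub>2 - \<gamma> \<sigma>\<^sub>3 - 1)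
        * Beta (\<gamma>' \<sigma>\<^sub>1 + \<gamma> \<sigma>\<^sub>2 + 2) (\<gamma>' \<sigma>\<^sub>2 + \<gamma> \<sigma>\<^sub>3 + 2))"

definition F\<^sub>3 :: "real \<Rightarrow> real \<Rightarrow> real" where
  "F\<^sub>3 \<gamma>\<^sub>1 \<gamma>\<^sub>2 = beta_bracket \<gamma>\<^sub>1 \<gamma>\<^sub>2 powr (- (3 / 2))"

end

theory Submission
  imports Defs
begin

text \<open>
  For a symmetric kernel \<open>f\<close> the integral \<open>Z\<close> of \<open>f\<close> has second moment \<open>2 \<parallel>f\<parallel>\<^sup>2\<close> and third moment
  \<open>8 tr f\<^sup>3\<close>, where \<open>tr f\<^sup>3\<close> is the integral of \<open>f (x, y) f (y, z) f (z, x)\<close>. Both hold for step functions,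
  by adding the independent Gaussian variables one at a time; the same induction bounds the fourth moment
  of a step integral by 27 times the square of its second moment, so that third moments pass to the
  \<open>L\<^sup>2\<close> limit. As the cyclic integral is trilinear and bounded by the product of the \<open>L\<^sup>2\<close> norms, it passes
  to the limit too.

  The Rosenblatt kernel is an integral over \<open>s\<close> of products of functions of one variable, so Tonelli's theorem
  turns its traces into integrals over \<open>s, t, u\<close> of products of one-dimensional overlaps
  \<open>\<integral> (s - y)\<^sub>+ powr \<alpha> * (t - y)\<^sub>+ powr \<beta> dy\<close>, which are Beta values times powers of \<open>\<bar>t - s\<bar>\<close>. The resulting
  integrands are symmetric, so it suffices to integrate over \<open>s < t < u\<close>, where one more Beta integral remains.
\<close>

section \<open>Moments of quadratic forms in independent Gaussian variables\<close>

text \<open>The integral is a version picked by a choice operator, so nothing is known of it until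
  some version exists. That takes the density of off-diagonal step functions in L2 of the plane,
  including functions that do not vanish near the diagonal, and the completeness of L2 of the
  probability space. As the version picked is unknown, the moments are proved for every version.

  The kernel is infinite on a part of the diagonal, and its square integrability is not known
  beforehand. As it is nonnegative, both traces can be computed with values in [0, \<infinity>],
  where Tonelli's theorem asks for measurability only; the finite value of the trace of the square
  then proves square integrability. The condition
  \<open>\<gamma>\<^sub>1 + \<gamma>\<^sub>2 > - 3 / 2\<close> makes the last integral there, that
  of \<open>(t - s) powr (2 * (\<gamma>\<^sub>1 + \<gamma>\<^sub>2) + 2)\<close> over
  \<open>s < t\<close>, converge.

  In a cycle every point brings both exponents, one on either side. The total power of the gaps is
  therefore the same for all choices of indices: the last integrations give one common denominator,
  which goes into \<open>F\<^sub>1\<close>, and only Beta values are left for the sum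
  \<open>F\<^sub>2\<close>.\<close>

definition fourth_integrable :: "'a measure \<Rightarrow> ('a \<Rightarrow> real) \<Rightarrow> bool" where
  "fourth_integrable M f \<longleftrightarrow> f \<in> borel_measurable M \<and> integrable M (\<lambda>\<omega>. f \<omega> ^ 4)"

lemma fourth_integrable_measurable: "fourth_integrable M f \<Longrightarrow> f \<in> borel_measurable M"
  by (simp add: fourth_integrable_def)

lemma power4_add_le: "((x::real) + y) ^ 4 \<le> 8 * x ^ 4 + 8 * y ^ 4"
proof -
  have "(x + y)\<^sup>2 \<le> 2 * (x\<^sup>2 + y\<^sup>2)"
    using zero_le_power2[of "x - y"] by (simp add: power2_eq_square algebra_simps)
  then have "((x + y)\<^sup>2)\<^sup>2 \<le> (2 * (x\<^sup>2 + y\<^sup>2))\<^sup>2"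
    by (intro power_mono) auto
  also have "\<dots> \<le> 8 * (x\<^sup>2)\<^sup>2 + 8 * (y\<^sup>2)\<^sup>2"
    using zero_le_power2[of "x\<^sup>2 - y\<^sup>2"] by (simp add: power2_eq_square algebra_simps)
  finally show ?thesis by simp
qed

text \<open>Only integrability is to follow, so the constants are generous; the arithmetic-geometric
  mean inequality would give a quarter of the right-hand side.\<close>

lemma abs_prod4_le: "\<bar>(a::real) * b * c * d\<bar> \<le> a ^ 4 + b ^ 4 + c ^ 4 + d ^ 4"
proof -
  have *: "\<bar>x * y\<bar> \<le> (x\<^sup>2 + y\<^sup>2) / 2" for x y :: real
    using sum_squares_bound[of x y] sum_squares_bound[of "-x" y] by (auto simp: abs_le_iff)
  have sq: "((a\<^sup>2 + b\<^sup>2) / 2)\<^sup>2 \<le> (a ^ 4 + b ^ 4) / 2" for a b :: real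
    using zero_le_power2[of "a\<^sup>2 - b\<^sup>2"] by (simp add: power2_eq_square power4_eq_xxxx algebra_simps)
  have pq: "p * q \<le> (p\<^sup>2 + q\<^sup>2) / 2" for p q :: real
    using zero_le_power2[of "p - q"] by (simp add: power2_diff)
  have "\<bar>a * b * c * d\<bar> = \<bar>a * b\<bar> * \<bar>c * d\<bar>" by (simp add: abs_mult)
  also have "\<dots> \<le> ((a\<^sup>2 + b\<^sup>2) / 2) * ((c\<^sup>2 + d\<^sup>2) / 2)"
    using *[of a b] *[of c d] by (intro mult_mono) auto
  also have "\<dots> \<le> (((a\<^sup>2 + b\<^sup>2) / 2)\<^sup>2 + ((c\<^sup>2 + d\<^sup>2) / 2)\<^sup>2) / 2"
    by (rule pq)
  also have "\<dots> \<le> (a ^ 4 + b ^ 4) / 2 + (c ^ 4 + d ^ 4) / 2"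
  proof -
    have "(p + q) / 2 \<le> p' + q'" if "p \<le> p'" "q \<le> q'" "0 \<le> p" "0 \<le> q" for p q p' q' :: real
      using that by simp
    from this[OF sq[of a b] sq[of c d]] show ?thesis by simp
  qed
  also have "\<dots> \<le> a ^ 4 + b ^ 4 + c ^ 4 + d ^ 4"
  proof -
    have "(p + q) / 2 + (r + s) / 2 \<le> p + q + r + s" if "0 \<le> p" "0 \<le> q" "0 \<le> r" "0 \<le> s" for p q r s :: real
      using that by (simp add: field_simps)
    then show ?thesis by simp
  qed
  finally show ?thesis .
qed

lemma fourth_integrable_add: assumes "fourth_integrable M f" "fourth_integrable M g" shows "fourth_integrable M (\<lambda>\<omega>. f \<omega> + g \<omega>)"
proof -
  have [measurable]: "f \<in> borel_measurable M" "g \<in> borel_measurable M"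
    using assms by (auto simp: fourth_integrable_def)
  have "norm ((f \<omega> + g \<omega>) ^ 4) \<le> norm (8 * f \<omega> ^ 4 + 8 * g \<omega> ^ 4)" for \<omega>
    using power4_add_le[of "f \<omega>" "g \<omega>"] by simp
  then have "integrable M (\<lambda>\<omega>. (f \<omega> + g \<omega>) ^ 4)"
    using assms
    by - (rule Bochner_Integration.integrable_bound[where f="\<lambda>\<omega>. 8 * f \<omega> ^ 4 + 8 * g \<omega> ^ 4"], simp_all add: fourth_integrable_def)
  then show ?thesis by (simp add: fourth_integrable_def)
qed

lemma fourth_integrable_cmult: assumes "fourth_integrable M f" shows "fourth_integrable M (\<lambda>\<omega>. c * f \<omega>)"
  using assms by (auto simp: fourth_integrable_def power_mult_distrib)

text \<open>Expanding a moment up to the fourth leaves, beside a power of the last variable,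
  products of at most four linear or quadratic forms. On a probability space shorter products are
  padded with the constant 1.\<close>

lemma integrable_prod4:
  assumes "fourth_integrable M f" "fourth_integrable M g" "fourth_integrable M h" "fourth_integrable M k"
  shows "integrable M (\<lambda>\<omega>. f \<omega> * g \<omega> * h \<omega> * k \<omega>)"
proof -
  have [measurable]: "f \<in> borel_measurable M" "g \<in> borel_measurable M" "h \<in> borel_measurable M" "k \<in> borel_measurable M"
    using assms by (auto simp: fourth_integrable_def)
  have "norm (f \<omega> * g \<omega> * h \<omega> * k \<omega>) \<le> norm (f \<omega> ^ 4 + g \<omega> ^ 4 + h \<omega> ^ 4 + k \<omega> ^ 4)" for \<omega>
    unfolding real_norm_def by (rule order_trans[OF abs_prod4_le abs_ge_self])
  then show ?thesis
    using assms
    by - (rule Bochner_Integration.integrable_bound[where f="\<lambda>\<omega>. f \<omega> ^ 4 + g \<omega> ^ 4 + h \<omega> ^ 4 + k \<omega> ^ 4"], simp_all add: fourth_integrable_def)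
qed

context prob_space
begin

lemma fourth_integrable_const: "fourth_integrable M (\<lambda>\<omega>. c)"
  by (simp add: fourth_integrable_def)

lemma integrable_prod1: "fourth_integrable M f \<Longrightarrow> integrable M f"
  using integrable_prod4[of M f "\<lambda>_. 1" "\<lambda>_. 1" "\<lambda>_. 1"] fourth_integrable_const[of 1] by simp

lemma integrable_prod2: "fourth_integrable M f \<Longrightarrow> fourth_integrable M g \<Longrightarrow> integrable M (\<lambda>\<omega>. f \<omega> * g \<omega>)"
  using integrable_prod4[of M f g "\<lambda>_. 1" "\<lambda>_. 1"] fourth_integrable_const[of 1] by simp

lemma integrable_prod3: "fourth_integrable M f \<Longrightarrow> fourth_integrable M g \<Longrightarrow> fourth_integrable M h \<Longrightarrow> integrable M (\<lambda>\<omega>. f \<omega> * g \<omega> * h \<omega>)"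
  using integrable_prod4[of M f g h "\<lambda>_. 1"] fourth_integrable_const[of 1] by simp

end

section \<open>Linear and quadratic forms, and their moments\<close>

definition lin :: "nat \<Rightarrow> (nat \<Rightarrow> real) \<Rightarrow> (nat \<Rightarrow> real) \<Rightarrow> real" where
  "lin n c x = (\<Sum>i<n. c i * x i)"

definition quad :: "nat \<Rightarrow> (nat \<Rightarrow> nat \<Rightarrow> real) \<Rightarrow> (nat \<Rightarrow> real) \<Rightarrow> real" where
  "quad n b x = (\<Sum>i<n. \<Sum>j<n. b i j * x i * x j)"

lemma lin_0 [simp]: "lin 0 c x = 0" by (simp add: lin_def)
lemma quad_0 [simp]: "quad 0 c x = 0" by (simp add: quad_def)

lemma lin_Suc: "lin (Suc n) c x = lin n c x + c n * x n"
  by (simp add: lin_def)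

text \<open>The engine of every induction below: as the diagonal vanishes, \<open>x n\<close> enters
  only to the first power, and by symmetry its row and column merge into twice one linear form in
  the earlier variables.\<close>

lemma quad_Suc:
  assumes "\<And>i j. b i j = b j i" "\<And>i. b i i = 0"
  shows "quad (Suc n) b x = quad n b x + 2 * x n * lin n (b n) x"
proof -
  have "quad (Suc n) b x = quad n b x + (\<Sum>i<n. b i n * x i * x n) + (\<Sum>j<n. b n j * x n * x j)"
    by (simp add: quad_def sum.distrib assms(2))
  also have "(\<Sum>i<n. b i n * x i * x n) = (\<Sum>j<n. b n j * x n * x j)"
    by (intro sum.cong) (auto simp: assms(1)[of _ n])
  also have "\<dots> = x n * lin n (b n) x"
    by (simp add: lin_def sum_distrib_left mult_ac)
  finally show ?thesis by simp
qed

text \<open>A form of order \<open>n\<close> depends on the first \<open>n\<close> coordinates only;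
  \<open>indep_mult\<close> takes this as invariance under \<open>restrict\<close>.\<close>

lemma lin_restrict [simp]: "lin n c (restrict x {..<n}) = lin n c x"
  by (simp add: lin_def)
lemma quad_restrict [simp]: "quad n c (restrict x {..<n}) = quad n c x"
  by (simp add: quad_def)

lemma lin_measurable [measurable]: "lin n c \<in> borel_measurable (PiM {..<n} (\<lambda>_. borel))"
  unfolding lin_def by measurable
lemma quad_measurable [measurable]: "quad n c \<in> borel_measurable (PiM {..<n} (\<lambda>_. borel))"
  unfolding quad_def by measurable

text \<open>Four moments are fixed rather than the law, so that cells of measure 0, whose variables
  are almost surely 0 and have no density, are covered with \<open>v i = 0\<close>.\<close>

locale gaussian_like_family = prob_space M for M :: "'a measure" +
  fixes X :: "nat \<Rightarrow> 'a \<Rightarrow> real" and v :: "nat \<Rightarrow> real" and N :: nat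
  assumes indep: "indep_vars (\<lambda>_. borel) X {..<N}"
    and mom1: "i < N \<Longrightarrow> has_bochner_integral M (\<lambda>\<omega>. X i \<omega>) 0"
    and mom2: "i < N \<Longrightarrow> has_bochner_integral M (\<lambda>\<omega>. X i \<omega> ^ 2) (v i)"
    and mom3: "i < N \<Longrightarrow> has_bochner_integral M (\<lambda>\<omega>. X i \<omega> ^ 3) 0"
    and mom4: "i < N \<Longrightarrow> has_bochner_integral M (\<lambda>\<omega>. X i \<omega> ^ 4) (3 * (v i)\<^sup>2)"
begin

abbreviation Xv :: "'a \<Rightarrow> nat \<Rightarrow> real" where "Xv \<omega> \<equiv> (\<lambda>i. X i \<omega>)"

lemma X_measurable: "i < N \<Longrightarrow> X i \<in> borel_measurable M"
  using indep by (auto simp: indep_vars_def)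

lemma v_nonneg: "i < N \<Longrightarrow> 0 \<le> v i"
  using has_bochner_integral_integral_eq[OF mom2] by (metis integral_nonneg_AE AE_I2 zero_le_power2)

text \<open>The restrictions of the family to \<open>{n}\<close> and to \<open>{..<n}\<close> are
  independent blocks; \<open>f\<close> sees the first and, by its invariance under
  \<open>restrict\<close>, \<open>g\<close> sees only the second.\<close>

lemma indep_mult:
  fixes f :: "real \<Rightarrow> real" and g :: "(nat \<Rightarrow> real) \<Rightarrow> real"
  assumes n: "n < N"
    and [measurable]: "g \<in> borel_measurable (PiM {..<n} (\<lambda>_. borel))" "f \<in> borel_measurable borel"
    and g: "\<And>x. g (restrict x {..<n}) = g x"
    and hf: "has_bochner_integral M (\<lambda>\<omega>. f (X n \<omega>)) a"
    and hg: "has_bochner_integral M (\<lambda>\<omega>. g (Xv \<omega>)) b"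
  shows "has_bochner_integral M (\<lambda>\<omega>. f (X n \<omega>) * g (Xv \<omega>)) (a * b)"
proof -
  have "indep_var (PiM {n} (\<lambda>_. borel)) (\<lambda>\<omega>. restrict (Xv \<omega>) {n}) (PiM {..<n} (\<lambda>_. borel)) (\<lambda>\<omega>. restrict (Xv \<omega>) {..<n})"
    by (rule indep_var_restrict[OF indep]) (use n in auto)
  then have iv: "indep_var borel ((\<lambda>x. f (x n)) \<circ> (\<lambda>\<omega>. restrict (Xv \<omega>) {n})) borel (g \<circ> (\<lambda>\<omega>. restrict (Xv \<omega>) {..<n}))"
    by (rule indep_var_compose) measurable
  have iv': "indep_var borel (\<lambda>\<omega>. f (X n \<omega>)) borel (\<lambda>\<omega>. g (Xv \<omega>))"
    using iv by (simp add: comp_def g)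
  show ?thesis
    using indep_var_lebesgue_integral[OF iv'] indep_var_integrable[OF iv'] hf hg
    by (simp add: has_bochner_integral_iff)
qed

lemma indep_mult_power1:
  fixes g :: "(nat \<Rightarrow> real) \<Rightarrow> real"
  assumes "n < N" "g \<in> borel_measurable (PiM {..<n} (\<lambda>_. borel))" "\<And>x. g (restrict x {..<n}) = g x"
    "integrable M (\<lambda>\<omega>. g (Xv \<omega>))"
  shows "has_bochner_integral M (\<lambda>\<omega>. X n \<omega> * g (Xv \<omega>)) 0"
  using indep_mult[OF assms(1,2) _ assms(3), of "\<lambda>x. x" 0] mom1[OF assms(1)] assms(4)
  by (auto simp: has_bochner_integral_iff)

lemma indep_mult_power2:
  fixes g :: "(nat \<Rightarrow> real) \<Rightarrow> real"
  assumes "n < N" "g \<in> borel_measurable (PiM {..<n} (\<lambda>_. borel))" "\<And>x. g (restrict x {..<n}) = g x"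
    "has_bochner_integral M (\<lambda>\<omega>. g (Xv \<omega>)) b"
  shows "has_bochner_integral M (\<lambda>\<omega>. X n \<omega> ^ 2 * g (Xv \<omega>)) (v n * b)"
  by (rule indep_mult[OF assms(1,2) _ assms(3), of "\<lambda>x. x ^ 2" "v n" b]) (use mom2[OF assms(1)] assms(4) in auto)

lemma indep_mult_power3:
  fixes g :: "(nat \<Rightarrow> real) \<Rightarrow> real"
  assumes "n < N" "g \<in> borel_measurable (PiM {..<n} (\<lambda>_. borel))" "\<And>x. g (restrict x {..<n}) = g x"
    "integrable M (\<lambda>\<omega>. g (Xv \<omega>))"
  shows "has_bochner_integral M (\<lambda>\<omega>. X n \<omega> ^ 3 * g (Xv \<omega>)) 0"
  using indep_mult[OF assms(1,2) _ assms(3), of "\<lambda>x. x ^ 3" 0] mom3[OF assms(1)] assms(4)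
  by (auto simp: has_bochner_integral_iff)

lemma indep_mult_power4:
  fixes g :: "(nat \<Rightarrow> real) \<Rightarrow> real"
  assumes "n < N" "g \<in> borel_measurable (PiM {..<n} (\<lambda>_. borel))" "\<And>x. g (restrict x {..<n}) = g x"
    "has_bochner_integral M (\<lambda>\<omega>. g (Xv \<omega>)) b"
  shows "has_bochner_integral M (\<lambda>\<omega>. X n \<omega> ^ 4 * g (Xv \<omega>)) (3 * (v n)\<^sup>2 * b)"
  by (rule indep_mult[OF assms(1,2) _ assms(3), of "\<lambda>x. x ^ 4" "3 * (v n)\<^sup>2" b]) (use mom4[OF assms(1)] assms(4) in auto)

lemma fourth_integrable_X: "i < N \<Longrightarrow> fourth_integrable M (X i)"
  using mom4[of i] X_measurable[of i] by (auto simp: fourth_integrable_def has_bochner_integral_iff)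

lemma fourth_integrable_lin: "n \<le> N \<Longrightarrow> fourth_integrable M (\<lambda>\<omega>. lin n c (Xv \<omega>))"
proof (induction n)
  case 0 then show ?case using fourth_integrable_const[of 0] by simp
next
  case (Suc n)
  then have "fourth_integrable M (\<lambda>\<omega>. lin n c (Xv \<omega>))" "fourth_integrable M (X n)" using fourth_integrable_X by auto
  then show ?case unfolding lin_Suc by (intro fourth_integrable_add fourth_integrable_cmult)
qed

text \<open>A product of two functions with finite fourth moments need not have one; here the
  factors are independent, so that the fourth moments multiply.\<close>

lemma fourth_integrable_X_lin:
  assumes "n < N" shows "fourth_integrable M (\<lambda>\<omega>. X n \<omega> * lin n c (Xv \<omega>))"
proof -
  have L: "fourth_integrable M (\<lambda>\<omega>. lin n c (Xv \<omega>))" using fourth_integrable_lin assms by simp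
  then have "has_bochner_integral M (\<lambda>\<omega>. (lin n c (Xv \<omega>)) ^ 4) (expectation (\<lambda>\<omega>. (lin n c (Xv \<omega>)) ^ 4))"
    by (auto simp: fourth_integrable_def has_bochner_integral_iff)
  from indep_mult_power4[OF assms, of "\<lambda>x. (lin n c x) ^ 4", OF _ _ this]
  have "integrable M (\<lambda>\<omega>. (X n \<omega> * lin n c (Xv \<omega>)) ^ 4)"
    by (simp add: power_mult_distrib has_bochner_integral_iff)
  moreover have "(\<lambda>\<omega>. X n \<omega> * lin n c (Xv \<omega>)) \<in> borel_measurable M"
    using X_measurable[OF assms] fourth_integrable_measurable[OF L] by measurable
  ultimately show ?thesis by (simp add: fourth_integrable_def)
qed

lemma has_bochner_integral_rewrite:
  "has_bochner_integral M f a \<Longrightarrow> (\<And>x. f x = g x) \<Longrightarrow> a = b \<Longrightarrow> has_bochner_integral M g b"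
  using has_bochner_integral_cong[of M M f g a b] by simp

lemma E_lin2:
  "n \<le> N \<Longrightarrow> has_bochner_integral M (\<lambda>\<omega>. lin n c (Xv \<omega>) * lin n d (Xv \<omega>)) (\<Sum>i<n. c i * d i * v i)"
proof (induction n)
  case 0 then show ?case by (simp add: has_bochner_integral_zero)
next
  case (Suc n)
  then have n: "n < N" "n \<le> N" by auto
  let ?L = "\<lambda>c \<omega>. lin n c (Xv \<omega>)"
  note IH = Suc.IH[OF n(2)]
  have t: "has_bochner_integral M (\<lambda>\<omega>. X n \<omega> * ?L c \<omega>) 0" for c
    by (rule indep_mult_power1[OF n(1), of "lin n c"]) (use integrable_prod1[OF fourth_integrable_lin[OF n(2)]] in auto)
  show ?case
    by (rule has_bochner_integral_rewrite[OF has_bochner_integral_add[OF IH has_bochner_integral_add[OF has_bochner_integral_mult_right[OF t[of c], of "d n"]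
       has_bochner_integral_add[OF has_bochner_integral_mult_right[OF t[of d], of "c n"] has_bochner_integral_mult_right[OF mom2[OF n(1)], of "c n * d n"]]]]])
      (auto simp: lin_Suc algebra_simps power2_eq_square)
qed

text \<open>The odd powers of \<open>X n\<close> vanish. With \<open>l\<close> the sum up to
  \<open>n\<close>, \<open>c = c n\<close> and \<open>v = v n\<close>, the even ones give
  \<open>3 * l^2 + 6 * c^2 * v * l + 3 * c^4 * v^2\<close>, three times a complete square because
  the fourth moment has its Gaussian value.\<close>

lemma E_lin4:
  "n \<le> N \<Longrightarrow> has_bochner_integral M (\<lambda>\<omega>. lin n c (Xv \<omega>) ^ 4) (3 * (\<Sum>i<n. (c i)\<^sup>2 * v i)\<^sup>2)"
proof (induction n)
  case 0 then show ?case by (simp add: has_bochner_integral_zero)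
next
  case (Suc n)
  then have n: "n < N" "n \<le> N" by auto
  let ?L = "\<lambda>\<omega>. lin n c (Xv \<omega>)"
  note IH = Suc.IH[OF n(2)]
  note L = fourth_integrable_lin[OF n(2), of c]
  have t1: "has_bochner_integral M (\<lambda>\<omega>. X n \<omega> * ?L \<omega> ^ 3) 0"
    by (rule indep_mult_power1[OF n(1), of "\<lambda>x. lin n c x ^ 3"]) (use integrable_prod3[OF L L L] in \<open>auto simp: power3_eq_cube\<close>)
  have t2: "has_bochner_integral M (\<lambda>\<omega>. X n \<omega> ^ 2 * ?L \<omega> ^ 2) (v n * (\<Sum>i<n. (c i)\<^sup>2 * v i))"
    by (rule indep_mult_power2[OF n(1), of "\<lambda>x. lin n c x ^ 2"]) (use E_lin2[OF n(2), of c c] in \<open>auto simp: power2_eq_square\<close>)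
  have t3: "has_bochner_integral M (\<lambda>\<omega>. X n \<omega> ^ 3 * ?L \<omega>) 0"
    by (rule indep_mult_power3[OF n(1), of "lin n c"]) (use integrable_prod1[OF L] in auto)
  have "has_bochner_integral M (\<lambda>\<omega>. ?L \<omega> ^ 4 + ((4 * c n) * (X n \<omega> * ?L \<omega> ^ 3) + ((6 * (c n)\<^sup>2) * (X n \<omega> ^ 2 * ?L \<omega> ^ 2)
     + ((4 * (c n)^3) * (X n \<omega> ^ 3 * ?L \<omega>) + (c n)^4 * X n \<omega> ^ 4))))
    (3 * (\<Sum>i<n. (c i)\<^sup>2 * v i)\<^sup>2 + ((4 * c n) * 0 + ((6 * (c n)\<^sup>2) * (v n * (\<Sum>i<n. (c i)\<^sup>2 * v i))
     + ((4 * (c n)^3) * 0 + (c n)^4 * (3 * (v n)\<^sup>2)))))" (is "has_bochner_integral M ?f ?v")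
    by (intro has_bochner_integral_add has_bochner_integral_mult_right IH t1 t2 t3 mom4 n)
  then show ?case
  proof (rule has_bochner_integral_rewrite)
    fix \<omega> show "?f \<omega> = lin (Suc n) c (Xv \<omega>) ^ 4"
      unfolding lin_Suc by (simp add: power4_eq_xxxx power3_eq_cube power2_eq_square algebra_simps)
  next
    show "?v = 3 * (\<Sum>i<Suc n. (c i)\<^sup>2 * v i)\<^sup>2"
      by (simp add: power4_eq_xxxx power3_eq_cube power2_eq_square algebra_simps)
  qed
qed

lemma fourth_integrable_quad:
  assumes "\<And>i j. b i j = b j i" "\<And>i. b i i = 0"
  shows "n \<le> N \<Longrightarrow> fourth_integrable M (\<lambda>\<omega>. quad n b (Xv \<omega>))"
proof (induction n)
  case 0 then show ?case using fourth_integrable_const[of 0] by simp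
next
  case (Suc n)
  then have "fourth_integrable M (\<lambda>\<omega>. quad n b (Xv \<omega>) + 2 * (X n \<omega> * lin n (b n) (Xv \<omega>)))"
    by (intro fourth_integrable_add fourth_integrable_cmult fourth_integrable_X_lin) auto
  then show ?case by (simp add: quad_Suc[OF assms] mult.assoc)
qed

context
  fixes b :: "nat \<Rightarrow> nat \<Rightarrow> real"
  assumes b_sym: "\<And>i j. b i j = b j i" and b_diag: "\<And>i. b i i = 0"
begin

lemmas quad_Suc' = quad_Suc[of b, OF b_sym b_diag]
lemmas fourth_integrable_quad' = fourth_integrable_quad[of b, OF b_sym b_diag]

lemma E_quad: "n \<le> N \<Longrightarrow> has_bochner_integral M (\<lambda>\<omega>. quad n b (Xv \<omega>)) 0"
proof (induction n)
  case 0 then show ?case by (simp add: has_bochner_integral_zero)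
next
  case (Suc n)
  then have n: "n < N" "n \<le> N" by auto
  have t: "has_bochner_integral M (\<lambda>\<omega>. X n \<omega> * lin n (b n) (Xv \<omega>)) 0"
    by (rule indep_mult_power1[OF n(1), of "lin n (b n)"]) (use integrable_prod1[OF fourth_integrable_lin[OF n(2)]] in auto)
  show ?case
    by (rule has_bochner_integral_rewrite[OF has_bochner_integral_add[OF Suc.IH[OF n(2)] has_bochner_integral_mult_right[OF t, of 2]]])
      (auto simp: quad_Suc')
qed

lemma E_quad2:
  "n \<le> N \<Longrightarrow> has_bochner_integral M (\<lambda>\<omega>. quad n b (Xv \<omega>) ^ 2) (2 * (\<Sum>i<n. \<Sum>j<n. (b i j)\<^sup>2 * v i * v j))"
proof (induction n)
  case 0 then show ?case by (simp add: has_bochner_integral_zero)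
next
  case (Suc n)
  then have n: "n < N" "n \<le> N" by auto
  let ?L = "\<lambda>\<omega>. lin n (b n) (Xv \<omega>)"
  let ?S = "\<lambda>\<omega>. quad n b (Xv \<omega>)"
  let ?l = "\<Sum>i<n. (b n i)\<^sup>2 * v i"
  have t1: "has_bochner_integral M (\<lambda>\<omega>. X n \<omega> * (?S \<omega> * ?L \<omega>)) 0"
    by (rule indep_mult_power1[OF n(1), of "\<lambda>x. quad n b x * lin n (b n) x"])
      (use integrable_prod2[OF fourth_integrable_quad'[OF n(2)] fourth_integrable_lin[OF n(2), of "b n"]] in auto)
  have t2: "has_bochner_integral M (\<lambda>\<omega>. X n \<omega> ^ 2 * ?L \<omega> ^ 2) (v n * ?l)"
    by (rule indep_mult_power2[OF n(1), of "\<lambda>x. lin n (b n) x ^ 2"]) (use E_lin2[OF n(2), of "b n" "b n"] in \<open>auto simp: power2_eq_square\<close>)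
  have "has_bochner_integral M (\<lambda>\<omega>. ?S \<omega> ^ 2 + (4 * (X n \<omega> * (?S \<omega> * ?L \<omega>)) + 4 * (X n \<omega> ^ 2 * ?L \<omega> ^ 2)))
    (2 * (\<Sum>i<n. \<Sum>j<n. (b i j)\<^sup>2 * v i * v j) + (4 * 0 + 4 * (v n * ?l)))" (is "has_bochner_integral M ?f ?v")
    by (intro has_bochner_integral_add has_bochner_integral_mult_right Suc.IH t1 t2 n)
  then show ?case
  proof (rule has_bochner_integral_rewrite)
    fix \<omega> show "?f \<omega> = quad (Suc n) b (Xv \<omega>) ^ 2"
      unfolding quad_Suc' by (simp add: power2_eq_square algebra_simps)
  next
    \<comment> \<open>The new row and the new column of \<open>b\<close> each contribute
      \<open>v n * ?l\<close>; their sum, doubled, is the \<open>4 * (v n * ?l)\<close> of the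
      expansion.\<close>
    have "(\<Sum>i<n. (b i n)\<^sup>2 * v i * v n) = v n * ?l" "(\<Sum>j<n. (b n j)\<^sup>2 * v n * v j) = v n * ?l"
      by (simp_all add: sum_distrib_left mult_ac b_sym[of _ n])
    then show "?v = 2 * (\<Sum>i<Suc n. \<Sum>j<Suc n. (b i j)\<^sup>2 * v i * v j)"
      by (simp add: sum.distrib b_diag)
  qed
qed

text \<open>Serves \<open>E_quad3\<close>, whose expansion contains \<open>?S * ?L ^ 2\<close> with
  \<open>?L\<close> the linear form of row \<open>n\<close>. The coefficients \<open>c\<close> are
  free because they stay fixed during the induction, while the row \<open>b n\<close> changes from
  step to step.\<close>

lemma E_quad_lin2:
  "n \<le> N \<Longrightarrow> has_bochner_integral M (\<lambda>\<omega>. quad n b (Xv \<omega>) * lin n c (Xv \<omega>) ^ 2)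
     (2 * (\<Sum>i<n. \<Sum>j<n. b i j * c i * c j * v i * v j))"
proof (induction n)
  case 0 then show ?case by (simp add: has_bochner_integral_zero)
next
  case (Suc n)
  then have n: "n < N" "n \<le> N" by auto
  let ?L = "\<lambda>\<omega>. lin n c (Xv \<omega>)"
  let ?K = "\<lambda>\<omega>. lin n (b n) (Xv \<omega>)"
  let ?S = "\<lambda>\<omega>. quad n b (Xv \<omega>)"
  let ?l = "\<Sum>i<n. b n i * c i * v i"
  note LL = fourth_integrable_quad'[OF n(2)] fourth_integrable_lin[OF n(2), of c] fourth_integrable_lin[OF n(2), of "b n"]
  have t1: "has_bochner_integral M (\<lambda>\<omega>. X n \<omega> * (?S \<omega> * ?L \<omega>)) 0"
    by (rule indep_mult_power1[OF n(1), of "\<lambda>x. quad n b x * lin n c x"])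
      (use integrable_prod2[OF LL(1,2)] in auto)
  have t2: "has_bochner_integral M (\<lambda>\<omega>. X n \<omega> ^ 2 * ?S \<omega>) (v n * 0)"
    by (rule indep_mult_power2[OF n(1), of "\<lambda>x. quad n b x"]) (use E_quad[OF n(2)] in auto)
  have t3: "has_bochner_integral M (\<lambda>\<omega>. X n \<omega> * (?K \<omega> * ?L \<omega> * ?L \<omega>)) 0"
    by (rule indep_mult_power1[OF n(1), of "\<lambda>x. lin n (b n) x * lin n c x * lin n c x"])
      (use integrable_prod3[OF LL(3,2,2)] in auto)
  have t4: "has_bochner_integral M (\<lambda>\<omega>. X n \<omega> ^ 2 * (?K \<omega> * ?L \<omega>)) (v n * ?l)"
    by (rule indep_mult_power2[OF n(1), of "\<lambda>x. lin n (b n) x * lin n c x"]) (use E_lin2[OF n(2), of "b n" c] in auto)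
  have t5: "has_bochner_integral M (\<lambda>\<omega>. X n \<omega> ^ 3 * ?K \<omega>) 0"
    by (rule indep_mult_power3[OF n(1), of "lin n (b n)"]) (use integrable_prod1[OF LL(3)] in auto)
  have "has_bochner_integral M (\<lambda>\<omega>. ?S \<omega> * ?L \<omega> ^ 2 + ((2 * c n) * (X n \<omega> * (?S \<omega> * ?L \<omega>)) + ((c n)\<^sup>2 * (X n \<omega> ^ 2 * ?S \<omega>)
      + (2 * (X n \<omega> * (?K \<omega> * ?L \<omega> * ?L \<omega>)) + ((4 * c n) * (X n \<omega> ^ 2 * (?K \<omega> * ?L \<omega>)) + (2 * (c n)\<^sup>2) * (X n \<omega> ^ 3 * ?K \<omega>))))))
    (2 * (\<Sum>i<n. \<Sum>j<n. b i j * c i * c j * v i * v j) + ((2 * c n) * 0 + ((c n)\<^sup>2 * (v n * 0) + (2 * 0 + ((4 * c n) * (v n * ?l) + (2 * (c n)\<^sup>2) * 0)))))" (is "has_bochner_integral M ?f ?v")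
    by (intro has_bochner_integral_add has_bochner_integral_mult_right Suc.IH t1 t2 t3 t4 t5 n)
  then show ?case
  proof (rule has_bochner_integral_rewrite)
    fix \<omega> show "?f \<omega> = quad (Suc n) b (Xv \<omega>) * lin (Suc n) c (Xv \<omega>) ^ 2"
      unfolding quad_Suc' lin_Suc by (simp add: power2_eq_square power3_eq_cube algebra_simps)
  next
    have "(\<Sum>i<n. b i n * c i * c n * v i * v n) = c n * (v n * ?l)" "(\<Sum>j<n. b n j * c n * c j * v n * v j) = c n * (v n * ?l)"
      by (simp_all add: sum_distrib_left mult_ac b_sym[of _ n])
    then show "?v = 2 * (\<Sum>i<Suc n. \<Sum>j<Suc n. b i j * c i * c j * v i * v j)"
      by (simp add: sum.distrib b_diag)
  qed
qed

text \<open>Beside the cube of the old form only the term with \<open>X n ^ 2\<close> survives, with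
  expectation \<open>24 * (v n * ?l)\<close>. On the other side the index \<open>n\<close> takes one
  of three places in the cycle, each worth \<open>8 * (v n * ?l)\<close>; it cannot take two, since
  any two places are neighbours and \<open>b n n = 0\<close>.\<close>

lemma E_quad3:
  "n \<le> N \<Longrightarrow> has_bochner_integral M (\<lambda>\<omega>. quad n b (Xv \<omega>) ^ 3)
     (8 * (\<Sum>i<n. \<Sum>j<n. \<Sum>k<n. b i j * b j k * b k i * v i * v j * v k))"
proof (induction n)
  case 0 then show ?case by (simp add: has_bochner_integral_zero)
next
  case (Suc n)
  then have n: "n < N" "n \<le> N" by auto
  let ?L = "\<lambda>\<omega>. lin n (b n) (Xv \<omega>)"
  let ?S = "\<lambda>\<omega>. quad n b (Xv \<omega>)"
  let ?l = "\<Sum>i<n. \<Sum>j<n. b i j * b n i * b n j * v i * v j"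
  let ?q = "\<Sum>i<n. \<Sum>j<n. \<Sum>k<n. b i j * b j k * b k i * v i * v j * v k"
  note LL = fourth_integrable_quad'[OF n(2)] fourth_integrable_lin[OF n(2), of "b n"]
  have t1: "has_bochner_integral M (\<lambda>\<omega>. X n \<omega> * (?S \<omega> * ?S \<omega> * ?L \<omega>)) 0"
    by (rule indep_mult_power1[OF n(1), of "\<lambda>x. quad n b x * quad n b x * lin n (b n) x"])
      (use integrable_prod3[OF LL(1,1,2)] in auto)
  have t2: "has_bochner_integral M (\<lambda>\<omega>. X n \<omega> ^ 2 * (?S \<omega> * ?L \<omega> ^ 2)) (v n * (2 * ?l))"
    by (rule indep_mult_power2[OF n(1), of "\<lambda>x. quad n b x * lin n (b n) x ^ 2"]) (use E_quad_lin2[OF n(2), of "b n"] in auto)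
  have t3: "has_bochner_integral M (\<lambda>\<omega>. X n \<omega> ^ 3 * (?L \<omega> * ?L \<omega> * ?L \<omega>)) 0"
    by (rule indep_mult_power3[OF n(1), of "\<lambda>x. lin n (b n) x * lin n (b n) x * lin n (b n) x"]) (use integrable_prod3[OF LL(2,2,2)] in auto)
  have "has_bochner_integral M (\<lambda>\<omega>. ?S \<omega> ^ 3 + (6 * (X n \<omega> * (?S \<omega> * ?S \<omega> * ?L \<omega>))
      + (12 * (X n \<omega> ^ 2 * (?S \<omega> * ?L \<omega> ^ 2)) + 8 * (X n \<omega> ^ 3 * (?L \<omega> * ?L \<omega> * ?L \<omega>)))))
    (8 * ?q + (6 * 0 + (12 * (v n * (2 * ?l)) + 8 * 0)))" (is "has_bochner_integral M ?f ?v")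
    by (intro has_bochner_integral_add has_bochner_integral_mult_right Suc.IH t1 t2 t3 n)
  then show ?case
  proof (rule has_bochner_integral_rewrite)
    fix \<omega> show "?f \<omega> = quad (Suc n) b (Xv \<omega>) ^ 3"
      unfolding quad_Suc' by (simp add: power2_eq_square power3_eq_cube algebra_simps)
  next
    have e1: "(\<Sum>i<n. \<Sum>j<n. b i j * b j n * b n i * v i * v j * v n) = v n * ?l"
      unfolding sum_distrib_left by (intro sum.cong refl) (simp add: mult_ac b_sym[of _ n])
    have e2: "(\<Sum>i<n. \<Sum>k<n. b i n * b n k * b k i * v i * v n * v k) = v n * ?l"
      unfolding sum_distrib_left
    proof (intro sum.cong refl)
      fix i k show "b i n * b n k * b k i * v i * v n * v k = v n * (b i k * b n i * b n k * v i * v k)"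
        using b_sym[of i n] b_sym[of k i] by simp
    qed
    have e3: "(\<Sum>j<n. \<Sum>k<n. b n j * b j k * b k n * v n * v j * v k) = v n * ?l"
      unfolding sum_distrib_left by (intro sum.cong refl) (simp add: mult_ac b_sym[of _ n])
    show "?v =
      8 * (\<Sum>i<Suc n. \<Sum>j<Suc n. \<Sum>k<Suc n. b i j * b j k * b k i * v i * v j * v k)"
      using e1 e2 e3 by (simp add: sum.distrib b_diag)
  qed
qed

text \<open>
  By Cauchy-Schwarz the mixed term of the induction step is at most that of the square of
  \<open>?q n + 2 * v n * ?l\<close>, which is the new value of \<open>?q\<close>. This is where the constant 27 comes from.
\<close>

lemma E_quad4_le:
  "n \<le> N \<Longrightarrow> expectation (\<lambda>\<omega>. quad n b (Xv \<omega>) ^ 4) \<le> 27 * (2 * (\<Sum>i<n. \<Sum>j<n. (b i j)\<^sup>2 * v i * v j))\<^sup>2"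
proof (induction n)
  case 0 then show ?case by (simp add: has_bochner_integral_zero)
next
  case (Suc n)
  then have n: "n < N" "n \<le> N" by auto
  let ?L = "\<lambda>\<omega>. lin n (b n) (Xv \<omega>)"
  let ?S = "\<lambda>\<omega>. quad n b (Xv \<omega>)"
  let ?l = "\<Sum>i<n. (b n i)\<^sup>2 * v i"
  let ?q = "\<lambda>n. \<Sum>i<n. \<Sum>j<n. (b i j)\<^sup>2 * v i * v j"
  let ?E4 = "expectation (\<lambda>\<omega>. ?S \<omega> ^ 4)"
  let ?E22 = "expectation (\<lambda>\<omega>. ?S \<omega> ^ 2 * ?L \<omega> ^ 2)"
  note LL = fourth_integrable_quad'[OF n(2)] fourth_integrable_lin[OF n(2), of "b n"]
  have v: "0 \<le> v n" using v_nonneg n by auto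
  have l: "0 \<le> ?l" by (intro sum_nonneg mult_nonneg_nonneg v_nonneg) (use n in auto)
  have q: "0 \<le> ?q n" by (intro sum_nonneg mult_nonneg_nonneg v_nonneg) (use n in auto)
  have IH: "?E4 \<le> 27 * (2 * ?q n)\<^sup>2" using Suc.IH n by simp
  have i22: "integrable M (\<lambda>\<omega>. ?S \<omega> ^ 2 * ?L \<omega> ^ 2)"
    using integrable_prod4[OF LL(1,1,2,2)] by (simp add: power2_eq_square mult.assoc)
  have i4: "integrable M (\<lambda>\<omega>. ?S \<omega> ^ 4)" "integrable M (\<lambda>\<omega>. ?L \<omega> ^ 4)"
    using LL by (auto simp: fourth_integrable_def)
  have EL: "expectation (\<lambda>\<omega>. ?L \<omega> ^ 4) = 3 * ?l\<^sup>2"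
    using E_lin4[OF n(2), of "b n"] by (simp add: has_bochner_integral_iff)
  have E22: "?E22 \<le> 18 * (?q n * ?l)"
  proof -
    \<comment> \<open>The square of \<open>s * ?L^2 - ?S^2\<close> has nonnegative expectation:
      Cauchy-Schwarz before \<open>s\<close> is optimised.\<close>
    have key: "2 * (s * ?E22) \<le> s\<^sup>2 * (3 * ?l\<^sup>2) + ?E4" for s
    proof -
      have "expectation (\<lambda>\<omega>. (2 * s) * (?S \<omega> ^ 2 * ?L \<omega> ^ 2)) \<le> expectation (\<lambda>\<omega>. s\<^sup>2 * ?L \<omega> ^ 4 + ?S \<omega> ^ 4)"
      proof (rule integral_mono)
        fix \<omega>
        show "(2 * s) * (?S \<omega> ^ 2 * ?L \<omega> ^ 2) \<le> s\<^sup>2 * ?L \<omega> ^ 4 + ?S \<omega> ^ 4"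
          using zero_le_power2[of "s * ?L \<omega> ^ 2 - ?S \<omega> ^ 2"]
          by (simp add: power2_eq_square power4_eq_xxxx algebra_simps)
      qed (use i22 i4 in simp_all)
      then show ?thesis using i22 i4 EL by (simp add: algebra_simps)
    qed
    show ?thesis
    proof (cases "?l = 0 \<or> ?q n = 0")
      case False
      then have pos: "0 < ?l" "0 < ?q n" using l q by auto
      \<comment> \<open>With this \<open>s\<close> both summands get the same bound
        \<open>108 * (?q n)^2\<close>, the second one through the induction hypothesis.\<close>
      define s where "s = 6 * ?q n / ?l"
      have "2 * (s * ?E22) \<le> s\<^sup>2 * (3 * ?l\<^sup>2) + 27 * (2 * ?q n)\<^sup>2" using key[of s] IH by linarith
      also have "\<dots> = 2 * (s * (18 * (?q n * ?l)))"
        using pos by (simp add: s_def field_simps power2_eq_square)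
      finally show ?thesis using pos by (simp add: s_def field_simps)
    next
      case True
      have E0: "0 \<le> ?E22" by (intro integral_nonneg_AE AE_I2) simp
      \<comment> \<open>The optimal \<open>s\<close> would be infinite for \<open>?l = 0\<close> and
        0 for \<open>?q n = 0\<close>; a large or a small enough \<open>s\<close> refutes a positive
        \<open>?E22\<close>.\<close>
      have "?E22 \<le> 0"
      proof (rule ccontr)
        assume "\<not> ?E22 \<le> 0"
        then have p: "?E22 > 0" by simp
        show False
        proof (cases "?l = 0")
          case True
          have "2 * ((?E4 + 1) / ?E22 * ?E22) \<le> ?E4" using key[of "(?E4 + 1) / ?E22"] unfolding True by simp
          then have "2 * (?E4 + 1) \<le> ?E4" using p by simp
          moreover have "0 \<le> ?E4" by (intro integral_nonneg_AE AE_I2) simp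
          moreover have "\<not> 2 * (e + 1) \<le> e" if "0 \<le> e" for e :: real using that by simp
          ultimately show False by blast
        next
          case False
          then have q0: "?q n = 0" using True by auto
          have l0: "?l > 0" using l False by simp
          have E40: "?E4 \<le> 0" using IH unfolding q0 by simp
          define s where "s = ?E22 / (3 * ?l\<^sup>2)"
          have "2 * (s * ?E22) \<le> s\<^sup>2 * (3 * ?l\<^sup>2)" using key[of s] E40 by linarith
          also have "\<dots> = s * ?E22" using l0 by (simp add: s_def power2_eq_square)
          finally have "s * ?E22 \<le> 0" by simp
          moreover have "0 < s * ?E22" using p l0 by (simp add: s_def)
          ultimately show False by simp
        qed
      qed
      then show ?thesis using l q by (auto intro: order_trans[OF _ mult_nonneg_nonneg])
    qed
  qed
  have t1: "has_bochner_integral M (\<lambda>\<omega>. X n \<omega> * (?S \<omega> * ?S \<omega> * ?S \<omega> * ?L \<omega>)) 0"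
    by (rule indep_mult_power1[OF n(1), of "\<lambda>x. quad n b x * quad n b x * quad n b x * lin n (b n) x"])
      (use integrable_prod4[OF LL(1,1,1,2)] in auto)
  have t2: "has_bochner_integral M (\<lambda>\<omega>. X n \<omega> ^ 2 * (?S \<omega> ^ 2 * ?L \<omega> ^ 2)) (v n * ?E22)"
    by (rule indep_mult_power2[OF n(1), of "\<lambda>x. quad n b x ^ 2 * lin n (b n) x ^ 2"]) (use i22 in \<open>auto simp: has_bochner_integral_iff\<close>)
  have t3: "has_bochner_integral M (\<lambda>\<omega>. X n \<omega> ^ 3 * (?S \<omega> * ?L \<omega> * ?L \<omega> * ?L \<omega>)) 0"
    by (rule indep_mult_power3[OF n(1), of "\<lambda>x. quad n b x * lin n (b n) x * lin n (b n) x * lin n (b n) x"]) (use integrable_prod4[OF LL(1,2,2,2)] in auto)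
  have t4: "has_bochner_integral M (\<lambda>\<omega>. X n \<omega> ^ 4 * ?L \<omega> ^ 4) (3 * (v n)\<^sup>2 * (3 * ?l\<^sup>2))"
    by (rule indep_mult_power4[OF n(1), of "\<lambda>x. lin n (b n) x ^ 4"]) (use E_lin4[OF n(2), of "b n"] in auto)
  have t0: "has_bochner_integral M (\<lambda>\<omega>. ?S \<omega> ^ 4) ?E4" using i4 by (simp add: has_bochner_integral_iff)
  have "has_bochner_integral M (\<lambda>\<omega>. ?S \<omega> ^ 4 + (8 * (X n \<omega> * (?S \<omega> * ?S \<omega> * ?S \<omega> * ?L \<omega>))
      + (24 * (X n \<omega> ^ 2 * (?S \<omega> ^ 2 * ?L \<omega> ^ 2)) + (32 * (X n \<omega> ^ 3 * (?S \<omega> * ?L \<omega> * ?L \<omega> * ?L \<omega>))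
      + 16 * (X n \<omega> ^ 4 * ?L \<omega> ^ 4)))))
    (?E4 + (8 * 0 + (24 * (v n * ?E22) + (32 * 0 + 16 * (3 * (v n)\<^sup>2 * (3 * ?l\<^sup>2))))))" (is "has_bochner_integral M ?f _")
    by (intro has_bochner_integral_add has_bochner_integral_mult_right t0 t1 t2 t3 t4)
  then have "has_bochner_integral M (\<lambda>\<omega>. quad (Suc n) b (Xv \<omega>) ^ 4) (?E4 + 24 * (v n * ?E22) + 144 * (v n * ?l)\<^sup>2)"
  proof (rule has_bochner_integral_rewrite)
    fix \<omega> show "?f \<omega> = quad (Suc n) b (Xv \<omega>) ^ 4"
      unfolding quad_Suc' by (simp add: power2_eq_square power3_eq_cube power4_eq_xxxx algebra_simps)
  qed (simp add: power_mult_distrib)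
  then have "expectation (\<lambda>\<omega>. quad (Suc n) b (Xv \<omega>) ^ 4) = ?E4 + 24 * (v n * ?E22) + 144 * (v n * ?l)\<^sup>2"
    by (rule has_bochner_integral_integral_eq)
  also have "\<dots> \<le> 27 * (2 * ?q n)\<^sup>2 + 24 * (v n * (18 * (?q n * ?l))) + 144 * (v n * ?l)\<^sup>2"
    by (intro add_mono IH mult_left_mono E22 v) auto
  \<comment> \<open>With \<open>C\<close> for 27, Cauchy-Schwarz gives the mixed term the
    coefficient 48 sqrt(3 C) on the left, against 16 C on the right. The two agree at C = 27, and
    the last terms are then 144 against 432.\<close>
  also have "\<dots> \<le> 27 * (2 * (?q n + 2 * (v n * ?l)))\<^sup>2"
  proof -
    have "27 * (2 * q)\<^sup>2 + 24 * (v * (18 * (q * l))) + 144 * (v * l)\<^sup>2 \<le> 27 * (2 * (q + 2 * (v * l)))\<^sup>2" for q v l :: real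
      using zero_le_power2[of "v * l"] by (simp add: power2_eq_square algebra_simps)
    then show ?thesis by blast
  qed
  also have "?q n + 2 * (v n * ?l) = ?q (Suc n)"
  proof -
    have "(\<Sum>i<n. (b i n)\<^sup>2 * v i * v n) = v n * ?l" "(\<Sum>j<n. (b n j)\<^sup>2 * v n * v j) = v n * ?l"
      by (simp_all add: sum_distrib_left mult_ac b_sym[of _ n])
    then show ?thesis by (simp add: sum.distrib b_diag)
  qed
  finally show ?case .
qed

end

end

section \<open>Square norms and cyclic integrals\<close>

definition sq_norm :: "'a measure \<Rightarrow> ('a \<Rightarrow> real) \<Rightarrow> ennreal" where
  "sq_norm M f = (\<integral>\<^sup>+x. ennreal ((f x)\<^sup>2) \<partial>M)"

text \<open>The weight \<open>c\<close> stays free; Cauchy-Schwarz follows by optimising it.\<close>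

lemma ennreal_young:
  fixes f g :: ennreal and c :: real
  assumes c: "0 < c"
  shows "2 * (f * g) \<le> ennreal (1 / c) * f\<^sup>2 + ennreal c * g\<^sup>2"
proof (cases f; cases g)
  fix x y assume fg: "f = ennreal x" "0 \<le> x" "g = ennreal y" "0 \<le> y"
  have "2 * (x * y) \<le> 1 / c * x\<^sup>2 + c * y\<^sup>2"
    using zero_le_power2[of "x - c * y"] c by (simp add: field_simps power2_eq_square)
  then have "ennreal (2 * (x * y)) \<le> ennreal (1 / c * x\<^sup>2 + c * y\<^sup>2)" by (rule ennreal_leI)
  also have "\<dots> = ennreal (1 / c) * f\<^sup>2 + ennreal c * g\<^sup>2"
    using fg c by (simp only: ennreal_plus ennreal_mult ennreal_power[symmetric] zero_le_power2 divide_nonneg_nonneg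
       less_imp_le zero_le_one mult_nonneg_nonneg)
  finally show ?thesis using fg by (simp add: ennreal_mult)
qed (use c in \<open>auto simp: power2_eq_square ennreal_mult_top ennreal_top_mult\<close>)

lemma nn_integral_Cauchy_Schwarz:
  fixes f g :: "'a \<Rightarrow> ennreal"
  assumes [measurable]: "f \<in> borel_measurable M" "g \<in> borel_measurable M"
  shows "(\<integral>\<^sup>+x. f x * g x \<partial>M)\<^sup>2 \<le> (\<integral>\<^sup>+x. (f x)\<^sup>2 \<partial>M) * (\<integral>\<^sup>+x. (g x)\<^sup>2 \<partial>M)"
proof -
  let ?a = "\<integral>\<^sup>+x. (f x)\<^sup>2 \<partial>M" and ?b = "\<integral>\<^sup>+x. (g x)\<^sup>2 \<partial>M"
  have zero: "(\<integral>\<^sup>+x. u x * w x \<partial>M) = 0" if "(\<integral>\<^sup>+x. (u x)\<^sup>2 \<partial>M) = 0"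
    and [measurable]: "u \<in> borel_measurable M" "w \<in> borel_measurable M" for u w :: "'a \<Rightarrow> ennreal"
  proof -
    have "AE x in M. (u x)\<^sup>2 = 0" using that by (subst (asm) nn_integral_0_iff_AE) auto
    then have "AE x in M. u x * w x = 0" by (auto elim!: eventually_mono)
    then show ?thesis by (subst nn_integral_0_iff_AE) auto
  qed
  \<comment> \<open>Zero norms are split off first: in \<open>ennreal\<close> the product of 0 and
    infinity is 0, so an infinite norm makes the right-hand side infinite only if the other one is
    nonzero.\<close>
  consider "?a = 0" | "?b = 0" | "?a \<noteq> 0" "?b \<noteq> 0" "?a = top \<or> ?b = top"
    | "?a \<noteq> 0" "?b \<noteq> 0" "?a \<noteq> top" "?b \<noteq> top" by blast
  then show ?thesis
  proof cases
    case 1 then show ?thesis using zero[of f g] by simp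
  next
    case 2 then show ?thesis using zero[of g f] by (simp add: mult.commute)
  next
    case 3 then show ?thesis by (auto simp: ennreal_mult_top ennreal_top_mult ennreal_mult_eq_top_iff)
  next
    case 4
    obtain A where A: "?a = ennreal A" "0 < A" using 4 by (cases ?a) (auto simp: less_le)
    obtain B where B: "?b = ennreal B" "0 < B" using 4 by (cases ?b) (auto simp: less_le)
    \<comment> \<open>The weight for which both terms of \<open>ennreal_young\<close> integrate to
      \<open>sqrt (A * B)\<close>.\<close>
    define c where "c = sqrt (A / B)"
    have c: "0 < c" using A B by (simp add: c_def)
    have "2 * (\<integral>\<^sup>+x. f x * g x \<partial>M) = (\<integral>\<^sup>+x. 2 * (f x * g x) \<partial>M)"
      by (subst nn_integral_cmult) auto
    also have "\<dots> \<le> (\<integral>\<^sup>+x. ennreal (1 / c) * (f x)\<^sup>2 + ennreal c * (g x)\<^sup>2 \<partial>M)"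
      by (intro nn_integral_mono ennreal_young c)
    also have "\<dots> = ennreal (1 / c) * ennreal A + ennreal c * ennreal B"
      by (subst nn_integral_add) (auto simp: nn_integral_cmult A B)
    also have "\<dots> = ennreal (1 / c * A + c * B)"
      using A B c by (simp only: ennreal_plus ennreal_mult less_imp_le divide_nonneg_nonneg zero_le_one mult_nonneg_nonneg)
    also have "1 / c * A + c * B = 2 * sqrt (A * B)"
    proof -
      have "c = sqrt A / sqrt B" by (simp add: c_def real_sqrt_divide)
      moreover have "1 / (a / b) * (a * a) + a / b * (b * b) = 2 * (a * b)" if "a > 0" "b > 0" for a b :: real
        using that by (simp add: field_simps)
      from this[of "sqrt A" "sqrt B"] have "1 / (sqrt A / sqrt B) * A + sqrt A / sqrt B * B = 2 * (sqrt A * sqrt B)"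
        using A B by simp
      ultimately show ?thesis by (simp add: real_sqrt_mult)
    qed
    finally have "2 * (\<integral>\<^sup>+x. f x * g x \<partial>M) \<le> 2 * ennreal (sqrt (A * B))"
      using A B by (simp add: ennreal_mult)
    then have "(\<integral>\<^sup>+x. f x * g x \<partial>M) \<le> ennreal (sqrt (A * B))"
      by (subst (asm) ennreal_mult_le_mult_iff) auto
    then have "(\<integral>\<^sup>+x. f x * g x \<partial>M)\<^sup>2 \<le> (ennreal (sqrt (A * B)))\<^sup>2" by (intro power_mono) auto
    also have "\<dots> = ennreal ((sqrt (A * B))\<^sup>2)" by (rule ennreal_power) (use A B in auto)
    also have "\<dots> = ?a * ?b" using A B by (simp add: ennreal_mult)
    finally show ?thesis .
  qed
qed

text \<open>Cauchy-Schwarz bounds the squares of the integrals that have to vanish; this takes the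
  root.\<close>

lemma ennreal_power2_tendsto_0:
  fixes T :: "nat \<Rightarrow> ennreal"
  assumes "(\<lambda>k. (T k)\<^sup>2) \<longlonglongrightarrow> 0"
  shows "T \<longlonglongrightarrow> 0"
proof (rule order_tendstoI)
  fix a :: ennreal assume "0 < a"
  then have "0 < a\<^sup>2" by (simp add: power2_eq_square ennreal_zero_less_mult_iff)
  then have "\<forall>\<^sub>F k in sequentially. (T k)\<^sup>2 < a\<^sup>2" using order_tendstoD(2)[OF assms] by simp
  then show "\<forall>\<^sub>F k in sequentially. T k < a"
  proof eventually_elim
    case (elim k)
    then have "\<not> a \<le> T k" using power_mono[of a "T k" 2] by (auto simp: not_less[symmetric])
    then show ?case by (simp add: not_le)
  qed
qed auto

lemma ennreal_tendsto_0_le: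
  fixes f g :: "nat \<Rightarrow> ennreal"
  assumes "f \<longlonglongrightarrow> 0" "\<And>k. g k \<le> f k"
  shows "g \<longlonglongrightarrow> 0"
  by (rule tendsto_sandwich[of "\<lambda>_. 0" g _ f]) (use assms in auto)

text \<open>Squared norms take the place of norms, and the factor 2 that of the triangle inequality;
  only convergence and finiteness are at stake, for which constants are harmless.\<close>

lemma sq_norm_add:
  assumes [measurable]: "f \<in> borel_measurable M" "g \<in> borel_measurable M"
  shows "sq_norm M (\<lambda>x. f x + g x) \<le> 2 * sq_norm M f + 2 * sq_norm M g"
proof -
  have "(a + b)\<^sup>2 \<le> 2 * a\<^sup>2 + 2 * b\<^sup>2" for a b :: real
    using zero_le_power2[of "a - b"] by (simp add: power2_eq_square algebra_simps)
  then have "ennreal ((a + b)\<^sup>2) \<le> ennreal (2 * a\<^sup>2 + 2 * b\<^sup>2)" for a b :: real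
    by (rule ennreal_leI)
  moreover have "ennreal (2 * a\<^sup>2 + 2 * b\<^sup>2) = 2 * ennreal (a\<^sup>2) + 2 * ennreal (b\<^sup>2)" for a b :: real
    by (subst ennreal_plus) (simp_all add: ennreal_mult)
  ultimately have "ennreal ((a + b)\<^sup>2) \<le> 2 * ennreal (a\<^sup>2) + 2 * ennreal (b\<^sup>2)" for a b :: real
    by simp
  then have "sq_norm M (\<lambda>x. f x + g x) \<le> (\<integral>\<^sup>+x. 2 * ennreal ((f x)\<^sup>2) + 2 * ennreal ((g x)\<^sup>2) \<partial>M)"
    unfolding sq_norm_def by (intro nn_integral_mono)
  also have "\<dots> = 2 * sq_norm M f + 2 * sq_norm M g"
    unfolding sq_norm_def by (subst nn_integral_add) (auto simp: nn_integral_cmult)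
  finally show ?thesis .
qed

lemma sq_norm_minus_commute: "sq_norm M (\<lambda>x. f x - g x) = sq_norm M (\<lambda>x. g x - f x)"
  by (simp add: sq_norm_def power2_commute)

lemma sq_norm_triangle:
  assumes [measurable]: "f \<in> borel_measurable M" "g \<in> borel_measurable M" "h \<in> borel_measurable M"
  shows "sq_norm M (\<lambda>x. f x - h x) \<le> 2 * sq_norm M (\<lambda>x. f x - g x) + 2 * sq_norm M (\<lambda>x. g x - h x)"
  using sq_norm_add[of "\<lambda>x. f x - g x" M "\<lambda>x. g x - h x"] by simp

lemma sq_norm_cmult: "f \<in> borel_measurable M \<Longrightarrow> sq_norm M (\<lambda>x. c * f x) = ennreal (c\<^sup>2) * sq_norm M f"
  by (simp add: sq_norm_def power_mult_distrib ennreal_mult nn_integral_cmult)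

lemma sq_norm_abs: "(\<integral>\<^sup>+x. (ennreal \<bar>f x\<bar>)\<^sup>2 \<partial>M) = sq_norm M f"
  by (simp add: sq_norm_def ennreal_power)

lemma sq_norm_integrable:
  assumes "f \<in> borel_measurable M" "sq_norm M f < \<infinity>"
  shows "integrable M (\<lambda>x. (f x)\<^sup>2)"
  using assms unfolding sq_norm_def by (intro integrableI_nonneg) auto

lemma sq_norm_eq_integral:
  assumes "f \<in> borel_measurable M" "sq_norm M f < \<infinity>"
  shows "sq_norm M f = ennreal (\<integral>x. (f x)\<^sup>2 \<partial>M)"
  unfolding sq_norm_def by (rule nn_integral_eq_integral[OF sq_norm_integrable[OF assms]]) auto

lemma sq_norm_AE_cong: "AE x in M. f x = g x \<Longrightarrow> sq_norm M f = sq_norm M g"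
  unfolding sq_norm_def by (rule nn_integral_cong_AE) auto

lemma sq_norm_tendsto_finite:
  assumes [measurable]: "\<And>k. f k \<in> borel_measurable M" "g \<in> borel_measurable M"
    and lim: "(\<lambda>k. sq_norm M (\<lambda>x. f k x - g x)) \<longlonglongrightarrow> 0" and fin: "sq_norm M g < \<infinity>"
  shows "\<forall>\<^sub>F k in sequentially. sq_norm M (f k) < \<infinity> \<and> sq_norm M (f k) \<le> 2 * sq_norm M g + 2 \<and> sq_norm M (\<lambda>x. f k x - g x) < 1"
proof -
  have "\<forall>\<^sub>F k in sequentially. sq_norm M (\<lambda>x. f k x - g x) < 1" using order_tendstoD(2)[OF lim, of 1] by simp
  then show ?thesis
  proof eventually_elim
    case (elim k)
    have "sq_norm M (f k) \<le> 2 * sq_norm M g + 2 * sq_norm M (\<lambda>x. f k x - g x)"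
      using sq_norm_add[of g M "\<lambda>x. f k x - g x"] by simp
    also have "\<dots> \<le> 2 * sq_norm M g + 2 * 1" by (intro add_mono mult_left_mono) (use elim in auto)
    finally have *: "sq_norm M (f k) \<le> 2 * sq_norm M g + 2" by simp
    have "2 * sq_norm M g + 2 < \<infinity>" using fin by (simp add: ennreal_mult_less_top)
    then show ?case using elim * by (auto intro: le_less_trans[OF *])
  qed
qed

text \<open>As \<open>f^2 - g^2 = (f - g)^2 + 2 * (f - g) * g\<close>, the difference is bounded by
  the squared distance and a Cauchy-Schwarz product with the fixed norm of \<open>g\<close>.\<close>

lemma sq_norm_tendsto_integral:
  assumes [measurable]: "\<And>k. f k \<in> borel_measurable M" "g \<in> borel_measurable M"
    and lim: "(\<lambda>k. sq_norm M (\<lambda>x. f k x - g x)) \<longlonglongrightarrow> 0" and fin: "sq_norm M g < \<infinity>"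
    and fink: "\<And>k. sq_norm M (f k) < \<infinity>"
  shows "(\<lambda>k. \<integral>x. (f k x)\<^sup>2 \<partial>M) \<longlonglongrightarrow> (\<integral>x. (g x)\<^sup>2 \<partial>M)"
proof (rule tendsto_L1_int)
  show "integrable M (\<lambda>x. (g x)\<^sup>2)" "integrable M (\<lambda>x. (f k x)\<^sup>2)" for k
    using fin fink by (auto intro: sq_norm_integrable)
  let ?D = "\<lambda>k. sq_norm M (\<lambda>x. f k x - g x)"
  let ?c = "\<lambda>k. \<integral>\<^sup>+x. ennreal \<bar>f k x - g x\<bar> * ennreal \<bar>g x\<bar> \<partial>M"
  have "(\<lambda>k. ?D k * sq_norm M g) \<longlonglongrightarrow> 0 * sq_norm M g"
    using lim fin by (intro tendsto_mult_ennreal) auto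
  moreover have "(?c k)\<^sup>2 \<le> ?D k * sq_norm M g" for k
    using nn_integral_Cauchy_Schwarz[of "\<lambda>x. ennreal \<bar>f k x - g x\<bar>" M "\<lambda>x. ennreal \<bar>g x\<bar>"]
    by (simp add: sq_norm_abs)
  ultimately have "(\<lambda>k. (?c k)\<^sup>2) \<longlonglongrightarrow> 0"
    by - (rule ennreal_tendsto_0_le[where f="\<lambda>k. ?D k * sq_norm M g"], simp_all)
  then have c0: "?c \<longlonglongrightarrow> 0" by (rule ennreal_power2_tendsto_0)
  have "(\<lambda>k. ?D k + 2 * ?c k) \<longlonglongrightarrow> 0 + 2 * 0"
    by (intro tendsto_add lim ennreal_tendsto_cmult c0) auto
  then have lim0: "(\<lambda>k. ?D k + 2 * ?c k) \<longlonglongrightarrow> 0" by simp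
  show "(\<lambda>k. \<integral>\<^sup>+x. ennreal (norm ((f k x)\<^sup>2 - (g x)\<^sup>2)) \<partial>M) \<longlonglongrightarrow> 0"
  proof (rule ennreal_tendsto_0_le[OF lim0])
    fix k
    have "ennreal (norm ((f k x)\<^sup>2 - (g x)\<^sup>2)) \<le> ennreal ((f k x - g x)\<^sup>2) + 2 * (ennreal \<bar>f k x - g x\<bar> * ennreal \<bar>g x\<bar>)" for x
    proof -
      have "(f k x)\<^sup>2 - (g x)\<^sup>2 = (f k x - g x)\<^sup>2 + 2 * ((f k x - g x) * g x)"
        by (simp add: power2_eq_square algebra_simps)
      then have "norm ((f k x)\<^sup>2 - (g x)\<^sup>2) \<le> norm ((f k x - g x)\<^sup>2) + norm (2 * ((f k x - g x) * g x))"
        using norm_triangle_ineq by metis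
      then have "norm ((f k x)\<^sup>2 - (g x)\<^sup>2) \<le> (f k x - g x)\<^sup>2 + 2 * (\<bar>f k x - g x\<bar> * \<bar>g x\<bar>)"
        by (simp add: abs_mult)
      from ennreal_leI[OF this] show ?thesis by (simp add: ennreal_mult)
    qed
    then have "(\<integral>\<^sup>+x. ennreal (norm ((f k x)\<^sup>2 - (g x)\<^sup>2)) \<partial>M) \<le> (\<integral>\<^sup>+x. ennreal ((f k x - g x)\<^sup>2) + 2 * (ennreal \<bar>f k x - g x\<bar> * ennreal \<bar>g x\<bar>) \<partial>M)"
      by (intro nn_integral_mono)
    also have "\<dots> = ?D k + 2 * ?c k"
      unfolding sq_norm_def by (subst nn_integral_add) (auto simp: nn_integral_cmult)
    finally show "(\<integral>\<^sup>+x. ennreal (norm ((f k x)\<^sup>2 - (g x)\<^sup>2)) \<partial>M) \<le> ?D k + 2 * ?c k" .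
  qed
qed

section \<open>Cyclic integrals as a trilinear form on L2\<close>

lemma trilinear_bound:
  fixes f g h :: "'a \<times> 'a \<Rightarrow> ennreal"
  assumes L: "sigma_finite_measure L"
    and [measurable]: "f \<in> borel_measurable (L \<Otimes>\<^sub>M L)" "g \<in> borel_measurable (L \<Otimes>\<^sub>M L)" "h \<in> borel_measurable (L \<Otimes>\<^sub>M L)"
  shows "(\<integral>\<^sup>+x. \<integral>\<^sup>+y. \<integral>\<^sup>+z. f (x, y) * g (y, z) * h (z, x) \<partial>L \<partial>L \<partial>L)\<^sup>2
    \<le> (\<integral>\<^sup>+p. (f p)\<^sup>2 \<partial>(L \<Otimes>\<^sub>M L)) * ((\<integral>\<^sup>+p. (g p)\<^sup>2 \<partial>(L \<Otimes>\<^sub>M L)) * (\<integral>\<^sup>+p. (h p)\<^sup>2 \<partial>(L \<Otimes>\<^sub>M L)))"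
proof -
  interpret L: sigma_finite_measure L by fact
  interpret P: pair_sigma_finite L L by standard
  define I where "I = (\<lambda>(x, y). \<integral>\<^sup>+z. g (y, z) * h (z, x) \<partial>L)"
  define G where "G = (\<lambda>y. \<integral>\<^sup>+z. (g (y, z))\<^sup>2 \<partial>L)"
  define H where "H = (\<lambda>x. \<integral>\<^sup>+z. (h (z, x))\<^sup>2 \<partial>L)"
  have [measurable]: "I \<in> borel_measurable (L \<Otimes>\<^sub>M L)" "G \<in> borel_measurable L" "H \<in> borel_measurable L"
    unfolding I_def G_def H_def by measurable
  \<comment> \<open>Cauchy-Schwarz in \<open>z\<close> bounds the squared composition of
    \<open>g\<close> and \<open>h\<close> by a function of \<open>x\<close> times a function of
    \<open>y\<close>, so that its integral over the plane factors. Cauchy-Schwarz against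
    \<open>f\<close> does the rest.\<close>
  have I: "(I (x, y))\<^sup>2 \<le> H x * G y" if "x \<in> space L" "y \<in> space L" for x y
  proof -
    have [measurable]: "(\<lambda>z. g (y, z)) \<in> borel_measurable L" "(\<lambda>z. h (z, x)) \<in> borel_measurable L"
      using that by measurable
    show ?thesis using nn_integral_Cauchy_Schwarz[of "\<lambda>z. g (y, z)" L "\<lambda>z. h (z, x)"]
      by (simp add: I_def G_def H_def mult.commute)
  qed
  have "(\<integral>\<^sup>+x. \<integral>\<^sup>+y. \<integral>\<^sup>+z. f (x, y) * g (y, z) * h (z, x) \<partial>L \<partial>L \<partial>L) = (\<integral>\<^sup>+x. \<integral>\<^sup>+y. f (x, y) * I (x, y) \<partial>L \<partial>L)"
    by (intro nn_integral_cong) (simp add: I_def nn_integral_cmult[symmetric] mult.assoc)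
  also have "\<dots> = (\<integral>\<^sup>+p. f p * I p \<partial>(L \<Otimes>\<^sub>M L))"
    by (subst L.nn_integral_fst[symmetric]) auto
  finally have "(\<integral>\<^sup>+x. \<integral>\<^sup>+y. \<integral>\<^sup>+z. f (x, y) * g (y, z) * h (z, x) \<partial>L \<partial>L \<partial>L)\<^sup>2
    \<le> (\<integral>\<^sup>+p. (f p)\<^sup>2 \<partial>(L \<Otimes>\<^sub>M L)) * (\<integral>\<^sup>+p. (I p)\<^sup>2 \<partial>(L \<Otimes>\<^sub>M L))"
    using nn_integral_Cauchy_Schwarz[of f "L \<Otimes>\<^sub>M L" I] by simp
  also have "(\<integral>\<^sup>+p. (I p)\<^sup>2 \<partial>(L \<Otimes>\<^sub>M L)) = (\<integral>\<^sup>+x. \<integral>\<^sup>+y. (I (x, y))\<^sup>2 \<partial>L \<partial>L)"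
    by (subst L.nn_integral_fst[symmetric]) auto
  also have "\<dots> \<le> (\<integral>\<^sup>+x. \<integral>\<^sup>+y. H x * G y \<partial>L \<partial>L)"
    by (intro nn_integral_mono I) auto
  also have "\<dots> = (\<integral>\<^sup>+y. G y \<partial>L) * (\<integral>\<^sup>+x. H x \<partial>L)"
    by (simp add: nn_integral_cmult nn_integral_multc mult.commute)
  also have "(\<integral>\<^sup>+y. G y \<partial>L) = (\<integral>\<^sup>+p. (g p)\<^sup>2 \<partial>(L \<Otimes>\<^sub>M L))"
    unfolding G_def by (subst L.nn_integral_fst[symmetric]) auto
  also have "(\<integral>\<^sup>+x. H x \<partial>L) = (\<integral>\<^sup>+p. (h p)\<^sup>2 \<partial>(L \<Otimes>\<^sub>M L))"
    unfolding H_def by (subst P.nn_integral_snd[symmetric]) auto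
  finally show ?thesis by (simp add: mult_left_mono)
qed

text \<open>The integral of this function is the trace of the third power of the integral operator with kernel \<open>f\<close>.\<close>

definition cyclic_prod :: "('a \<times> 'a \<Rightarrow> real) \<Rightarrow> 'a \<times> 'a \<times> 'a \<Rightarrow> real" where
  "cyclic_prod f = (\<lambda>(x, y, z). f (x, y) * f (y, z) * f (z, x))"

lemma cyclic_prod_measurable [measurable]:
  assumes [measurable]: "f \<in> borel_measurable (L \<Otimes>\<^sub>M L)"
  shows "cyclic_prod f \<in> borel_measurable (L \<Otimes>\<^sub>M (L \<Otimes>\<^sub>M L))"
  unfolding cyclic_prod_def by measurable

lemma nn_integral_triple:
  fixes F :: "'a \<times> 'a \<times> 'a \<Rightarrow> ennreal"
  assumes L: "sigma_finite_measure L"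
    and [measurable]: "F \<in> borel_measurable (L \<Otimes>\<^sub>M (L \<Otimes>\<^sub>M L))"
  shows "(\<integral>\<^sup>+p. F p \<partial>(L \<Otimes>\<^sub>M (L \<Otimes>\<^sub>M L))) = (\<integral>\<^sup>+x. \<integral>\<^sup>+y. \<integral>\<^sup>+z. F (x, y, z) \<partial>L \<partial>L \<partial>L)"
proof -
  interpret L: sigma_finite_measure L by fact
  interpret P: pair_sigma_finite L L by standard
  have LL: "sigma_finite_measure (L \<Otimes>\<^sub>M L)" using L L by (rule sigma_finite_pair_measure)
  have "(\<integral>\<^sup>+p. F p \<partial>(L \<Otimes>\<^sub>M (L \<Otimes>\<^sub>M L))) = (\<integral>\<^sup>+x. \<integral>\<^sup>+q. F (x, q) \<partial>(L \<Otimes>\<^sub>M L) \<partial>L)"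
    by (subst sigma_finite_measure.nn_integral_fst[OF LL, symmetric]) auto
  also have "\<dots> = (\<integral>\<^sup>+x. \<integral>\<^sup>+y. \<integral>\<^sup>+z. F (x, y, z) \<partial>L \<partial>L \<partial>L)"
    by (intro nn_integral_cong, subst L.nn_integral_fst[symmetric]) auto
  finally show ?thesis .
qed

lemma cyclic_prod_integrable:
  assumes L: "sigma_finite_measure L"
    and [measurable]: "f \<in> borel_measurable (L \<Otimes>\<^sub>M L)" and fin: "sq_norm (L \<Otimes>\<^sub>M L) f < \<infinity>"
  shows "integrable (L \<Otimes>\<^sub>M (L \<Otimes>\<^sub>M L)) (cyclic_prod f)"
proof (rule integrableI_bounded)
  have "(\<integral>\<^sup>+p. ennreal (norm (cyclic_prod f p)) \<partial>(L \<Otimes>\<^sub>M (L \<Otimes>\<^sub>M L)))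
    = (\<integral>\<^sup>+x. \<integral>\<^sup>+y. \<integral>\<^sup>+z. ennreal \<bar>f (x, y)\<bar> * ennreal \<bar>f (y, z)\<bar> * ennreal \<bar>f (z, x)\<bar> \<partial>L \<partial>L \<partial>L)" (is "?l = ?r")
    by (subst nn_integral_triple[OF L]) (auto simp: cyclic_prod_def abs_mult ennreal_mult)
  moreover have "?r\<^sup>2 < \<infinity>"
  proof (rule le_less_trans)
    show "?r\<^sup>2 \<le> sq_norm (L \<Otimes>\<^sub>M L) f * (sq_norm (L \<Otimes>\<^sub>M L) f * sq_norm (L \<Otimes>\<^sub>M L) f)"
      using trilinear_bound[OF L, of "\<lambda>p. ennreal \<bar>f p\<bar>" "\<lambda>p. ennreal \<bar>f p\<bar>" "\<lambda>p. ennreal \<bar>f p\<bar>"] by (simp add: sq_norm_abs)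
    show "\<dots> < \<infinity>" using fin by (simp add: ennreal_mult_less_top)
  qed
  ultimately have "?l\<^sup>2 < \<infinity>" by simp
  then show "?l < \<infinity>" by (auto simp: power2_eq_square ennreal_mult_less_top)
qed measurable

text \<open>The factors are exchanged one at a time: each of the three resulting differences
  contains \<open>f k - g\<close> once and is controlled by \<open>trilinear_bound\<close>.\<close>

lemma cyclic_prod_tendsto:
  assumes L: "sigma_finite_measure L"
    and [measurable]: "\<And>k. f k \<in> borel_measurable (L \<Otimes>\<^sub>M L)" "g \<in> borel_measurable (L \<Otimes>\<^sub>M L)"
    and lim: "(\<lambda>k. sq_norm (L \<Otimes>\<^sub>M L) (\<lambda>x. f k x - g x)) \<longlonglongrightarrow> 0" and fin: "sq_norm (L \<Otimes>\<^sub>M L) g < \<infinity>"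
    and fink: "\<And>k. sq_norm (L \<Otimes>\<^sub>M L) (f k) < \<infinity>"
  shows "(\<lambda>k. \<integral>p. cyclic_prod (f k) p \<partial>(L \<Otimes>\<^sub>M (L \<Otimes>\<^sub>M L))) \<longlonglongrightarrow> (\<integral>p. cyclic_prod g p \<partial>(L \<Otimes>\<^sub>M (L \<Otimes>\<^sub>M L)))"
proof (rule tendsto_L1_int)
  show "integrable (L \<Otimes>\<^sub>M (L \<Otimes>\<^sub>M L)) (cyclic_prod g)" "integrable (L \<Otimes>\<^sub>M (L \<Otimes>\<^sub>M L)) (cyclic_prod (f k))" for k
    by (rule cyclic_prod_integrable[OF L _ fin], measurable) (rule cyclic_prod_integrable[OF L _ fink], measurable)
  let ?LL = "L \<Otimes>\<^sub>M L"
  let ?D = "\<lambda>k. sq_norm ?LL (\<lambda>x. f k x - g x)"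
  define d where "d k p = ennreal \<bar>f k p - g p\<bar>" for k p
  define F where "F k p = ennreal \<bar>f k p\<bar>" for k p
  define G where "G p = ennreal \<bar>g p\<bar>" for p
  have dm [measurable]: "d k \<in> borel_measurable ?LL" "F k \<in> borel_measurable ?LL" "G \<in> borel_measurable ?LL" for k
    unfolding d_def F_def G_def by measurable
  define T where "T a b c = (\<integral>\<^sup>+x. \<integral>\<^sup>+y. \<integral>\<^sup>+z. a (x, y) * b (y, z) * c (z, x) \<partial>L \<partial>L \<partial>L)" for a b c :: "'a \<times> 'a \<Rightarrow> ennreal"
  have T_eq: "T a b c = (\<integral>\<^sup>+p. (case p of (x, y, z) \<Rightarrow> a (x, y) * b (y, z) * c (z, x)) \<partial>(L \<Otimes>\<^sub>M ?LL))"
    if [measurable]: "a \<in> borel_measurable ?LL" "b \<in> borel_measurable ?LL" "c \<in> borel_measurable ?LL" for a b c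
    by (subst nn_integral_triple[OF L]) (auto simp: T_def)
  \<comment> \<open>A common bound for the squared norm of \<open>g\<close> and, eventually, those
    of the \<open>f k\<close>.\<close>
  define C where "C = 2 * sq_norm ?LL g + 2"
  have C: "C < \<infinity>" using fin by (simp add: C_def ennreal_mult_less_top ennreal_add_less_top)
  have gC: "sq_norm ?LL g \<le> C" unfolding C_def mult_2 add.assoc by (rule add_increasing2) simp_all
  have key: "(\<lambda>k. T (a k) (b k) (c k)) \<longlonglongrightarrow> 0"
    if "\<forall>\<^sub>F k in sequentially. (T (a k) (b k) (c k))\<^sup>2 \<le> ?D k * (C * C)" for a b c
  proof -
    have "(\<lambda>k. ?D k * (C * C)) \<longlonglongrightarrow> 0 * (C * C)"
      using lim C by (intro tendsto_mult_ennreal) (auto simp: ennreal_mult_eq_top_iff)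
    then have "(\<lambda>k. (T (a k) (b k) (c k))\<^sup>2) \<longlonglongrightarrow> 0"
      by - (rule tendsto_sandwich[of "\<lambda>_. 0" _ _ "\<lambda>k. ?D k * (C * C)"], use that in auto)
    then show ?thesis by (rule ennreal_power2_tendsto_0)
  qed
  have sd: "(\<integral>\<^sup>+p. (d k p)\<^sup>2 \<partial>?LL) = ?D k" "(\<integral>\<^sup>+p. (F k p)\<^sup>2 \<partial>?LL) = sq_norm ?LL (f k)" "(\<integral>\<^sup>+p. (G p)\<^sup>2 \<partial>?LL) = sq_norm ?LL g" for k
    unfolding d_def F_def G_def by (simp_all add: sq_norm_abs)
  have ev: "\<forall>\<^sub>F k in sequentially. sq_norm ?LL (f k) \<le> C"
    using sq_norm_tendsto_finite[OF assms(2,3) lim fin] unfolding C_def by eventually_elim auto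
  note tb = trilinear_bound[OF L, folded T_def]
  have T1: "(\<lambda>k. T (d k) (F k) (F k)) \<longlonglongrightarrow> 0"
  proof (rule key, use ev in eventually_elim)
    fix k assume *: "sq_norm ?LL (f k) \<le> C"
    have "(T (d k) (F k) (F k))\<^sup>2 \<le> ?D k * (sq_norm ?LL (f k) * sq_norm ?LL (f k))"
      using tb[of "d k" "F k" "F k"] by (simp add: sd mult_ac)
    also have "\<dots> \<le> ?D k * (C * C)" by (intro mult_left_mono mult_mono *) auto
    finally show "(T (d k) (F k) (F k))\<^sup>2 \<le> ?D k * (C * C)" .
  qed
  have T2: "(\<lambda>k. T G (d k) (F k)) \<longlonglongrightarrow> 0"
  proof (rule key, use ev in eventually_elim)
    fix k assume *: "sq_norm ?LL (f k) \<le> C"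
    have "(T G (d k) (F k))\<^sup>2 \<le> ?D k * (sq_norm ?LL g * sq_norm ?LL (f k))"
      using tb[of G "d k" "F k"] by (simp add: sd mult_ac)
    also have "\<dots> \<le> ?D k * (C * C)" by (intro mult_left_mono mult_mono gC *) auto
    finally show "(T G (d k) (F k))\<^sup>2 \<le> ?D k * (C * C)" .
  qed
  have T3: "(\<lambda>k. T G G (d k)) \<longlonglongrightarrow> 0"
  proof (rule key, intro always_eventually allI)
    fix k
    have "(T G G (d k))\<^sup>2 \<le> ?D k * (sq_norm ?LL g * sq_norm ?LL g)"
      using tb[of G G "d k"] by (simp add: sd mult_ac)
    also have "\<dots> \<le> ?D k * (C * C)" by (intro mult_left_mono mult_mono gC) auto
    finally show "(T G G (d k))\<^sup>2 \<le> ?D k * (C * C)" .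
  qed
  have "(\<lambda>k. T (d k) (F k) (F k) + T G (d k) (F k) + T G G (d k)) \<longlonglongrightarrow> 0 + 0 + 0"
    by (intro tendsto_add T1 T2 T3)
  then have lim0: "(\<lambda>k. T (d k) (F k) (F k) + T G (d k) (F k) + T G G (d k)) \<longlonglongrightarrow> 0" by simp
  show "(\<lambda>k. \<integral>\<^sup>+p. ennreal (norm (cyclic_prod (f k) p - cyclic_prod g p)) \<partial>(L \<Otimes>\<^sub>M ?LL)) \<longlonglongrightarrow> 0"
  proof (rule ennreal_tendsto_0_le[OF lim0])
    fix k
    have pw: "ennreal (norm (cyclic_prod (f k) (x, y, z) - cyclic_prod g (x, y, z))) \<le> d k (x, y) * F k (y, z) * F k (z, x)
      + G (x, y) * d k (y, z) * F k (z, x) + G (x, y) * G (y, z) * d k (z, x)" for x y z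
    proof -
      have "cyclic_prod (f k) (x, y, z) - cyclic_prod g (x, y, z) = (f k (x, y) - g (x, y)) * f k (y, z) * f k (z, x)
        + g (x, y) * (f k (y, z) - g (y, z)) * f k (z, x) + g (x, y) * g (y, z) * (f k (z, x) - g (z, x))"
        by (simp add: cyclic_prod_def algebra_simps)
      then have "norm (cyclic_prod (f k) (x, y, z) - cyclic_prod g (x, y, z)) \<le> \<bar>f k (x, y) - g (x, y)\<bar> * \<bar>f k (y, z)\<bar> * \<bar>f k (z, x)\<bar>
        + \<bar>g (x, y)\<bar> * \<bar>f k (y, z) - g (y, z)\<bar> * \<bar>f k (z, x)\<bar> + \<bar>g (x, y)\<bar> * \<bar>g (y, z)\<bar> * \<bar>f k (z, x) - g (z, x)\<bar>"
        by (simp only: real_norm_def abs_mult[symmetric])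
      from ennreal_leI[OF this] show ?thesis by (simp add: d_def F_def G_def ennreal_mult)
    qed
    have "(\<integral>\<^sup>+p. ennreal (norm (cyclic_prod (f k) p - cyclic_prod g p)) \<partial>(L \<Otimes>\<^sub>M ?LL)) \<le> (\<integral>\<^sup>+p. (case p of (x, y, z) \<Rightarrow> d k (x, y) * F k (y, z) * F k (z, x))
      + (case p of (x, y, z) \<Rightarrow> G (x, y) * d k (y, z) * F k (z, x)) + (case p of (x, y, z) \<Rightarrow> G (x, y) * G (y, z) * d k (z, x)) \<partial>(L \<Otimes>\<^sub>M ?LL))"
    proof (rule nn_integral_mono)
      fix p :: "'a \<times> 'a \<times> 'a"
      show "ennreal (norm (cyclic_prod (f k) p - cyclic_prod g p)) \<le> (case p of (x, y, z) \<Rightarrow> d k (x, y) * F k (y, z) * F k (z, x))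
      + (case p of (x, y, z) \<Rightarrow> G (x, y) * d k (y, z) * F k (z, x)) + (case p of (x, y, z) \<Rightarrow> G (x, y) * G (y, z) * d k (z, x))"
        by (rule prod_cases3[of p]) (simp only: prod.case pw)
    qed
    also have "\<dots> = T (d k) (F k) (F k) + T G (d k) (F k) + T G G (d k)"
      unfolding T_eq[OF dm(1) dm(2) dm(2)] T_eq[OF dm(3) dm(1) dm(2)] T_eq[OF dm(3) dm(3) dm(1)]
      by (subst nn_integral_add, measurable)+
    finally show "(\<integral>\<^sup>+p. ennreal (norm (cyclic_prod (f k) p - cyclic_prod g p)) \<partial>(L \<Otimes>\<^sub>M ?LL)) \<le> T (d k) (F k) (F k) + T G (d k) (F k) + T G G (d k)" .
  qed
qed

section \<open>Off-diagonal step functions\<close>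

declare sum_mult_indicator [simp del] sum_indicator_mult [simp del] sum_indicator_scaleR [simp del]

lemma finite_borel_sets_empty [simp]: "{} \<in> finite_borel_sets"
  by (simp add: finite_borel_sets_def)

lemma finite_borel_sets_borel: "A \<in> finite_borel_sets \<Longrightarrow> A \<in> sets borel"
  by (simp add: finite_borel_sets_def)

lemma finite_borel_sets_subset: "A \<in> finite_borel_sets \<Longrightarrow> B \<in> sets borel \<Longrightarrow> B \<subseteq> A \<Longrightarrow> B \<in> finite_borel_sets"
  using emeasure_mono[of B A lborel] by (auto simp: finite_borel_sets_def)

lemma finite_borel_sets_emeasure: "A \<in> finite_borel_sets \<Longrightarrow> emeasure lborel A = ennreal (measure lborel A)"
  by (auto simp: finite_borel_sets_def emeasure_eq_ennreal_measure)

lemma sum_indicator_cell: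
  fixes g :: "nat \<Rightarrow> real"
  assumes "disjoint_family_on A {..<n}" "i < n" "x \<in> A i"
  shows "(\<Sum>j<n. g j * indicator (A j) x) = g i"
proof -
  have "(\<Sum>j<n. g j * indicator (A j) x) = (\<Sum>j<n. if j = i then g j else 0)"
    using assms by (intro sum.cong) (auto simp: disjoint_family_on_def indicator_def)
  then show ?thesis using assms by simp
qed

lemma sum_indicator_outside:
  fixes g :: "nat \<Rightarrow> real"
  assumes "\<And>i. i < n \<Longrightarrow> x \<notin> A i"
  shows "(\<Sum>j<n. g j * indicator (A j) x) = 0"
  using assms by (intro sum.neutral) auto

lemma step_fun_alt:
  "step_fun (n, A, a) (x, y) = (\<Sum>i<n. (\<Sum>j<n. a i j * indicator (A j) y) * indicator (A i) x)"
  by (simp add: sum_distrib_left sum_distrib_right mult_ac)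

lemma step_fun_measurable [measurable]:
  assumes "h \<in> off_diag_steps"
  shows "step_fun h \<in> borel_measurable borel"
proof -
  obtain n A a where h: "h = (n, A, a)" by (cases h)
  have [measurable]: "i < n \<Longrightarrow> A i \<in> sets borel" for i
    using assms by (auto simp: h off_diag_steps_def finite_borel_sets_def)
  have "(\<lambda>p. (\<Sum>i<n. \<Sum>j<n. a i j * indicator (A i) (fst p) * indicator (A j) (snd p))) \<in> borel_measurable (borel \<Otimes>\<^sub>M borel)"
    by measurable
  also have "(\<lambda>p. (\<Sum>i<n. \<Sum>j<n. a i j * indicator (A i) (fst p) * indicator (A j) (snd p))) = step_fun h"
    by (auto simp: h)
  finally show ?thesis by (simp add: borel_prod)
qed

context
  fixes n :: nat and A :: "nat \<Rightarrow> real set" and a :: "nat \<Rightarrow> nat \<Rightarrow> real"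
  assumes h: "(n, A, a) \<in> off_diag_steps"
begin

lemma cells_disjoint: "disjoint_family_on A {..<n}"
  using h by (simp add: off_diag_steps_def)

lemma step_fun_cases:
  obtains (out1) "\<And>i. i < n \<Longrightarrow> x \<notin> A i" | (out2) "\<And>i. i < n \<Longrightarrow> y \<notin> A i"
  | (inside) i j where "i < n" "j < n" "x \<in> A i" "y \<in> A j"
  by blast

text \<open>The coefficients \<open>a'\<close> are free because squares and cyclic products of
  \<open>a\<close> occur as coefficients over the same cells.\<close>

lemma step_fun_inside:
  "i < n \<Longrightarrow> j < n \<Longrightarrow> x \<in> A i \<Longrightarrow> y \<in> A j \<Longrightarrow> step_fun (n, A, a') (x, y) = a' i j"
  unfolding step_fun_alt
  by (subst sum_indicator_cell[OF cells_disjoint], assumption+)+ (rule refl)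

lemma step_fun_out1: "(\<And>i. i < n \<Longrightarrow> x \<notin> A i) \<Longrightarrow> step_fun (n, A, a') (x, y) = 0"
  unfolding step_fun_alt by (rule sum_indicator_outside)

lemma step_fun_out2: "(\<And>i. i < n \<Longrightarrow> y \<notin> A i) \<Longrightarrow> step_fun (n, A, a') (x, y) = 0"
  unfolding step_fun_alt by (intro sum.neutral ballI) (auto intro: sum_indicator_outside)

text \<open>At every point at most one term of the double sum is nonzero, so squaring acts on the
  coefficients.\<close>

lemma step_fun_power2: "(step_fun (n, A, a) (x, y))\<^sup>2 = step_fun (n, A, \<lambda>i j. (a i j)\<^sup>2) (x, y)"
proof (cases rule: step_fun_cases[where x=x and y=y])
  case out1 then show ?thesis by (simp only: step_fun_out1[OF out1]) simp
next
  case out2 then show ?thesis by (simp only: step_fun_out2[OF out2]) simp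
next
  case (inside i j) then show ?thesis by (simp only: step_fun_inside)
qed

text \<open>Freezing the cell \<open>i\<close> of \<open>x\<close> leaves a step function of the
  other two variables, to which the facts on two variables apply.\<close>

lemma cyclic_prod_step_fun: "cyclic_prod (step_fun (n, A, a)) (x, y, z) =
   (\<Sum>i<n. step_fun (n, A, \<lambda>j k. a i j * a j k * a k i) (y, z) * indicator (A i) x)"
proof (cases "\<exists>i<n. x \<in> A i")
  case False
  then have out: "\<And>i. i < n \<Longrightarrow> x \<notin> A i" by blast
  show ?thesis unfolding cyclic_prod_def prod.case
    by (simp only: step_fun_out1[OF out] sum_indicator_outside[of n x A, OF out] mult_zero_left)
next
  case True
  then obtain i where i: "i < n" "x \<in> A i" by blast
  have *: "(\<Sum>i<n. step_fun (n, A, \<lambda>j k. a i j * a j k * a k i) (y, z) * indicator (A i) x) = step_fun (n, A, \<lambda>j k. a i j * a j k * a k i) (y, z)"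
    by (rule sum_indicator_cell[OF cells_disjoint i])
  show ?thesis unfolding * unfolding cyclic_prod_def prod.case
  proof (cases rule: step_fun_cases[where x=y and y=z])
    case out1 then show "step_fun (n, A, a) (x, y) * step_fun (n, A, a) (y, z) * step_fun (n, A, a) (z, x) = step_fun (n, A, \<lambda>j k. a i j * a j k * a k i) (y, z)"
      by (simp only: step_fun_out1[OF out1] mult_zero_left mult_zero_right)
  next
    case out2 then show "step_fun (n, A, a) (x, y) * step_fun (n, A, a) (y, z) * step_fun (n, A, a) (z, x) = step_fun (n, A, \<lambda>j k. a i j * a j k * a k i) (y, z)"
      by (simp only: step_fun_out2[OF out2] mult_zero_left mult_zero_right)
  next
    case (inside j k) then show "step_fun (n, A, a) (x, y) * step_fun (n, A, a) (y, z) * step_fun (n, A, a) (z, x) = step_fun (n, A, \<lambda>j k. a i j * a j k * a k i) (y, z)"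
      by (simp only: step_fun_inside[OF i(1) _ i(2)] step_fun_inside[OF _ i(1) _ i(2)] step_fun_inside)
  qed
qed

lemma cells_fbs: "i < n \<Longrightarrow> A i \<in> finite_borel_sets"
  using h by (simp add: off_diag_steps_def)

lemma cells_borel: "i < n \<Longrightarrow> A i \<in> sets borel"
  using cells_fbs finite_borel_sets_borel by blast

lemma nn_integral_step_fun:
  assumes "\<And>i j. 0 \<le> c i j"
  shows "(\<integral>\<^sup>+p. ennreal (step_fun (n, A, c) p) \<partial>lborel) = ennreal (\<Sum>i<n. \<Sum>j<n. c i j * measure lborel (A i) * measure lborel (A j))"
proof -
  note [measurable] = cells_borel
  have "(\<integral>\<^sup>+p. ennreal (step_fun (n, A, c) p) \<partial>lborel) = (\<integral>\<^sup>+p. ennreal (step_fun (n, A, c) p) \<partial>(lborel \<Otimes>\<^sub>M lborel))"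
    by (simp add: lborel_prod)
  also have "\<dots> = (\<integral>\<^sup>+p. (\<Sum>i<n. \<Sum>j<n. ennreal (c i j) * indicator (A i \<times> A j) p) \<partial>(lborel \<Otimes>\<^sub>M lborel))"
    using assms by (intro nn_integral_cong) (auto simp: sum_ennreal[symmetric] ennreal_mult ennreal_indicator[symmetric] indicator_times sum_nonneg mult.assoc
       simp del: sum_ennreal ennreal_indicator)
  also have "\<dots> = (\<Sum>i<n. \<Sum>j<n. ennreal (c i j) * (\<integral>\<^sup>+p. indicator (A i \<times> A j) p \<partial>(lborel \<Otimes>\<^sub>M lborel)))"
  proof (subst nn_integral_sum)
    show "(\<Sum>i<n. \<integral>\<^sup>+p. (\<Sum>j<n. ennreal (c i j) * indicator (A i \<times> A j) p) \<partial>(lborel \<Otimes>\<^sub>M lborel))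
      = (\<Sum>i<n. \<Sum>j<n. ennreal (c i j) * (\<integral>\<^sup>+p. indicator (A i \<times> A j) p \<partial>(lborel \<Otimes>\<^sub>M lborel)))"
      by (intro sum.cong refl, subst nn_integral_sum) (auto simp: nn_integral_cmult)
  qed auto
  also have "\<dots> = (\<Sum>i<n. \<Sum>j<n. ennreal (c i j * measure lborel (A i) * measure lborel (A j)))"
    using assms by (intro sum.cong refl) (simp add: lborel.emeasure_pair_measure_Times finite_borel_sets_emeasure cells_fbs ennreal_mult mult.assoc)
  also have "\<dots> = ennreal (\<Sum>i<n. \<Sum>j<n. c i j * measure lborel (A i) * measure lborel (A j))"
    using assms by (simp add: sum_nonneg)
  finally show ?thesis .
qed

lemma sq_norm_step_fun:
  "sq_norm lborel (step_fun (n, A, a)) = ennreal (\<Sum>i<n. \<Sum>j<n. (a i j)\<^sup>2 * measure lborel (A i) * measure lborel (A j))"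
proof -
  have "sq_norm lborel (step_fun (n, A, a)) = (\<integral>\<^sup>+p. ennreal (step_fun (n, A, \<lambda>i j. (a i j)\<^sup>2) p) \<partial>lborel)"
    unfolding sq_norm_def
  proof (intro nn_integral_cong)
    fix p :: "real \<times> real"
    show "ennreal ((step_fun (n, A, a) p)\<^sup>2) = ennreal (step_fun (n, A, \<lambda>i j. (a i j)\<^sup>2) p)"
      using step_fun_power2[of "fst p" "snd p"] by simp
  qed
  then show ?thesis by (subst (asm) nn_integral_step_fun) auto
qed

text \<open>With \<open>v i\<close> the measure of \<open>A i\<close> and a symmetric array, this is
  an eighth of the third moment in \<open>E_quad3\<close>, just as \<open>sq_norm_step_fun\<close>
  gives half of the second moment in \<open>E_quad2\<close>.\<close>

lemma has_bochner_integral_cyclic_prod_step_fun: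
  "has_bochner_integral (lborel \<Otimes>\<^sub>M (lborel \<Otimes>\<^sub>M lborel)) (cyclic_prod (step_fun (n, A, a)))
    (\<Sum>i<n. \<Sum>j<n. \<Sum>k<n. a i j * a j k * a k i * measure lborel (A i) * measure lborel (A j) * measure lborel (A k))"
proof -
  note [measurable] = cells_borel
  have LL: "sigma_finite_measure (lborel \<Otimes>\<^sub>M lborel :: (real \<times> real) measure)"
    by (rule sigma_finite_pair_measure) standard
  have *: "has_bochner_integral (lborel \<Otimes>\<^sub>M (lborel \<Otimes>\<^sub>M lborel)) (indicator (A i \<times> A j \<times> A k)) (measure lborel (A i) * measure lborel (A j) * measure lborel (A k))"
    if "i < n" "j < n" "k < n" for i j k
  proof -
    have "emeasure (lborel \<Otimes>\<^sub>M (lborel \<Otimes>\<^sub>M lborel)) (A i \<times> A j \<times> A k) = ennreal (measure lborel (A i) * measure lborel (A j) * measure lborel (A k))"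
      using that by (simp add: sigma_finite_measure.emeasure_pair_measure_Times[OF LL] lborel.emeasure_pair_measure_Times finite_borel_sets_emeasure cells_fbs ennreal_mult mult.assoc)
    then have e: "emeasure (lborel \<Otimes>\<^sub>M (lborel \<Otimes>\<^sub>M lborel)) (A i \<times> A j \<times> A k) < \<infinity>"
      "measure (lborel \<Otimes>\<^sub>M (lborel \<Otimes>\<^sub>M lborel)) (A i \<times> A j \<times> A k) = measure lborel (A i) * measure lborel (A j) * measure lborel (A k)"
      by (simp_all add: measure_def)
    show ?thesis using that
      by (subst e(2)[symmetric], intro has_bochner_integral_real_indicator e(1)) simp
  qed
  have "has_bochner_integral (lborel \<Otimes>\<^sub>M (lborel \<Otimes>\<^sub>M lborel)) (\<lambda>p. \<Sum>i<n. \<Sum>j<n. \<Sum>k<n. (a i j * a j k * a k i) * indicator (A i \<times> A j \<times> A k) p)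
    (\<Sum>i<n. \<Sum>j<n. \<Sum>k<n. (a i j * a j k * a k i) * (measure lborel (A i) * measure lborel (A j) * measure lborel (A k)))"
    by (intro has_bochner_integral_sum has_bochner_integral_mult_right *) auto
  moreover have "cyclic_prod (step_fun (n, A, a)) = (\<lambda>p. \<Sum>i<n. \<Sum>j<n. \<Sum>k<n. (a i j * a j k * a k i) * indicator (A i \<times> A j \<times> A k) p)"
  proof
    fix p :: "real \<times> real \<times> real"
    obtain x y z where p: "p = (x, y, z)" by (cases p)
    show "cyclic_prod (step_fun (n, A, a)) p = (\<Sum>i<n. \<Sum>j<n. \<Sum>k<n. (a i j * a j k * a k i) * indicator (A i \<times> A j \<times> A k) p)"
      unfolding p cyclic_prod_step_fun by (simp add: indicator_times sum_distrib_left sum_distrib_right mult_ac)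
  qed
  ultimately show ?thesis by (simp add: mult.assoc)
qed

end

section \<open>Common refinements of two steps\<close>

lemma sum_reindex_refinement:
  fixes u v :: "nat \<times> nat \<Rightarrow> real"
  assumes J: "J = {..n} \<times> {..m} - {(n, m)}"
  shows "(\<Sum>p\<in>J. \<Sum>q\<in>J. (if fst p < n \<and> fst q < n then a (fst p) (fst q) else 0) * u p * v q)
    = (\<Sum>i<n. \<Sum>i'<n. a i i' * (\<Sum>j\<le>m. u (i, j)) * (\<Sum>j\<le>m. v (i', j)))" (is ?A)
  and "(\<Sum>p\<in>J. \<Sum>q\<in>J. (if snd p < m \<and> snd q < m then b (snd p) (snd q) else 0) * u p * v q)
    = (\<Sum>j<m. \<Sum>j'<m. b j j' * (\<Sum>i\<le>n. u (i, j)) * (\<Sum>i\<le>n. v (i, j')))" (is ?B)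
proof -
  \<comment> \<open>An array that looks at the first index only is blind to the refinement: pairs
    with first index \<open>n\<close> have coefficient 0, \<open>J\<close> contains all the others,
    and summing over the second index glues the pieces of each cell together again.\<close>
  let ?J = "{..<n} \<times> {..m}"
  have "(\<Sum>p\<in>J. \<Sum>q\<in>J. (if fst p < n \<and> fst q < n then a (fst p) (fst q) else 0) * u p * v q)
    = (\<Sum>p\<in>J. \<Sum>q\<in>?J. (if fst p < n \<and> fst q < n then a (fst p) (fst q) else 0) * u p * v q)"
    by (intro sum.cong refl sum.mono_neutral_right) (auto simp: J)
  also have "\<dots> = (\<Sum>p\<in>?J. \<Sum>q\<in>?J. (if fst p < n \<and> fst q < n then a (fst p) (fst q) else 0) * u p * v q)"
    by (intro sum.mono_neutral_right) (auto simp: J)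
  also have "\<dots> = (\<Sum>i<n. \<Sum>j\<le>m. \<Sum>i'<n. \<Sum>j'\<le>m. a i i' * u (i, j) * v (i', j'))"
    by (simp add: sum.cartesian_product' split_def)
  also have "\<dots> = (\<Sum>i<n. \<Sum>i'<n. \<Sum>j\<le>m. \<Sum>j'\<le>m. a i i' * u (i, j) * v (i', j'))"
    by (intro sum.cong refl sum.swap)
  finally show ?A by (simp add: sum_product sum_distrib_left mult_ac)
  let ?J = "{..n} \<times> {..<m}"
  have "(\<Sum>p\<in>J. \<Sum>q\<in>J. (if snd p < m \<and> snd q < m then b (snd p) (snd q) else 0) * u p * v q)
    = (\<Sum>p\<in>J. \<Sum>q\<in>?J. (if snd p < m \<and> snd q < m then b (snd p) (snd q) else 0) * u p * v q)"
    by (intro sum.cong refl sum.mono_neutral_right) (auto simp: J)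
  also have "\<dots> = (\<Sum>p\<in>?J. \<Sum>q\<in>?J. (if snd p < m \<and> snd q < m then b (snd p) (snd q) else 0) * u p * v q)"
    by (intro sum.mono_neutral_right) (auto simp: J)
  also have "\<dots> = (\<Sum>i\<le>n. \<Sum>j<m. \<Sum>i'\<le>n. \<Sum>j'<m. b j j' * u (i, j) * v (i', j'))"
    by (simp add: sum.cartesian_product' split_def)
  also have "\<dots> = (\<Sum>j<m. \<Sum>i\<le>n. \<Sum>j'<m. \<Sum>i'\<le>n. b j j' * u (i, j) * v (i', j'))"
    by (subst sum.swap, intro sum.cong refl sum.swap)
  also have "\<dots> = (\<Sum>j<m. \<Sum>j'<m. \<Sum>i\<le>n. \<Sum>i'\<le>n. b j j' * u (i, j) * v (i', j'))"
    by (intro sum.cong refl sum.swap)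
  finally show ?B by (simp add: sum_product sum_distrib_left mult_ac)
qed

text \<open>Steps are indexed by initial segments of the naturals; this admits the pairs of a
  refinement. One and the same step has to serve the function and its integral, hence the joint
  statement.\<close>

lemma off_diag_step_finite_index:
  fixes c :: "'j \<Rightarrow> 'j \<Rightarrow> real"
  assumes "finite J" "\<And>p. p \<in> J \<Longrightarrow> C p \<in> finite_borel_sets" "disjoint_family_on C J" "\<And>p. p \<in> J \<Longrightarrow> c p p = 0"
  shows "\<exists>h\<in>off_diag_steps.
    (\<forall>x y. step_fun h (x, y) = (\<Sum>p\<in>J. \<Sum>q\<in>J. c p q * indicator (C p) x * indicator (C q) y)) \<and>
    (\<forall>(W :: real set \<Rightarrow> 'a \<Rightarrow> real) \<omega>. step_integral W h \<omega> = (\<Sum>p\<in>J. \<Sum>q\<in>J. c p q * W (C p) \<omega> * W (C q) \<omega>))"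
proof -
  obtain e where e: "bij_betw e {..<card J} J"
    using ex_bij_betw_nat_finite[OF assms(1)] by (auto simp: atLeast0LessThan)
  define h :: off_diag_step where "h = (card J, \<lambda>i. C (e i), \<lambda>i j. c (e i) (e j))"
  have eJ: "e i \<in> J" if "i < card J" for i using e that by (auto simp: bij_betw_def)
  have inj: "e i = e j \<longleftrightarrow> i = j" if "i < card J" "j < card J" for i j
    using e that by (auto simp: bij_betw_def inj_on_def)
  have "disjoint_family_on (\<lambda>i. C (e i)) {..<card J}"
    using assms(3) eJ inj unfolding disjoint_family_on_def by (metis lessThan_iff)
  then have "h \<in> off_diag_steps" using assms eJ by (auto simp: h_def off_diag_steps_def)
  moreover have re: "(\<Sum>i<card J. \<Sum>j<card J. F (e i) (e j)) = (\<Sum>p\<in>J. \<Sum>q\<in>J. F p q)" for F :: "'j \<Rightarrow> 'j \<Rightarrow> real"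
    by (simp add: sum.reindex_bij_betw[OF e, of "\<lambda>p. \<Sum>q\<in>J. F p q", symmetric] sum.reindex_bij_betw[OF e])
  ultimately show ?thesis
    by (intro bexI[of _ h]) (simp_all add: h_def re[of "\<lambda>p q. c p q * indicator (C p) _ * indicator (C q) _"] re[of "\<lambda>p q. c p q * _ (C p) _ * _ (C q) _"])
qed

text \<open>
  Cells of a common refinement are indexed by pairs. The last index on either side stands for the
  complement of all cells, and the pair of the two complements, of infinite measure, is left out.
\<close>

definition with_rest :: "nat \<Rightarrow> (nat \<Rightarrow> real set) \<Rightarrow> nat \<Rightarrow> real set" where
  "with_rest n A i = (if i < n then A i else - (\<Union>j<n. A j))"

lemma with_rest_disjoint:
  "disjoint_family_on A {..<n} \<Longrightarrow> disjoint_family_on (with_rest n A) {..n}"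
  by (auto simp: disjoint_family_on_def with_rest_def)

lemma with_rest_UN: "(\<Union>i\<le>n. with_rest n A i) = UNIV"
proof -
  have "\<exists>i\<le>n. x \<in> with_rest n A i" for x
  proof (cases "\<exists>j<n. x \<in> A j")
    case True then show ?thesis by (auto simp: with_rest_def intro: less_imp_le)
  next
    case False then show ?thesis by (intro exI[of _ n]) (auto simp: with_rest_def)
  qed
  then show ?thesis by auto
qed

lemma with_rest_borel: "(\<And>i. i < n \<Longrightarrow> A i \<in> sets borel) \<Longrightarrow> with_rest n A i \<in> sets borel"
proof -
  assume "\<And>i. i < n \<Longrightarrow> A i \<in> sets borel"
  moreover from this have "(\<Union>j<n. A j) \<in> sets borel" by (intro sets.finite_UN) auto
  ultimately show ?thesis by (simp only: with_rest_def borel_comp split: if_split) simp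
qed

text \<open>The moment formulas ask for a symmetric array with zero diagonal. The diagonal is reset
  explicitly because \<open>off_diag_steps\<close> controls \<open>a i i\<close> only for
  \<open>i < n\<close>, whereas those formulas assume it for all indices.\<close>

fun sym_step :: "off_diag_step \<Rightarrow> off_diag_step" where
  "sym_step (n, A, a) = (n, A, \<lambda>i j. if i = j then 0 else (a i j + a j i) / 2)"

lemma sym_step_mem: "h \<in> off_diag_steps \<Longrightarrow> sym_step h \<in> off_diag_steps"
  by (cases h) (auto simp: off_diag_steps_def)

text \<open>With \<open>u = v\<close> this concerns the integral, which symmetrisation preserves;
  with different \<open>u\<close> and \<open>v\<close> it concerns the step function, which is
  averaged with its reflection.\<close>

lemma sym_sum:
  fixes a :: "nat \<Rightarrow> nat \<Rightarrow> real"
  assumes "\<And>i. i < n \<Longrightarrow> a i i = 0"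
  shows "(\<Sum>i<n. \<Sum>j<n. (if i = j then 0 else (a i j + a j i) / 2) * u i * v j)
    = ((\<Sum>i<n. \<Sum>j<n. a i j * u i * v j) + (\<Sum>i<n. \<Sum>j<n. a i j * v i * u j)) / 2"
proof -
  have "(\<Sum>i<n. \<Sum>j<n. (if i = j then 0 else (a i j + a j i) / 2) * u i * v j)
    = (\<Sum>i<n. \<Sum>j<n. (a i j * u i * v j + a j i * v j * u i) / 2)"
    by (intro sum.cong refl) (auto simp: assms algebra_simps add_divide_distrib)
  also have "\<dots> = ((\<Sum>i<n. \<Sum>j<n. a i j * u i * v j) + (\<Sum>i<n. \<Sum>j<n. a j i * v j * u i)) / 2"
    by (simp add: sum.distrib flip: sum_divide_distrib)
  also have "(\<Sum>i<n. \<Sum>j<n. a j i * v j * u i) = (\<Sum>i<n. \<Sum>j<n. a i j * v i * u j)"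
    by (rule sum.swap)
  finally show ?thesis .
qed

lemma step_integral_sym_step:
  assumes "h \<in> off_diag_steps" shows "step_integral W (sym_step h) \<omega> = step_integral W h \<omega>"
proof -
  obtain n A a where h: "h = (n, A, a)" by (cases h)
  have "\<And>i. i < n \<Longrightarrow> a i i = 0" using assms by (auto simp: h off_diag_steps_def)
  from sym_sum[of n a "\<lambda>i. W (A i) \<omega>" "\<lambda>i. W (A i) \<omega>", OF this] show ?thesis by (simp add: h)
qed

lemma step_fun_sym_step:
  assumes "h \<in> off_diag_steps"
  shows "step_fun (sym_step h) (x, y) = (step_fun h (x, y) + step_fun h (y, x)) / 2"
proof -
  obtain n A a where h: "h = (n, A, a)" by (cases h)
  have "\<And>i. i < n \<Longrightarrow> a i i = 0" using assms by (auto simp: h off_diag_steps_def)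
  from sym_sum[of n a, OF this] show ?thesis by (simp add: h)
qed

lemma sq_norm_swap:
  fixes f :: "real \<times> real \<Rightarrow> real"
  assumes [measurable]: "f \<in> borel_measurable borel"
  shows "sq_norm lborel (\<lambda>p. f (snd p, fst p)) = sq_norm lborel f"
proof -
  have [measurable]: "f \<in> borel_measurable (borel \<Otimes>\<^sub>M borel)" by (simp add: borel_prod)
  have "sq_norm (lborel \<Otimes>\<^sub>M lborel) f = (\<integral>\<^sup>+p. ennreal ((f p)\<^sup>2) \<partial>distr (lborel \<Otimes>\<^sub>M lborel) (lborel \<Otimes>\<^sub>M lborel) (\<lambda>(x, y). (y, x)))"
    unfolding sq_norm_def by (subst lborel_pair.distr_pair_swap) simp
  also have "\<dots> = (\<integral>\<^sup>+p. ennreal ((f (case p of (x, y) \<Rightarrow> (y, x)))\<^sup>2) \<partial>(lborel \<Otimes>\<^sub>M lborel))"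
    by (subst nn_integral_distr) auto
  also have "\<dots> = sq_norm (lborel \<Otimes>\<^sub>M lborel) (\<lambda>p. f (snd p, fst p))"
    unfolding sq_norm_def by (intro nn_integral_cong) (simp split: prod.split)
  finally show ?thesis by (simp add: lborel_prod)
qed

text \<open>For a symmetric \<open>f\<close> the new error is the average of the old one and its
  reflection, and the square is convex.\<close>

lemma sq_norm_sym_step_le:
  fixes f :: "real \<times> real \<Rightarrow> real"
  assumes h: "h \<in> off_diag_steps" and f [measurable]: "f \<in> borel_measurable borel" and sym: "\<And>x y. f (x, y) = f (y, x)"
  shows "sq_norm lborel (\<lambda>p. step_fun (sym_step h) p - f p) \<le> sq_norm lborel (\<lambda>p. step_fun h p - f p)"
proof -
  note [measurable] = step_fun_measurable[OF h]
  let ?g = "\<lambda>p. step_fun h p - f p"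
  let ?g' = "\<lambda>p. ?g (snd p, fst p)"
  have half_nonneg: "0 \<le> (1 / 2 :: real)" and half: "ennreal (1 / 2) + ennreal (1 / 2) = 1"
    by (simp, subst ennreal_plus[symmetric]) (simp_all del: ennreal_plus)
  have "((a + b) / 2)\<^sup>2 \<le> 1 / 2 * a\<^sup>2 + 1 / 2 * b\<^sup>2" for a b :: real
    using zero_le_power2[of "a - b"] by (simp add: power2_eq_square field_simps)
  then have *: "ennreal (((a + b) / 2)\<^sup>2) \<le> ennreal (1 / 2) * ennreal (a\<^sup>2) + ennreal (1 / 2) * ennreal (b\<^sup>2)" for a b :: real
  proof -
    assume le: "\<And>a b :: real. ((a + b) / 2)\<^sup>2 \<le> 1 / 2 * a\<^sup>2 + 1 / 2 * b\<^sup>2"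
    have "ennreal (((a + b) / 2)\<^sup>2) \<le> ennreal (1 / 2 * a\<^sup>2 + 1 / 2 * b\<^sup>2)" by (rule ennreal_leI[OF le])
    also have "\<dots> = ennreal (1 / 2) * ennreal (a\<^sup>2) + ennreal (1 / 2) * ennreal (b\<^sup>2)"
      by (simp only: ennreal_plus ennreal_mult zero_le_power2 mult_nonneg_nonneg half_nonneg)
    finally show ?thesis .
  qed
  have [measurable]: "?g' \<in> borel_measurable borel"
  proof -
    have "(\<lambda>p. (snd p, fst p) :: real \<times> real) \<in> borel_measurable (borel :: (real \<times> real) measure)"
      by (intro borel_measurable_continuous_onI continuous_intros)
    then show ?thesis by measurable
  qed
  have "sq_norm lborel (\<lambda>p. step_fun (sym_step h) p - f p) = sq_norm lborel (\<lambda>p. (?g p + ?g' p) / 2)"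
    unfolding sq_norm_def
  proof (intro nn_integral_cong)
    fix p :: "real \<times> real"
    obtain x y where p: "p = (x, y)" by (cases p)
    have "step_fun (sym_step h) p - f p = (?g p + ?g' p) / 2"
      using sym[of x y] by (simp add: p step_fun_sym_step[OF h] field_simps)
    then show "ennreal ((step_fun (sym_step h) p - f p)\<^sup>2) = ennreal (((?g p + ?g' p) / 2)\<^sup>2)" by (simp only:)
  qed
  also have "\<dots> \<le> (\<integral>\<^sup>+p. ennreal (1 / 2) * ennreal ((?g p)\<^sup>2) + ennreal (1 / 2) * ennreal ((?g' p)\<^sup>2) \<partial>lborel)"
    unfolding sq_norm_def by (intro nn_integral_mono *)
  also have "\<dots> = ennreal (1 / 2) * sq_norm lborel ?g + ennreal (1 / 2) * sq_norm lborel ?g'"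
    unfolding sq_norm_def by (subst nn_integral_add) (simp_all add: nn_integral_cmult)
  also have "sq_norm lborel ?g' = sq_norm lborel ?g" by (rule sq_norm_swap) measurable
  also have "ennreal (1 / 2) * sq_norm lborel ?g + ennreal (1 / 2) * sq_norm lborel ?g = sq_norm lborel ?g"
    by (simp only: distrib_right[symmetric] half mult_1)
  finally show ?thesis .
qed

section \<open>Step integrals: linearity, moments and L2 bounds\<close>

context brownian_random_measure
begin

text \<open>Countable additivity, with the sequence of cells continued by empty sets;
  \<open>W {}\<close> is almost surely 0 because the empty set is null.\<close>

lemma W_finite_additive:
  assumes J: "finite J" and C: "\<And>j. j \<in> J \<Longrightarrow> C j \<in> finite_borel_sets" "disjoint_family_on C J"
  shows "AE \<omega> in M. W (\<Union>j\<in>J. C j) \<omega> = (\<Sum>j\<in>J. W (C j) \<omega>)"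
proof -
  obtain e where e: "bij_betw e {..<card J} J"
    using ex_bij_betw_nat_finite[OF J] by (auto simp: atLeast0LessThan)
  have eJ: "e i \<in> J" if "i < card J" for i using e that by (auto simp: bij_betw_def)
  have inj: "e i = e j \<longleftrightarrow> i = j" if "i < card J" "j < card J" for i j
    using e that by (auto simp: bij_betw_def inj_on_def)
  define A where "A i = (if i < card J then C (e i) else {})" for i
  have U: "(\<Union>i. A i) = (\<Union>j\<in>J. C j)"
  proof -
    have "(\<Union>i. A i) = (\<Union>i<card J. C (e i))" by (auto simp: A_def split: if_splits)
    also have "\<dots> = \<Union> (C ` (e ` {..<card J}))" by (simp only: image_image)
    also have "e ` {..<card J} = J" using e by (simp add: bij_betw_def)
    finally show ?thesis .
  qed
  have 1: "range A \<subseteq> finite_borel_sets" using C(1) eJ by (auto simp: A_def)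
  have 2: "disjoint_family A" using C(2) eJ inj unfolding disjoint_family_on_def A_def by auto
  have 3: "(\<Union>j\<in>J. C j) \<in> finite_borel_sets"
  proof -
    have "emeasure lborel (\<Union>j\<in>J. C j) \<le> (\<Sum>j\<in>J. emeasure lborel (C j))"
      by (rule emeasure_subadditive_finite) (use J C finite_borel_sets_borel in auto)
    also have "\<dots> < \<infinity>" using J C(1) by (simp add: finite_borel_sets_def less_top[symmetric])
    finally have "emeasure lborel (\<Union>j\<in>J. C j) < \<infinity>" .
    moreover have "(\<Union>j\<in>J. C j) \<in> sets borel" by (intro sets.finite_UN J finite_borel_sets_borel C(1))
    ultimately show ?thesis unfolding finite_borel_sets_def by simp
  qed
  have "AE \<omega> in M. W {} \<omega> = 0" by (rule null_W) auto
  moreover have "AE \<omega> in M. (\<lambda>i. W (A i) \<omega>) sums W (\<Union>j\<in>J. C j) \<omega>"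
    using countably_additive_W[OF 1 2] 3 by (simp add: U)
  ultimately show ?thesis
  proof eventually_elim
    case (elim \<omega>)
    have "(\<lambda>i. W (A i) \<omega>) sums (\<Sum>i<card J. W (A i) \<omega>)"
      by (rule sums_finite) (auto simp: A_def elim)
    then have "W (\<Union>j\<in>J. C j) \<omega> = (\<Sum>i<card J. W (A i) \<omega>)" using elim(2) sums_unique2 by blast
    also have "\<dots> = (\<Sum>i<card J. W (C (e i)) \<omega>)" by (simp add: A_def)
    also have "\<dots> = (\<Sum>j\<in>J. W (C j) \<omega>)" by (rule sum.reindex_bij_betw[OF e])
    finally show ?case .
  qed
qed

lemma step_integral_measurable [measurable]:
  assumes "h \<in> off_diag_steps"
  shows "step_integral W h \<in> borel_measurable M"
proof -
  obtain n A a where h: "h = (n, A, a)" by (cases h)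
  have [measurable]: "i < n \<Longrightarrow> W (A i) \<in> borel_measurable M" for i
    using assms by (auto simp: h off_diag_steps_def intro: random_variable_W)
  show ?thesis unfolding h step_integral.simps[abs_def] by measurable
qed

text \<open>Both steps are rewritten over one common refinement. The integrals agree only almost
  surely, since \<open>W\<close> is additive only up to null sets that depend on the cells.\<close>

lemma off_diag_step_linear:
  assumes "h1 \<in> off_diag_steps" "h2 \<in> off_diag_steps"
  obtains h where "h \<in> off_diag_steps" "\<And>z. step_fun h z = step_fun h1 z + r * step_fun h2 z"
    "AE \<omega> in M. step_integral W h \<omega> = step_integral W h1 \<omega> + r * step_integral W h2 \<omega>"
proof -
  obtain n A a where h1: "h1 = (n, A, a)" by (cases h1)
  obtain m B b where h2: "h2 = (m, B, b)" by (cases h2)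
  define J where "J = {..n} \<times> {..m} - {(n, m)}"
  define C where "C = (\<lambda>(i, j). with_rest n A i \<inter> with_rest m B j)"
  define c where "c p q = (if fst p < n \<and> fst q < n then a (fst p) (fst q) else 0) + r * (if snd p < m \<and> snd q < m then b (snd p) (snd q) else 0)" for p q :: "nat \<times> nat"
  note hA = assms(1)[unfolded h1] and hB = assms(2)[unfolded h2]
  have A: "i < n \<Longrightarrow> A i \<in> finite_borel_sets" and B: "j < m \<Longrightarrow> B j \<in> finite_borel_sets" for i j
    using cells_fbs[OF hA] cells_fbs[OF hB] by auto
  have borel: "with_rest n A i \<in> sets borel" "with_rest m B j \<in> sets borel" for i j
    using with_rest_borel[of n A] with_rest_borel[of m B] finite_borel_sets_borel[OF A] finite_borel_sets_borel[OF B] by auto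
  have CA: "C (i, j) \<subseteq> A i" if "i < n" for i j using that by (auto simp: C_def with_rest_def)
  have CB: "C (i, j) \<subseteq> B j" if "j < m" for i j using that by (auto simp: C_def with_rest_def)
  have Cborel: "C p \<in> sets borel" for p using borel by (auto simp: C_def split: prod.splits)
  have C: "C p \<in> finite_borel_sets" if "p \<in> J" for p
  proof -
    obtain i j where p: "p = (i, j)" by (cases p)
    from that have "i < n \<or> j < m" by (auto simp: p J_def)
    then show ?thesis unfolding p using finite_borel_sets_subset[OF A Cborel CA] finite_borel_sets_subset[OF B Cborel CB] by blast
  qed
  note dA = with_rest_disjoint[OF cells_disjoint[OF hA]] and dB = with_rest_disjoint[OF cells_disjoint[OF hB]]
  have disj: "disjoint_family_on C ({..n} \<times> {..m})"
    unfolding disjoint_family_on_def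
  proof (intro ballI impI)
    fix p q assume pq: "p \<in> {..n} \<times> {..m}" "q \<in> {..n} \<times> {..m}" "p \<noteq> q"
    obtain i j i' j' where ij: "p = (i, j)" "q = (i', j')" by (cases p; cases q)
    from pq have "i \<noteq> i' \<or> j \<noteq> j'" by (auto simp: ij)
    then have "with_rest n A i \<inter> with_rest n A i' = {} \<or> with_rest m B j \<inter> with_rest m B j' = {}"
      using pq dA dB unfolding disjoint_family_on_def ij by (meson mem_Sigma_iff)
    then show "C p \<inter> C q = {}" by (auto simp: C_def ij)
  qed
  have c0: "c p p = 0" if "p \<in> J" for p using hA hB by (auto simp: c_def off_diag_steps_def)
  have finJ: "finite J" by (simp add: J_def)
  have dJ: "disjoint_family_on C J" using disj by (rule disjoint_family_on_mono[rotated]) (auto simp: J_def)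
  have "\<exists>h\<in>off_diag_steps.
    (\<forall>x y. step_fun h (x, y) = (\<Sum>p\<in>J. \<Sum>q\<in>J. c p q * indicator (C p) x * indicator (C q) y)) \<and>
    (\<forall>(W :: real set \<Rightarrow> 'a \<Rightarrow> real) \<omega>. step_integral W h \<omega> = (\<Sum>p\<in>J. \<Sum>q\<in>J. c p q * W (C p) \<omega> * W (C q) \<omega>))"
    by (rule off_diag_step_finite_index[OF finJ C dJ c0])
  then obtain h where hs: "h \<in> off_diag_steps"
    and hf: "\<forall>x y. step_fun h (x, y) = (\<Sum>p\<in>J. \<Sum>q\<in>J. c p q * indicator (C p) x * indicator (C q) y)"
    and hi: "\<forall>(W :: real set \<Rightarrow> 'a \<Rightarrow> real) \<omega>. step_integral W h \<omega> = (\<Sum>p\<in>J. \<Sum>q\<in>J. c p q * W (C p) \<omega> * W (C q) \<omega>)"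
    by (elim bexE conjE)
  note h = hs hf[rule_format] hi[rule_format]
  have split: "(\<Sum>p\<in>J. \<Sum>q\<in>J. c p q * u p * v q) = (\<Sum>i<n. \<Sum>i'<n. a i i' * (\<Sum>j\<le>m. u (i, j)) * (\<Sum>j\<le>m. v (i', j)))
    + r * (\<Sum>j<m. \<Sum>j'<m. b j j' * (\<Sum>i\<le>n. u (i, j)) * (\<Sum>i\<le>n. v (i, j')))" for u v
    unfolding sum_reindex_refinement[OF J_def, symmetric]
    by (simp add: c_def distrib_right sum.distrib sum_distrib_left mult.assoc)
  have UA: "(\<Union>j\<le>m. C (i, j)) = A i" if "i < n" for i
    using with_rest_UN[of m B] that by (auto simp: C_def with_rest_def[of n])
  have UB: "(\<Union>i\<le>n. C (i, j)) = B j" if "j < m" for j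
    using with_rest_UN[of n A] that by (auto simp: C_def with_rest_def[of m])
  have dCA: "disjoint_family_on (\<lambda>j. C (i, j)) {..m}" if "i < n" for i
    using disj that by (auto simp: disjoint_family_on_def)
  have dCB: "disjoint_family_on (\<lambda>i. C (i, j)) {..n}" if "j < m" for j
    using disj that by (auto simp: disjoint_family_on_def)
  have iA: "(\<Sum>j\<le>m. indicator (C (i, j)) x) = (indicator (A i) x :: real)" if "i < n" for i x
    unfolding UA[OF that, symmetric] by (rule indicator_UN_disjoint[OF finite_atMost dCA[OF that], symmetric])
  have iB: "(\<Sum>i\<le>n. indicator (C (i, j)) x) = (indicator (B j) x :: real)" if "j < m" for j x
    unfolding UB[OF that, symmetric] by (rule indicator_UN_disjoint[OF finite_atMost dCB[OF that], symmetric])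
  have "step_fun h z = step_fun h1 z + r * step_fun h2 z" for z
  proof -
    obtain x y where z: "z = (x, y)" by (cases z)
    show ?thesis unfolding z h(2) split h1 h2 step_fun.simps by (simp add: iA iB)
  qed
  moreover have "AE \<omega> in M. step_integral W h \<omega> = step_integral W h1 \<omega> + r * step_integral W h2 \<omega>"
  proof -
    \<comment> \<open>There are finitely many cells, so their exceptional null sets unite to a
      single one.\<close>
    have "AE \<omega> in M. \<forall>i<n. W (A i) \<omega> = (\<Sum>j\<le>m. W (C (i, j)) \<omega>)"
    proof (rule AE_ball_countable[where X="{..<n}", unfolded Ball_def lessThan_iff, THEN iffD2, rule_format])
      fix i assume i: "i < n"
      show "AE \<omega> in M. W (A i) \<omega> = (\<Sum>j\<le>m. W (C (i, j)) \<omega>)"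
        using W_finite_additive[of "{..m}" "\<lambda>j. C (i, j)"] dCA[OF i] UA[OF i] finite_borel_sets_subset[OF A[OF i] Cborel CA[OF i]] by simp
    qed auto
    moreover have "AE \<omega> in M. \<forall>j<m. W (B j) \<omega> = (\<Sum>i\<le>n. W (C (i, j)) \<omega>)"
    proof (rule AE_ball_countable[where X="{..<m}", unfolded Ball_def lessThan_iff, THEN iffD2, rule_format])
      fix j assume j: "j < m"
      show "AE \<omega> in M. W (B j) \<omega> = (\<Sum>i\<le>n. W (C (i, j)) \<omega>)"
        using W_finite_additive[of "{..n}" "\<lambda>i. C (i, j)"] dCB[OF j] UB[OF j] finite_borel_sets_subset[OF B[OF j] Cborel CB[OF j]] by simp
    qed auto
    ultimately show ?thesis
    proof eventually_elim
      case (elim \<omega>)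
      have "(\<Sum>i<n. \<Sum>i'<n. a i i' * (\<Sum>j\<le>m. W (C (i, j)) \<omega>) * (\<Sum>j\<le>m. W (C (i', j)) \<omega>)) = step_integral W h1 \<omega>"
        unfolding h1 step_integral.simps by (intro sum.cong refl) (simp add: elim(1)[rule_format])
      moreover have "(\<Sum>j<m. \<Sum>j'<m. b j j' * (\<Sum>i\<le>n. W (C (i, j)) \<omega>) * (\<Sum>i\<le>n. W (C (i, j')) \<omega>)) = step_integral W h2 \<omega>"
        unfolding h2 step_integral.simps by (intro sum.cong refl) (simp add: elim(2)[rule_format])
      ultimately show ?case unfolding h(3) split by (simp only:)
    qed
  qed
  ultimately show ?thesis by (rule that[OF h(1)])
qed

lemma gaussian_like_cells:
  assumes h: "(n, A, a) \<in> off_diag_steps"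
  shows "gaussian_like_family M (\<lambda>i. W (A i)) (\<lambda>i. measure lborel (A i)) n"
proof -
  have *: "has_bochner_integral M (W (A i)) 0 \<and> has_bochner_integral M (\<lambda>\<omega>. W (A i) \<omega> ^ 2) (measure lborel (A i))
    \<and> has_bochner_integral M (\<lambda>\<omega>. W (A i) \<omega> ^ 3) 0 \<and> has_bochner_integral M (\<lambda>\<omega>. W (A i) \<omega> ^ 4) (3 * (measure lborel (A i))\<^sup>2)"
    if i: "i < n" for i
  proof (cases "measure lborel (A i) = 0")
    case True
    have AE: "AE \<omega> in M. W (A i) \<omega> = 0" by (rule null_W[OF cells_fbs[OF h i] True])
    have [measurable]: "W (A i) \<in> borel_measurable M" by (rule random_variable_W[OF cells_fbs[OF h i]])
    have "has_bochner_integral M (\<lambda>\<omega>. W (A i) \<omega> ^ k) 0" if "0 < k" for k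
    proof (subst has_bochner_integral_cong_AE)
      show "AE \<omega> in M. W (A i) \<omega> ^ k = 0" using AE by eventually_elim (use that in simp)
    qed (auto intro: has_bochner_integral_zero)
    from this[of 1] this[of 2] this[of 3] this[of 4] show ?thesis by (simp add: True)
  next
    case False
    then have pos: "0 < measure lborel (A i)" by (simp add: less_le)
    let ?s = "sqrt (measure lborel (A i))"
    note D = gaussian_W[OF cells_fbs[OF h i] pos]
    have s: "0 < ?s" using pos by simp
    have "has_bochner_integral M (\<lambda>\<omega>. W (A i) \<omega> ^ k) e" if "has_bochner_integral lborel (\<lambda>x. normal_density 0 ?s x * (x - 0) ^ k) e" for k e
      using distributed_integral[OF D, of "\<lambda>x. x ^ k"] distributed_integrable[OF D, of "\<lambda>x. x ^ k"] that
      by (simp add: has_bochner_integral_iff)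
    \<comment> \<open>Moments one to four in this order. The fourth is
      \<open>4! / (2^2 * 2!)\<close> times the squared variance, that is, three times it.\<close>
    from this[OF normal_moment_odd[OF s, of 0 0]] this[OF normal_moment_even[OF s, of 0 1]]
      this[OF normal_moment_odd[OF s, of 0 1]] this[OF normal_moment_even[OF s, of 0 2]]
    show ?thesis using pos by (simp add: fact_numeral power2_eq_square power3_eq_cube field_simps)
  qed
  show ?thesis
  proof unfold_locales
    show "indep_vars (\<lambda>_. borel) (\<lambda>i. W (A i)) {..<n}"
      by (rule independently_scattered_W) (use cells_fbs[OF h] cells_disjoint[OF h] in auto)
  qed (use * in auto)
qed

text \<open>Norm and cyclic integral are those of \<open>sym_step h\<close>: the integral does not
  distinguish \<open>h\<close> from its symmetrisation but the step function does, and the moment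
  formulas hold for symmetric arrays.\<close>

lemma step_integral_moments:
  assumes h: "h \<in> off_diag_steps"
  shows "sq_norm M (step_integral W h) = 2 * sq_norm lborel (step_fun (sym_step h))"
    and "has_bochner_integral M (\<lambda>\<omega>. step_integral W h \<omega> ^ 3)
      (8 * (\<integral>p. cyclic_prod (step_fun (sym_step h)) p \<partial>(lborel \<Otimes>\<^sub>M (lborel \<Otimes>\<^sub>M lborel))))"
    and "integrable M (\<lambda>\<omega>. step_integral W h \<omega> ^ 4)"
    and "expectation (\<lambda>\<omega>. step_integral W h \<omega> ^ 4) \<le> 27 * (expectation (\<lambda>\<omega>. (step_integral W h \<omega>)\<^sup>2))\<^sup>2"
    and "sq_norm M (step_integral W h) < \<infinity>"
proof -
  obtain n A a where hd: "h = (n, A, a)" by (cases h)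
  define b where "b i j = (if i = j then 0 else (a i j + a j i) / 2)" for i j
  have sh: "sym_step h = (n, A, b)" by (simp add: hd b_def fun_eq_iff)
  have b: "(n, A, b) \<in> off_diag_steps" using sym_step_mem[OF h] by (simp add: sh)
  have bs: "b i j = b j i" "b i i = 0" for i j by (auto simp: b_def)
  interpret G: gaussian_like_family M "\<lambda>i. W (A i)" "\<lambda>i. measure lborel (A i)" n
    by (rule gaussian_like_cells[OF b])
  have S: "step_integral W h \<omega> = quad n b (\<lambda>i. W (A i) \<omega>)" for \<omega>
    unfolding step_integral_sym_step[OF h, symmetric] sh by (simp add: quad_def)
  note m2 = G.E_quad2[of b n, OF bs order_refl, folded S] and m3 = G.E_quad3[of b n, OF bs order_refl, folded S]
    and m4 = G.E_quad4_le[of b n, OF bs order_refl, folded S] and fourth_integrable = G.fourth_integrable_quad[of b n, OF bs order_refl, folded S]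
  let ?q = "\<Sum>i<n. \<Sum>j<n. (b i j)\<^sup>2 * measure lborel (A i) * measure lborel (A j)"
  have q: "0 \<le> ?q" by (intro sum_nonneg) auto
  have e2: "expectation (\<lambda>\<omega>. (step_integral W h \<omega>)\<^sup>2) = 2 * ?q" and i2: "integrable M (\<lambda>\<omega>. (step_integral W h \<omega>)\<^sup>2)"
    using m2 by (auto simp: has_bochner_integral_iff)
  have "sq_norm M (step_integral W h) = ennreal (2 * ?q)"
    unfolding sq_norm_def using nn_integral_eq_integral[OF i2] e2 by simp
  also have "\<dots> = 2 * sq_norm lborel (step_fun (sym_step h))"
    unfolding sh sq_norm_step_fun[OF b] using q by (simp add: ennreal_mult)
  finally show 2: "sq_norm M (step_integral W h) = 2 * sq_norm lborel (step_fun (sym_step h))" .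
  show "sq_norm M (step_integral W h) < \<infinity>" unfolding 2 sh sq_norm_step_fun[OF b] by (simp add: ennreal_mult_less_top)
  show "has_bochner_integral M (\<lambda>\<omega>. step_integral W h \<omega> ^ 3)
      (8 * (\<integral>p. cyclic_prod (step_fun (sym_step h)) p \<partial>(lborel \<Otimes>\<^sub>M (lborel \<Otimes>\<^sub>M lborel))))"
    unfolding sh has_bochner_integral_integral_eq[OF has_bochner_integral_cyclic_prod_step_fun[OF b]] by (rule m3)
  show "integrable M (\<lambda>\<omega>. step_integral W h \<omega> ^ 4)" using fourth_integrable by (simp add: fourth_integrable_def)
  show "expectation (\<lambda>\<omega>. step_integral W h \<omega> ^ 4) \<le> 27 * (expectation (\<lambda>\<omega>. (step_integral W h \<omega>)\<^sup>2))\<^sup>2"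
    unfolding e2 by (rule m4)
qed

text \<open>Symmetrisation is a contraction, by \<open>sq_norm_sym_step_le\<close> with
  \<open>f = 0\<close>.\<close>

lemma sq_norm_step_integral_le:
  assumes h: "h \<in> off_diag_steps"
  shows "sq_norm M (step_integral W h) \<le> 2 * sq_norm lborel (step_fun h)"
  unfolding step_integral_moments(1)[OF h]
  using sq_norm_sym_step_le[OF h, of "\<lambda>_. 0"] by (simp add: mult_left_mono)

text \<open>Continuity of the integral: the difference is almost surely a step integral again, by
  \<open>off_diag_step_linear\<close> with \<open>r = -1\<close>. Hence the integrals of converging
  steps form a Cauchy sequence.\<close>

lemma sq_norm_step_integral_diff_le:
  assumes h: "h1 \<in> off_diag_steps" "h2 \<in> off_diag_steps"
  shows "sq_norm M (\<lambda>\<omega>. step_integral W h1 \<omega> - step_integral W h2 \<omega>) \<le> 2 * sq_norm lborel (\<lambda>p. step_fun h1 p - step_fun h2 p)"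
proof -
  obtain h where hh: "h \<in> off_diag_steps" and f: "\<And>z. step_fun h z = step_fun h1 z + (-1) * step_fun h2 z"
    and I: "AE \<omega> in M. step_integral W h \<omega> = step_integral W h1 \<omega> + (-1) * step_integral W h2 \<omega>"
    by (rule off_diag_step_linear[OF h, of "-1"]) blast
  have "sq_norm M (\<lambda>\<omega>. step_integral W h1 \<omega> - step_integral W h2 \<omega>) = sq_norm M (step_integral W h)"
    by (rule sq_norm_AE_cong) (use I in eventually_elim, simp)
  also have "\<dots> \<le> 2 * sq_norm lborel (step_fun h)" by (rule sq_norm_step_integral_le[OF hh])
  also have "step_fun h = (\<lambda>p. step_fun h1 p - step_fun h2 p)" using f by auto
  finally show ?thesis .
qed

end

section \<open>Density of step functions\<close>

context brownian_random_measure
begin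

text \<open>The L2 closure of the off-diagonal step functions; the goal is that every square
  integrable function belongs to it.\<close>

definition step_limit :: "(real \<times> real \<Rightarrow> real) \<Rightarrow> bool" where
  "step_limit f \<longleftrightarrow> f \<in> borel_measurable borel \<and>
     (\<exists>h :: nat \<Rightarrow> off_diag_step. range h \<subseteq> off_diag_steps \<and> (\<lambda>k. sq_norm lborel (\<lambda>p. step_fun (h k) p - f p)) \<longlonglongrightarrow> 0)"

lemma step_limit_measurable: "step_limit f \<Longrightarrow> f \<in> borel_measurable borel"
  by (simp add: step_limit_def)

lemma step_limit_step_fun: "h \<in> off_diag_steps \<Longrightarrow> step_limit (step_fun h)"
  unfolding step_limit_def by (intro conjI step_fun_measurable exI[of _ "\<lambda>_. h"]) (auto simp: sq_norm_def)

lemma step_limit_linear: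
  assumes f: "step_limit f" and g: "step_limit g"
  shows "step_limit (\<lambda>p. f p + r * g p)"
proof -
  note [measurable] = step_limit_measurable[OF f] step_limit_measurable[OF g]
  obtain h where h: "range h \<subseteq> off_diag_steps" "(\<lambda>k. sq_norm lborel (\<lambda>p. step_fun (h k) p - f p)) \<longlonglongrightarrow> 0"
    using f by (auto simp: step_limit_def)
  obtain l where l: "range l \<subseteq> off_diag_steps" "(\<lambda>k. sq_norm lborel (\<lambda>p. step_fun (l k) p - g p)) \<longlonglongrightarrow> 0"
    using g by (auto simp: step_limit_def)
  have hl: "h k \<in> off_diag_steps" "l k \<in> off_diag_steps" for k using h l by auto
  have "\<exists>m\<in>off_diag_steps. \<forall>p. step_fun m p = step_fun (h k) p + r * step_fun (l k) p" for k
    by (rule off_diag_step_linear[OF hl(1)[of k] hl(2)[of k], where r=r]) blast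
  then obtain m where m: "\<And>k. m k \<in> off_diag_steps" "\<And>k p. step_fun (m k) p = step_fun (h k) p + r * step_fun (l k) p"
    by metis
  note [measurable] = step_fun_measurable[OF hl(1)] step_fun_measurable[OF hl(2)]
  have "(\<lambda>k. 2 * sq_norm lborel (\<lambda>p. step_fun (h k) p - f p) + 2 * (ennreal (r\<^sup>2) * sq_norm lborel (\<lambda>p. step_fun (l k) p - g p))) \<longlonglongrightarrow> 2 * 0 + 2 * (ennreal (r\<^sup>2) * 0)"
    by (intro tendsto_add ennreal_tendsto_cmult h l) (simp_all add: less_top)
  then have lim: "(\<lambda>k. 2 * sq_norm lborel (\<lambda>p. step_fun (h k) p - f p) + 2 * (ennreal (r\<^sup>2) * sq_norm lborel (\<lambda>p. step_fun (l k) p - g p))) \<longlonglongrightarrow> 0"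
    by simp
  have "(\<lambda>k. sq_norm lborel (\<lambda>p. step_fun (m k) p - (f p + r * g p))) \<longlonglongrightarrow> 0"
  proof (rule ennreal_tendsto_0_le[OF lim])
    fix k
    have "(\<lambda>p. step_fun (m k) p - (f p + r * g p)) = (\<lambda>p. (step_fun (h k) p - f p) + r * (step_fun (l k) p - g p))"
      by (simp add: m(2) fun_eq_iff algebra_simps)
    then show "sq_norm lborel (\<lambda>p. step_fun (m k) p - (f p + r * g p)) \<le>
      2 * sq_norm lborel (\<lambda>p. step_fun (h k) p - f p) + 2 * (ennreal (r\<^sup>2) * sq_norm lborel (\<lambda>p. step_fun (l k) p - g p))"
      using sq_norm_add[of "\<lambda>p. step_fun (h k) p - f p" lborel "\<lambda>p. r * (step_fun (l k) p - g p)"]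
        sq_norm_cmult[of "\<lambda>p. step_fun (l k) p - g p" lborel r] by simp
  qed
  then show ?thesis unfolding step_limit_def
    by (intro conjI exI[of _ m]) (use m(1) in auto)
qed

lemma step_limit_0: "step_limit (\<lambda>_. 0)"
proof -
  let ?h = "(0, \<lambda>_. {}, \<lambda>_ _. 0) :: off_diag_step"
  have "step_limit (step_fun ?h)" by (rule step_limit_step_fun) (simp add: off_diag_steps_def disjoint_family_on_def)
  also have "step_fun ?h = (\<lambda>_. 0)" by auto
  finally show ?thesis .
qed

lemma step_limit_cmult: "step_limit f \<Longrightarrow> step_limit (\<lambda>p. r * f p)"
  using step_limit_linear[OF step_limit_0, of f r] by simp

lemma step_limit_sum: "finite I \<Longrightarrow> (\<And>i. i \<in> I \<Longrightarrow> step_limit (f i)) \<Longrightarrow> step_limit (\<lambda>p. \<Sum>i\<in>I. f i p)"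
proof (induction I rule: finite_induct)
  case empty then show ?case using step_limit_0 by simp
next
  case (insert i I)
  then show ?case using step_limit_linear[of "f i" "\<lambda>p. \<Sum>i\<in>I. f i p" 1] by simp
qed

text \<open>The closure is closed: each \<open>f k\<close> is replaced by a step within squared
  distance \<open>1 / (k + 1)\<close>.\<close>

lemma step_limit_limit:
  assumes f: "\<And>k. step_limit (f k)" and [measurable]: "g \<in> borel_measurable borel"
    and lim: "(\<lambda>k. sq_norm lborel (\<lambda>p. f k p - g p)) \<longlonglongrightarrow> 0"
  shows "step_limit g"
proof -
  note [measurable] = step_limit_measurable[OF f]
  have "\<exists>h\<in>off_diag_steps. sq_norm lborel (\<lambda>p. step_fun h p - f k p) \<le> ennreal (1 / real (Suc k))" for k
  proof -
    obtain h where h: "range h \<subseteq> off_diag_steps" "(\<lambda>k'. sq_norm lborel (\<lambda>p. step_fun (h k') p - f k p)) \<longlonglongrightarrow> 0"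
      using f[of k] by (auto simp: step_limit_def)
    have "\<forall>\<^sub>F k' in sequentially. sq_norm lborel (\<lambda>p. step_fun (h k') p - f k p) < ennreal (1 / real (Suc k))"
      using order_tendstoD(2)[OF h(2)] by simp
    then obtain k' where "sq_norm lborel (\<lambda>p. step_fun (h k') p - f k p) < ennreal (1 / real (Suc k))"
      by (auto simp: eventually_sequentially)
    then show ?thesis using h(1) by (intro bexI[of _ "h k'"]) auto
  qed
  then obtain h where h: "\<And>k. h k \<in> off_diag_steps" "\<And>k. sq_norm lborel (\<lambda>p. step_fun (h k) p - f k p) \<le> ennreal (1 / real (Suc k))"
    by metis
  note [measurable] = step_fun_measurable[OF h(1)]
  have "(\<lambda>k. 1 / real (Suc k)) \<longlonglongrightarrow> 0" using lim_1_over_n by (rule LIMSEQ_Suc)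
  then have "(\<lambda>k. ennreal (1 / real (Suc k))) \<longlonglongrightarrow> ennreal 0" by (rule tendsto_ennrealI)
  then have "(\<lambda>k. 2 * ennreal (1 / real (Suc k)) + 2 * sq_norm lborel (\<lambda>p. f k p - g p)) \<longlonglongrightarrow> 2 * ennreal 0 + 2 * 0"
    by (intro tendsto_add ennreal_tendsto_cmult lim) (simp_all add: less_top)
  then have lim': "(\<lambda>k. 2 * ennreal (1 / real (Suc k)) + 2 * sq_norm lborel (\<lambda>p. f k p - g p)) \<longlonglongrightarrow> 0" by simp
  have "(\<lambda>k. sq_norm lborel (\<lambda>p. step_fun (h k) p - g p)) \<longlonglongrightarrow> 0"
  proof (rule ennreal_tendsto_0_le[OF lim'])
    fix k
    have "sq_norm lborel (\<lambda>p. step_fun (h k) p - g p) \<le> 2 * sq_norm lborel (\<lambda>p. step_fun (h k) p - f k p) + 2 * sq_norm lborel (\<lambda>p. f k p - g p)"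
      by (rule sq_norm_triangle) auto
    also have "\<dots> \<le> 2 * ennreal (1 / real (Suc k)) + 2 * sq_norm lborel (\<lambda>p. f k p - g p)"
      by (intro add_mono mult_left_mono h(2)) auto
    finally show "sq_norm lborel (\<lambda>p. step_fun (h k) p - g p) \<le> 2 * ennreal (1 / real (Suc k)) + 2 * sq_norm lborel (\<lambda>p. f k p - g p)" .
  qed
  then show ?thesis unfolding step_limit_def using h(1) by (intro conjI exI[of _ h]) auto
qed

text \<open>The form in which closedness is mostly applied: pointwise limits whose squared errors
  are dominated by an integrable \<open>w\<close>.\<close>

lemma step_limit_dominated:
  assumes f: "\<And>k. step_limit (f k)" and g [measurable]: "g \<in> borel_measurable borel"
    and lim: "\<And>p. (\<lambda>k. f k p) \<longlonglongrightarrow> g p"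
    and w [measurable]: "w \<in> borel_measurable borel" and fin: "(\<integral>\<^sup>+p. w p \<partial>lborel) < \<infinity>"
    and dom: "\<And>k p. ennreal ((f k p - g p)\<^sup>2) \<le> w p"
  shows "step_limit g"
proof (rule step_limit_limit[where f=f])
  show "step_limit (f k)" for k by (rule f)
  show "g \<in> borel_measurable borel" by (rule g)
  note [measurable] = step_limit_measurable[OF f]
  have "(\<lambda>k. \<integral>\<^sup>+p. ennreal ((f k p - g p)\<^sup>2) \<partial>lborel) \<longlonglongrightarrow> (\<integral>\<^sup>+(p :: real \<times> real). ennreal 0 \<partial>lborel)"
  proof (rule nn_integral_dominated_convergence[where w=w])
    show "AE p in lborel. (\<lambda>k. ennreal ((f k p - g p)\<^sup>2)) \<longlonglongrightarrow> ennreal 0"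
    proof (intro AE_I2 tendsto_ennrealI)
      fix p show "(\<lambda>k. (f k p - g p)\<^sup>2) \<longlonglongrightarrow> 0"
        using tendsto_power[OF tendsto_diff[OF lim[of p] tendsto_const[of "g p"]], of 2] by simp
    qed
  qed (use fin dom in auto)
  then show "(\<lambda>k. sq_norm lborel (\<lambda>p. f k p - g p)) \<longlonglongrightarrow> 0" by (simp add: sq_norm_def)
qed

text \<open>Two cells and a single coefficient off the diagonal. The sides must be disjoint to be
  different cells of one step; other rectangles have to be approximated.\<close>

lemma step_limit_disjoint_rectangle:
  assumes "A \<in> finite_borel_sets" "B \<in> finite_borel_sets" "A \<inter> B = {}"
  shows "step_limit (indicator (A \<times> B))"
proof -
  let ?h = "(2, \<lambda>i. if i = 0 then A else B, \<lambda>i j. if i = 0 \<and> j = 1 then 1 else 0) :: off_diag_step"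
  have "?h \<in> off_diag_steps"
    using assms by (auto simp: off_diag_steps_def disjoint_family_on_def)
  then have "step_limit (step_fun ?h)" by (rule step_limit_step_fun)
  also have "step_fun ?h = indicator (A \<times> B)"
    by (auto simp: fun_eq_iff numeral_2_eq_2 indicator_times)
  finally show ?thesis .
qed

text \<open>Dropping the diagonal blocks of a grid of mesh \<open>1 / (k + 1)\<close> costs measure at most \<open>measure lborel A / (k + 1)\<close>.\<close>

lemma step_limit_rectangle:
  assumes A: "A \<in> sets borel" "A \<subseteq> {-real N..<real N}" and B: "B \<in> sets borel" "B \<subseteq> {-real N..<real N}"
  shows "step_limit (indicator (A \<times> B))"
proof -
  have I: "{-real N..<real N} \<in> finite_borel_sets" by (simp add: finite_borel_sets_def)
  have fA: "A \<in> finite_borel_sets" and fB: "B \<in> finite_borel_sets" using finite_borel_sets_subset[OF I] A B by auto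
  define c where "c k i = {x :: real. \<lfloor>x * real (Suc k)\<rfloor> = i}" for k i
  have c_eq: "c k i = {real_of_int i / real (Suc k)..<(real_of_int i + 1) / real (Suc k)}" for k i
    unfolding c_def floor_eq_iff by (auto simp: field_simps)
  have [measurable]: "c k i \<in> sets borel" for k i by (simp add: c_eq)
  \<comment> \<open>All values of the floor on the half-open interval from \<open>- N\<close> to
    \<open>N\<close>; there are finitely many, so that \<open>f k\<close> below is a finite
    sum.\<close>
  define Z where "Z k = {- (int N * int (Suc k))..<int N * int (Suc k)}" for k
  define P where "P k = {p \<in> Z k \<times> Z k. fst p \<noteq> snd p}" for k
  have finP: "finite (P k)" for k by (simp add: P_def Z_def)
  have inZ: "\<lfloor>x * real (Suc k)\<rfloor> \<in> Z k" if "x \<in> {-real N..<real N}" for x k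
  proof -
    have "- (real N * real (Suc k)) \<le> x * real (Suc k)" "x * real (Suc k) < real N * real (Suc k)"
      using that mult_right_mono[of "- real N" x "real (Suc k)"] by (auto simp: mult_less_cancel_right)
    then have "of_int (- (int N * int (Suc k))) \<le> x * real (Suc k)" "x * real (Suc k) < of_int (int N * int (Suc k))"
      by (simp_all only: of_int_minus of_int_mult of_int_of_nat_eq)
    then show ?thesis unfolding Z_def by (simp only: le_floor_iff floor_less_iff atLeastLessThan_iff)
  qed
  define f where "f k z = (\<Sum>p\<in>P k. indicator ((A \<inter> c k (fst p)) \<times> (B \<inter> c k (snd p))) z :: real)" for k z
  have f: "step_limit (f k)" for k
    unfolding f_def
  proof (intro step_limit_sum finP step_limit_disjoint_rectangle)
    fix p assume "p \<in> P k"
    then show "A \<inter> c k (fst p) \<in> finite_borel_sets" "B \<inter> c k (snd p) \<in> finite_borel_sets" "A \<inter> c k (fst p) \<inter> (B \<inter> c k (snd p)) = {}"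
      using finite_borel_sets_subset[OF fA, of "A \<inter> c k (fst p)"] finite_borel_sets_subset[OF fB, of "B \<inter> c k (snd p)"] A B
      by (auto simp: P_def c_def)
  qed
  define D where "D k = {(x, y). x \<in> A \<and> y \<in> B \<and> \<lfloor>x * real (Suc k)\<rfloor> = \<lfloor>y * real (Suc k)\<rfloor>}" for k
  have f_eq: "f k z = indicator (A \<times> B) z - indicator (D k) z" for k z
  proof -
    obtain x y where z: "z = (x, y)" by (cases z)
    show ?thesis
    proof (cases "x \<in> A \<and> y \<in> B")
      case False then show ?thesis by (auto simp: f_def z D_def intro!: sum.neutral split: split_indicator)
    next
      case True
      let ?p = "(\<lfloor>x * real (Suc k)\<rfloor>, \<lfloor>y * real (Suc k)\<rfloor>)"
      have "f k z = (\<Sum>p\<in>P k. if p = ?p then 1 else 0)"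
        unfolding f_def z using True by (intro sum.cong refl) (auto simp: c_def indicator_def)
      also have "\<dots> = (if ?p \<in> P k then 1 else 0)" using finP by simp
      also have "\<dots> = indicator (A \<times> B) z - indicator (D k) z"
        using True A B inZ[of x k] inZ[of y k] by (auto simp: P_def z D_def indicator_def)
      finally show ?thesis .
    qed
  qed
  have [measurable]: "A \<in> sets borel" "B \<in> sets borel" by fact+
  have ABm [measurable]: "A \<times> B \<in> sets (borel :: (real \<times> real) measure)"
    unfolding borel_prod[symmetric] by (intro pair_measureI A B)
  have D_eq: "D k = (A \<times> B) \<inter> {p \<in> space (borel \<Otimes>\<^sub>M borel). \<lfloor>fst p * real (Suc k)\<rfloor> = \<lfloor>snd p * real (Suc k)\<rfloor>}" for k
    by (auto simp: D_def space_pair_measure)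
  have Dm: "D k \<in> sets (borel \<Otimes>\<^sub>M borel)" for k unfolding D_eq by measurable
  have [measurable]: "D k \<in> sets (borel :: (real \<times> real) measure)" for k unfolding borel_prod[symmetric] by (rule Dm)
  have D_small: "emeasure lborel (D k) \<le> ennreal (measure lborel A * (1 / real (Suc k)))" for k
  proof -
    have "emeasure lborel (D k) = emeasure (lborel \<Otimes>\<^sub>M lborel) (D k)" by (simp add: lborel_prod)
    also have "\<dots> = (\<integral>\<^sup>+x. emeasure lborel (Pair x -` D k) \<partial>lborel)"
      by (rule lborel.emeasure_pair_measure_alt) (use Dm in simp)
    \<comment> \<open>The section of \<open>D k\<close> at \<open>x\<close> lies in the one grid
      cell that contains \<open>x\<close>, of length \<open>1 / (k + 1)\<close>.\<close>
    also have "\<dots> \<le> (\<integral>\<^sup>+x. ennreal (1 / real (Suc k)) * indicator A x \<partial>lborel)"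
    proof (intro nn_integral_mono)
      fix x :: real
      have "Pair x -` D k \<subseteq> (if x \<in> A then c k \<lfloor>x * real (Suc k)\<rfloor> else {})" by (auto simp: D_def c_def)
      then have "emeasure lborel (Pair x -` D k) \<le> emeasure lborel (if x \<in> A then c k \<lfloor>x * real (Suc k)\<rfloor> else {})"
        by (rule emeasure_mono) auto
      also have "\<dots> \<le> ennreal (1 / real (Suc k)) * indicator A x"
        by (auto simp: c_eq emeasure_lborel_Ico divide_right_mono add_divide_distrib)
      finally show "emeasure lborel (Pair x -` D k) \<le> ennreal (1 / real (Suc k)) * indicator A x" .
    qed
    also have "\<dots> = ennreal (measure lborel A * (1 / real (Suc k)))"
      by (subst nn_integral_cmult_indicator) (simp_all add: finite_borel_sets_emeasure[OF fA] ennreal_mult[symmetric] mult.commute)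
    finally show ?thesis .
  qed
  have "(\<lambda>k. measure lborel A * (1 / real (Suc k))) \<longlonglongrightarrow> measure lborel A * 0"
    by (intro tendsto_mult tendsto_const LIMSEQ_Suc[OF lim_1_over_n])
  then have "(\<lambda>k. ennreal (measure lborel A * (1 / real (Suc k)))) \<longlonglongrightarrow> ennreal (measure lborel A * 0)" by (rule tendsto_ennrealI)
  then have lim0: "(\<lambda>k. ennreal (measure lborel A * (1 / real (Suc k)))) \<longlonglongrightarrow> 0" by simp
  show ?thesis
  proof (rule step_limit_limit[where f=f, OF f])
    show "(\<lambda>k. sq_norm lborel (\<lambda>p. f k p - indicator (A \<times> B) p)) \<longlonglongrightarrow> 0"
    proof (rule ennreal_tendsto_0_le[OF lim0])
      fix k
      have "sq_norm lborel (\<lambda>p. f k p - indicator (A \<times> B) p) = (\<integral>\<^sup>+p. indicator (D k) p \<partial>lborel)"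
        unfolding sq_norm_def f_eq by (intro nn_integral_cong) (auto simp: indicator_def)
      also have "\<dots> = emeasure lborel (D k)" by simp
      finally show "sq_norm lborel (\<lambda>p. f k p - indicator (A \<times> B) p) \<le> ennreal (measure lborel A * (1 / real (Suc k)))"
        using D_small by simp
    qed
  qed simp
qed

text \<open>Induction from rectangles through complements and disjoint unions. Complements are
  formed inside the square \<open>?Q\<close>, whose indicator is square integrable, unlike that of
  the plane.\<close>

lemma step_limit_bounded_set:
  assumes E: "E \<in> sets (borel :: (real \<times> real) measure)"
  shows "step_limit (indicator (E \<inter> {-real N..<real N} \<times> {-real N..<real N}))"
proof -
  let ?I = "{-real N..<real N}" and ?Q = "{-real N..<real N} \<times> {-real N..<real N}"
  let ?G = "{a \<times> b | a b. a \<in> sets (borel :: real measure) \<and> b \<in> sets (borel :: real measure)}"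
  have G: "Int_stable ?G" by (rule Int_stable_pair_measure_generator)
  have Qm: "?Q \<in> sets (borel :: (real \<times> real) measure)"
    unfolding borel_prod[symmetric] by (intro pair_measureI) auto
  have Qfin: "emeasure lborel ?Q < \<infinity>"
  proof -
    have "emeasure lborel ?Q = emeasure (lborel \<Otimes>\<^sub>M lborel) ?Q" by (simp add: lborel_prod)
    also have "\<dots> = emeasure lborel ?I * emeasure lborel ?I" by (rule lborel.emeasure_pair_measure_Times) auto
    also have "\<dots> < \<infinity>" by (simp add: ennreal_mult_less_top)
    finally show ?thesis .
  qed
  have borel_eq: "sets (borel :: (real \<times> real) measure) = sigma_sets UNIV ?G"
    unfolding borel_prod[symmetric] sets_pair_measure by simp
  have Q: "step_limit (indicator ?Q)" by (rule step_limit_rectangle) auto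
  have "E \<in> sigma_sets UNIV ?G" using E by (simp add: borel_eq)
  have "?G \<subseteq> Pow UNIV" by auto
  with G show ?thesis using \<open>E \<in> sigma_sets UNIV ?G\<close>
  proof (induction rule: sigma_sets_induct_disjoint)
    case (basic X)
    then obtain A B where "X = A \<times> B" "A \<in> sets borel" "B \<in> sets borel" by auto
    moreover have "(A \<times> B) \<inter> ?Q = (A \<inter> ?I) \<times> (B \<inter> ?I)" by auto
    ultimately show ?case using step_limit_rectangle[of "A \<inter> ?I" N "B \<inter> ?I"] by simp
  next
    case empty then show ?case using step_limit_0 by simp
  next
    case (compl X)
    have "step_limit (\<lambda>p. indicator ?Q p + (-1) * indicator (X \<inter> ?Q) p)" by (rule step_limit_linear[OF Q compl(2)])
    also have "(\<lambda>p. indicator ?Q p + (-1) * indicator (X \<inter> ?Q) p) = (indicator ((UNIV - X) \<inter> ?Q) :: _ \<Rightarrow> real)"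
      by (auto simp: fun_eq_iff indicator_def)
    finally show ?case .
  next
    case (union A)
    have Am: "A i \<in> sets borel" for i unfolding borel_eq using union(2) by blast
    show ?case
    proof (rule step_limit_dominated[where f="\<lambda>k p. \<Sum>i<k. indicator (A i \<inter> ?Q) p" and w="indicator ?Q"])
      show "step_limit (\<lambda>p. \<Sum>i<k. indicator (A i \<inter> ?Q) p)" for k
        by (intro step_limit_sum union(3)) auto
      show "indicator (\<Union> (range A) \<inter> ?Q) \<in> borel_measurable borel" using Am Qm by (intro borel_measurable_indicator sets.Int) auto
      show "indicator ?Q \<in> borel_measurable borel" using Qm by simp
      show "(\<integral>\<^sup>+p. indicator ?Q p \<partial>lborel) < \<infinity>" using Qfin Qm by simp
      have part: "(\<Sum>i<k. indicator (A i \<inter> ?Q) p) = (indicator ((\<Union>i<k. A i) \<inter> ?Q) p :: real)" for k p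
      proof -
        have "disjoint_family_on (\<lambda>i. A i \<inter> ?Q) {..<k}" using union(1) by (auto simp: disjoint_family_on_def)
        from indicator_UN_disjoint[OF finite_lessThan this]
        have "(\<Sum>i<k. indicator (A i \<inter> ?Q) p) = (indicator (\<Union>i<k. A i \<inter> ?Q) p :: real)" by (rule sym)
        also have "(\<Union>i<k. A i \<inter> ?Q) = (\<Union>i<k. A i) \<inter> ?Q" by blast
        finally show ?thesis .
      qed
      show "(\<lambda>k. \<Sum>i<k. indicator (A i \<inter> ?Q) p) \<longlonglongrightarrow> (indicator (\<Union> (range A) \<inter> ?Q) p :: real)" for p
      proof (cases "p \<in> \<Union> (range A)")
        case True
        then obtain i where i: "p \<in> A i" by auto
        show ?thesis
        proof (rule tendsto_eventually, unfold part, rule eventually_sequentiallyI[of "Suc i"])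
          fix k assume "Suc i \<le> k"
          then show "indicator ((\<Union>i<k. A i) \<inter> ?Q) p = (indicator (\<Union> (range A) \<inter> ?Q) p :: real)"
            using i by (auto simp: indicator_def)
        qed
      next
        case False then show ?thesis by (simp add: part indicator_def)
      qed
      show "ennreal (((\<Sum>i<k. indicator (A i \<inter> ?Q) p) - indicator (\<Union> (range A) \<inter> ?Q) p)\<^sup>2) \<le> indicator ?Q p" for k p
        unfolding part by (auto simp: indicator_def)
    qed
  qed
qed

text \<open>Squares exhaust the plane, and the errors are dominated by the indicator of
  \<open>E\<close> itself.\<close>

lemma step_limit_set:
  assumes E [measurable]: "E \<in> sets (borel :: (real \<times> real) measure)" and fin: "emeasure lborel E < \<infinity>"
  shows "step_limit (indicator E)"
proof (rule step_limit_dominated[where f="\<lambda>k. indicator (E \<inter> {-real k..<real k} \<times> {-real k..<real k})" and w="indicator E"])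
  show "step_limit (indicator (E \<inter> {-real k..<real k} \<times> {-real k..<real k}))" for k by (rule step_limit_bounded_set[OF E])
  show "(\<integral>\<^sup>+p. indicator E p \<partial>lborel) < \<infinity>" using fin E by simp
  show "(\<lambda>k. indicator (E \<inter> {-real k..<real k} \<times> {-real k..<real k}) p) \<longlonglongrightarrow> (indicator E p :: real)" for p
  proof -
    obtain n where n: "\<bar>fst p\<bar> < real n" "\<bar>snd p\<bar> < real n"
      using reals_Archimedean2[of "max \<bar>fst p\<bar> \<bar>snd p\<bar>"] by auto
    show ?thesis
    proof (rule tendsto_eventually, rule eventually_sequentiallyI[of n])
      fix k assume "n \<le> k"
      then have "real n \<le> real k" by simp
      then have "p \<in> {-real k..<real k} \<times> {-real k..<real k}" using n by (cases p) auto
      then show "indicator (E \<inter> {-real k..<real k} \<times> {-real k..<real k}) p = (indicator E p :: real)"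
        by (auto simp: indicator_def)
    qed
  qed
  show "ennreal ((indicator (E \<inter> {-real k..<real k} \<times> {-real k..<real k}) p - indicator E p)\<^sup>2) \<le> indicator E p" for k p
    by (auto simp: indicator_def)
qed measurable

lemma step_limit_square_integrable:
  assumes f [measurable]: "f \<in> borel_measurable borel" and fin: "sq_norm lborel f < \<infinity>"
  shows "step_limit f"
proof -
  obtain F where F: "\<And>i. simple_function borel (F i)" "\<And>x. (\<lambda>i. F i x) \<longlonglongrightarrow> f x" "\<And>i x. dist (F i x) 0 \<le> 2 * dist (f x) 0"
    using borel_measurable_implies_sequence_metric[OF f, of 0] by auto
  note [measurable] = borel_measurable_simple_function[OF F(1)]
  have le: "\<bar>F i x\<bar> \<le> 2 * \<bar>f x\<bar>" for i x using F(3)[of i x] by simp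
  have finF: "sq_norm lborel (F i) < \<infinity>" for i
  proof -
    have "(F i x)\<^sup>2 \<le> 4 * (f x)\<^sup>2" for x
      using power_mono[OF le[of i x] abs_ge_zero, of 2] by (simp add: power_mult_distrib)
    then have "sq_norm lborel (F i) \<le> (\<integral>\<^sup>+x. ennreal 4 * ennreal ((f x)\<^sup>2) \<partial>lborel)"
      unfolding sq_norm_def by (intro nn_integral_mono) (simp add: ennreal_mult[symmetric] ennreal_leI del: ennreal_numeral)
    also have "\<dots> = ennreal 4 * sq_norm lborel f" unfolding sq_norm_def by (rule nn_integral_cmult) auto
    also have "\<dots> < \<infinity>" using fin by (simp add: ennreal_mult_less_top)
    finally show ?thesis .
  qed
  have FS: "step_limit (F i)" for i
  proof -
    let ?R = "range (F i)"
    have R: "finite ?R" using simple_functionD(1)[OF F(1), of i] by simp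
    have single: "step_limit (\<lambda>p. y * indicator (F i -` {y}) p)" for y
    \<comment> \<open>A nonzero value is taken on a set of finite measure, by Chebyshev's
      inequality; the zero set may have infinite measure but contributes nothing.\<close>
    proof (cases "y = 0")
      case True then show ?thesis using step_limit_0 by simp
    next
      case False
      have S [measurable]: "F i -` {y} \<in> sets borel" using simple_functionD(2)[OF F(1), of i "{y}"] by simp
      have "ennreal (y\<^sup>2) * emeasure lborel (F i -` {y}) = (\<integral>\<^sup>+p. ennreal (y\<^sup>2) * indicator (F i -` {y}) p \<partial>lborel)"
        by (subst nn_integral_cmult_indicator) auto
      also have "\<dots> \<le> sq_norm lborel (F i)"
        unfolding sq_norm_def by (intro nn_integral_mono) (auto simp: indicator_def)
      also have "\<dots> < \<infinity>" by (rule finF)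
      finally have "emeasure lborel (F i -` {y}) < \<infinity>" using False by (auto simp: ennreal_mult_less_top)
      then show ?thesis by (intro step_limit_cmult step_limit_set S)
    qed
    have "F i = (\<lambda>p. \<Sum>y\<in>?R. y * indicator (F i -` {y}) p)"
    proof
      fix p
      have "(\<Sum>y\<in>?R. y * indicator (F i -` {y}) p) = (\<Sum>y\<in>?R. if y = F i p then y else 0)"
        by (intro sum.cong) (auto simp: indicator_def)
      then show "F i p = (\<Sum>y\<in>?R. y * indicator (F i -` {y}) p)" using R by simp
    qed
    then show ?thesis using step_limit_sum[OF R, of "\<lambda>y p. y * indicator (F i -` {y}) p", OF single] by simp
  qed
  show ?thesis
  \<comment> \<open>The approximants are at most twice \<open>f\<close> in absolute value, so the
    error is at most three times \<open>f\<close>, whence the 9.\<close>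
  proof (rule step_limit_dominated[OF FS f F(2), where w="\<lambda>p. ennreal 9 * ennreal ((f p)\<^sup>2)"])
    show "(\<integral>\<^sup>+p. ennreal 9 * ennreal ((f p)\<^sup>2) \<partial>lborel) < \<infinity>"
      using fin by (simp add: nn_integral_cmult sq_norm_def[symmetric] ennreal_mult_less_top)
    show "ennreal ((F k p - f p)\<^sup>2) \<le> ennreal 9 * ennreal ((f p)\<^sup>2)" for k p
    proof -
      have "\<bar>F k p - f p\<bar> \<le> 3 * \<bar>f p\<bar>" using le[of k p] by linarith
      from power_mono[OF this, of 2] have "(F k p - f p)\<^sup>2 \<le> 9 * (f p)\<^sup>2" by (simp add: power_mult_distrib)
      then show ?thesis by (simp add: ennreal_mult[symmetric] ennreal_leI del: ennreal_numeral)
    qed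
  qed measurable
qed

end

section \<open>The double Wiener-Ito integral\<close>

context brownian_random_measure
begin

lemma has_double_wiener_ito_sq_norm:
  "has_double_wiener_ito M W f Z \<longleftrightarrow> f \<in> borel_measurable borel \<and> Z \<in> borel_measurable M \<and>
     (\<exists>h :: nat \<Rightarrow> off_diag_step. range h \<subseteq> off_diag_steps \<and>
        (\<lambda>k. sq_norm lborel (\<lambda>p. step_fun (h k) p - f p)) \<longlonglongrightarrow> 0 \<and>
        (\<lambda>k. sq_norm M (\<lambda>\<omega>. step_integral W (h k) \<omega> - Z \<omega>)) \<longlonglongrightarrow> 0)"
  by (simp add: has_double_wiener_ito_def sq_norm_def)

lemma L1_le_sq_norm:
  assumes [measurable]: "f \<in> borel_measurable M"
  shows "(\<integral>\<^sup>+\<omega>. ennreal \<bar>f \<omega>\<bar> \<partial>M)\<^sup>2 \<le> sq_norm M f"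
  using nn_integral_Cauchy_Schwarz[of "\<lambda>\<omega>. ennreal \<bar>f \<omega>\<bar>" M "\<lambda>_. 1"] by (simp add: sq_norm_abs emeasure_space_1)

lemma ennreal_power2_le_imp_le:
  assumes "x\<^sup>2 \<le> (ennreal c)\<^sup>2" "0 \<le> c" shows "x \<le> ennreal c"
proof (cases x)
  case (real r)
  then show ?thesis using assms power2_le_imp_le[of r c] by (simp add: ennreal_power)
next
  case top
  then show ?thesis using assms by (simp add: ennreal_power top_power_ennreal top_unique)
qed

text \<open>The argument of Riesz and Fischer: a fast subsequence of step integrals converges almost
  surely, and Fatou's lemma turns this into convergence in L2.\<close>

lemma has_double_wiener_ito_exists:
  assumes f [measurable]: "f \<in> borel_measurable borel" and fin: "sq_norm lborel f < \<infinity>"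
  shows "\<exists>Z. has_double_wiener_ito M W f Z"
proof -
  obtain h0 where h0: "range h0 \<subseteq> off_diag_steps" "(\<lambda>k. sq_norm lborel (\<lambda>p. step_fun (h0 k) p - f p)) \<longlonglongrightarrow> 0"
    using step_limit_square_integrable[OF f fin] by (auto simp: step_limit_def)
  \<comment> \<open>The ratio 1/8 is fast enough: by \<open>SS\<close> the L1 distance of neighbours
    is at most the root of \<open>8 * (1 / 8) ^ k\<close>, which is below the summable
    \<open>3 * (1 / 2) ^ k\<close>.\<close>
  define e where "e k = (1 / 8 :: real) ^ k" for k
  have e: "0 < e k" for k by (simp add: e_def)
  have "\<exists>n. sq_norm lborel (\<lambda>p. step_fun (h0 n) p - f p) \<le> ennreal (e k)" for k
  proof -
    have "\<forall>\<^sub>F n in sequentially. sq_norm lborel (\<lambda>p. step_fun (h0 n) p - f p) < ennreal (e k)"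
      using order_tendstoD(2)[OF h0(2)] e by simp
    then show ?thesis by (auto simp: eventually_sequentially intro: less_imp_le)
  qed
  then obtain n where n: "\<And>k. sq_norm lborel (\<lambda>p. step_fun (h0 (n k)) p - f p) \<le> ennreal (e k)" by metis
  define h where "h k = h0 (n k)" for k
  have h: "h k \<in> off_diag_steps" for k using h0(1) by (auto simp: h_def)
  have hf: "sq_norm lborel (\<lambda>p. step_fun (h k) p - f p) \<le> ennreal (e k)" for k using n by (simp add: h_def)
  note [measurable] = step_fun_measurable[OF h] step_integral_measurable[OF h]
  define S where "S k = step_integral W (h k)" for k
  have [measurable]: "S k \<in> borel_measurable M" for k unfolding S_def by measurable
  \<comment> \<open>The 8 is 2 * (2 + 2): a factor 2 from the norm of the integral, and twice the 2
    of \<open>sq_norm_triangle\<close>.\<close>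
  have SS: "sq_norm M (\<lambda>\<omega>. S k \<omega> - S l \<omega>) \<le> ennreal (8 * e k)" if "k \<le> l" for k l
  proof -
    have "e l \<le> e k" unfolding e_def using that by (intro power_decreasing) auto
    have "sq_norm M (\<lambda>\<omega>. S k \<omega> - S l \<omega>) \<le> 2 * sq_norm lborel (\<lambda>p. step_fun (h k) p - step_fun (h l) p)"
      unfolding S_def by (rule sq_norm_step_integral_diff_le[OF h h])
    also have "\<dots> \<le> 2 * (2 * sq_norm lborel (\<lambda>p. step_fun (h k) p - f p) + 2 * sq_norm lborel (\<lambda>p. f p - step_fun (h l) p))"
      by (intro mult_left_mono sq_norm_triangle) auto
    also have "\<dots> \<le> 2 * (2 * ennreal (e k) + 2 * ennreal (e k))"
      using hf[of k] order_trans[OF hf[of l] ennreal_leI[OF \<open>e l \<le> e k\<close>]]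
      by (intro mult_left_mono add_mono) (auto simp: sq_norm_minus_commute[of lborel f])
    also have "\<dots> = ennreal (2 * (2 * e k + 2 * e k))"
      using e[of k] by (simp only: ennreal_mult ennreal_plus ennreal_numeral mult_nonneg_nonneg add_nonneg_nonneg less_imp_le zero_le_numeral)
    finally show ?thesis by (simp add: mult.assoc[symmetric])
  qed
  have L1: "(\<integral>\<^sup>+\<omega>. ennreal \<bar>S (Suc k) \<omega> - S k \<omega>\<bar> \<partial>M) \<le> ennreal (3 * (1 / 2) ^ k)" for k
  proof -
    have "(\<integral>\<^sup>+\<omega>. ennreal \<bar>S (Suc k) \<omega> - S k \<omega>\<bar> \<partial>M)\<^sup>2 \<le> ennreal (8 * e k)"
      using L1_le_sq_norm[of "\<lambda>\<omega>. S (Suc k) \<omega> - S k \<omega>"] SS[of k "Suc k"] by (simp add: sq_norm_minus_commute[of M "S (Suc k)"])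
    also have "\<dots> \<le> ennreal ((3 * (1 / 2) ^ k)\<^sup>2)"
    proof (rule ennreal_leI)
      have "(1 / 8 :: real) ^ k \<le> (1 / 4) ^ k" by (intro power_mono) auto
      then have "8 * (1 / 8 :: real) ^ k \<le> 9 * (1 / 4) ^ k" by (intro mult_mono) auto
      also have "\<dots> = (3 * (1 / 2) ^ k)\<^sup>2" by (simp add: power_mult_distrib power_mult[symmetric] power2_eq_square power_commutes flip: power_mult_distrib)
      finally show "8 * e k \<le> (3 * (1 / 2) ^ k)\<^sup>2" by (simp add: e_def)
    qed
    also have "\<dots> = (ennreal (3 * (1 / 2) ^ k))\<^sup>2" by (rule ennreal_power[symmetric]) simp
    finally have "(\<integral>\<^sup>+\<omega>. ennreal \<bar>S (Suc k) \<omega> - S k \<omega>\<bar> \<partial>M)\<^sup>2 \<le> (ennreal (3 * (1 / 2) ^ k))\<^sup>2" .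
    then show ?thesis by (rule ennreal_power2_le_imp_le) simp
  qed
  have "(\<integral>\<^sup>+\<omega>. (\<Sum>k. ennreal \<bar>S (Suc k) \<omega> - S k \<omega>\<bar>) \<partial>M) = (\<Sum>k. \<integral>\<^sup>+\<omega>. ennreal \<bar>S (Suc k) \<omega> - S k \<omega>\<bar> \<partial>M)"
    by (rule nn_integral_suminf) auto
  also have "\<dots> \<le> (\<Sum>k. ennreal (3 * (1 / 2) ^ k))"
    by (intro suminf_le L1) auto
  also have "\<dots> < \<infinity>"
    by (subst suminf_ennreal2) (auto intro!: summable_mult summable_geometric)
  finally have "AE \<omega> in M. (\<Sum>k. ennreal \<bar>S (Suc k) \<omega> - S k \<omega>\<bar>) \<noteq> \<infinity>"
    by (intro nn_integral_PInf_AE) auto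
  then have conv: "AE \<omega> in M. convergent (\<lambda>k. S k \<omega>)"
  proof eventually_elim
    case (elim \<omega>)
    then have "summable (\<lambda>k. \<bar>S (Suc k) \<omega> - S k \<omega>\<bar>)" by (intro summable_suminf_not_top) auto
    then have "summable (\<lambda>k. S (Suc k) \<omega> - S k \<omega>)" by (rule summable_rabs_cancel)
    then have "convergent (\<lambda>n. \<Sum>k<n. S (Suc k) \<omega> - S k \<omega>)" by (simp add: summable_iff_convergent)
    then have "convergent (\<lambda>n. S n \<omega> - S 0 \<omega>)" by (simp add: sum_lessThan_telescope[of "\<lambda>k. S k \<omega>"])
    from convergent_add[OF this convergent_const] have "convergent (\<lambda>n. (S n \<omega> - S 0 \<omega>) + S 0 \<omega>)" .
    then show ?case by simp
  qed
  \<comment> \<open>Where the sequence diverges, on a null set, the value of \<open>lim\<close> is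
    of no concern; \<open>Z\<close> is measurable nevertheless.\<close>
  define Z where "Z \<omega> = lim (\<lambda>k. S k \<omega>)" for \<omega>
  have [measurable]: "Z \<in> borel_measurable M" unfolding Z_def by (rule borel_measurable_lim_metric) measurable
  have SZ: "AE \<omega> in M. (\<lambda>k. S k \<omega>) \<longlonglongrightarrow> Z \<omega>"
    using conv by eventually_elim (simp add: Z_def convergent_LIMSEQ_iff)
  have bound: "sq_norm M (\<lambda>\<omega>. S k \<omega> - Z \<omega>) \<le> ennreal (8 * e k)" for k
  proof -
    have "sq_norm M (\<lambda>\<omega>. S k \<omega> - Z \<omega>) = (\<integral>\<^sup>+\<omega>. liminf (\<lambda>l. ennreal ((S k \<omega> - S l \<omega>)\<^sup>2)) \<partial>M)"
      unfolding sq_norm_def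
    proof (rule nn_integral_cong_AE, use SZ in eventually_elim)
      fix \<omega> assume "(\<lambda>k. S k \<omega>) \<longlonglongrightarrow> Z \<omega>"
      then have "(\<lambda>l. ennreal ((S k \<omega> - S l \<omega>)\<^sup>2)) \<longlonglongrightarrow> ennreal ((S k \<omega> - Z \<omega>)\<^sup>2)"
        by (intro tendsto_ennrealI tendsto_power tendsto_diff tendsto_const)
      then show "ennreal ((S k \<omega> - Z \<omega>)\<^sup>2) = liminf (\<lambda>l. ennreal ((S k \<omega> - S l \<omega>)\<^sup>2))"
        by (intro lim_imp_Liminf[symmetric]) auto
    qed
    also have "\<dots> \<le> liminf (\<lambda>l. \<integral>\<^sup>+\<omega>. ennreal ((S k \<omega> - S l \<omega>)\<^sup>2) \<partial>M)"
      by (rule nn_integral_liminf) measurable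
    also have "\<dots> \<le> ennreal (8 * e k)"
    proof (rule Liminf_le)
      show "\<forall>\<^sub>F l in sequentially. (\<integral>\<^sup>+\<omega>. ennreal ((S k \<omega> - S l \<omega>)\<^sup>2) \<partial>M) \<le> ennreal (8 * e k)"
        using eventually_ge_at_top[of k] by eventually_elim (use SS in \<open>simp add: sq_norm_def\<close>)
    qed simp
    finally show ?thesis .
  qed
  have "(\<lambda>k. 8 * e k) \<longlonglongrightarrow> 8 * 0" unfolding e_def by (intro tendsto_mult tendsto_const LIMSEQ_power_zero) auto
  then have lim8: "(\<lambda>k. ennreal (8 * e k)) \<longlonglongrightarrow> 0" using tendsto_ennrealI by fastforce
  have hlim: "(\<lambda>k. sq_norm lborel (\<lambda>p. step_fun (h k) p - f p)) \<longlonglongrightarrow> 0"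
  proof (rule ennreal_tendsto_0_le[OF lim8])
    show "sq_norm lborel (\<lambda>p. step_fun (h k) p - f p) \<le> ennreal (8 * e k)" for k
      by (rule order_trans[OF hf ennreal_leI]) (use e[of k] in auto)
  qed
  have slim: "(\<lambda>k. sq_norm M (\<lambda>\<omega>. step_integral W (h k) \<omega> - Z \<omega>)) \<longlonglongrightarrow> 0"
    by (rule ennreal_tendsto_0_le[OF lim8]) (use bound in \<open>simp add: S_def\<close>)
  show ?thesis unfolding has_double_wiener_ito_sq_norm
    by (rule exI[of _ Z], intro conjI exI[of _ h] hlim slim f) (use h in auto)
qed

text \<open>Symmetrising the steps changes neither their integrals nor, as \<open>f\<close> is
  symmetric, their limit, so the formulas for symmetric steps hold along the whole sequence.\<close>

lemma double_wiener_ito_moments: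
  assumes Z: "has_double_wiener_ito M W f Z" and fin: "sq_norm lborel f < \<infinity>" and sym: "\<And>x y. f (x, y) = f (y, x)"
  shows "expectation (\<lambda>\<omega>. (Z \<omega>)\<^sup>2) = 2 * (\<integral>p. (f p)\<^sup>2 \<partial>lborel)"
    and "has_bochner_integral M (\<lambda>\<omega>. Z \<omega> ^ 3) (8 * (\<integral>p. cyclic_prod f p \<partial>(lborel \<Otimes>\<^sub>M (lborel \<Otimes>\<^sub>M lborel))))"
proof -
  have f [measurable]: "f \<in> borel_measurable borel" and Zm [measurable]: "Z \<in> borel_measurable M"
    using Z by (auto simp: has_double_wiener_ito_sq_norm)
  obtain h where h': "range h \<subseteq> off_diag_steps" and hlim: "(\<lambda>k. sq_norm lborel (\<lambda>p. step_fun (h k) p - f p)) \<longlonglongrightarrow> 0"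
    and slim: "(\<lambda>k. sq_norm M (\<lambda>\<omega>. step_integral W (h k) \<omega> - Z \<omega>)) \<longlonglongrightarrow> 0"
    using Z by (auto simp: has_double_wiener_ito_sq_norm)
  have h: "h k \<in> off_diag_steps" for k using h' by auto
  define S where "S k = step_integral W (h k)" for k
  define g where "g k = step_fun (sym_step (h k))" for k
  have [measurable]: "S k \<in> borel_measurable M" "g k \<in> borel_measurable borel" for k
    unfolding S_def g_def using step_integral_measurable[OF h] step_fun_measurable[OF sym_step_mem[OF h]] by auto
  have slim: "(\<lambda>k. sq_norm M (\<lambda>\<omega>. S k \<omega> - Z \<omega>)) \<longlonglongrightarrow> 0" using slim by (simp add: S_def)
  have glim: "(\<lambda>k. sq_norm lborel (\<lambda>p. g k p - f p)) \<longlonglongrightarrow> 0"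
    by (rule ennreal_tendsto_0_le[OF hlim]) (unfold g_def, rule sq_norm_sym_step_le[OF h f sym])
  note mom = step_integral_moments[OF h, folded S_def, folded g_def]
  have gfin: "sq_norm lborel (g k) < \<infinity>" for k
  proof (rule ccontr)
    assume "\<not> sq_norm lborel (g k) < \<infinity>"
    then have "sq_norm lborel (g k) = top" by (auto simp: less_top[symmetric])
    then show False using mom(5)[of k] mom(1)[of k] by (simp add: ennreal_mult_top)
  qed
  have Zfin: "sq_norm M Z < \<infinity>"
  proof -
    have "\<forall>\<^sub>F k in sequentially. sq_norm M (\<lambda>\<omega>. S k \<omega> - Z \<omega>) < 1" using order_tendstoD(2)[OF slim, of 1] by simp
    then obtain k where k: "sq_norm M (\<lambda>\<omega>. S k \<omega> - Z \<omega>) < 1" by (auto simp: eventually_sequentially)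
    have "sq_norm M Z \<le> 2 * sq_norm M (\<lambda>\<omega>. Z \<omega> - S k \<omega>) + 2 * sq_norm M (S k)"
      using sq_norm_add[of "\<lambda>\<omega>. Z \<omega> - S k \<omega>" M "S k"] by simp
    also have "\<dots> < \<infinity>" using k mom(5)[of k]
      by (auto simp: ennreal_mult_less_top sq_norm_minus_commute[of M Z] intro: less_trans)
    finally show ?thesis .
  qed
  have lim2: "(\<lambda>k. expectation (\<lambda>\<omega>. (S k \<omega>)\<^sup>2)) \<longlonglongrightarrow> expectation (\<lambda>\<omega>. (Z \<omega>)\<^sup>2)"
    by (rule sq_norm_tendsto_integral[OF _ Zm slim Zfin mom(5)]) measurable
  have glim2: "(\<lambda>k. \<integral>p. (g k p)\<^sup>2 \<partial>lborel) \<longlonglongrightarrow> (\<integral>p. (f p)\<^sup>2 \<partial>lborel)"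
    by (rule sq_norm_tendsto_integral[OF _ _ glim fin gfin]) auto
  have eq2: "expectation (\<lambda>\<omega>. (S k \<omega>)\<^sup>2) = 2 * (\<integral>p. (g k p)\<^sup>2 \<partial>lborel)" for k
  proof -
    have "ennreal (expectation (\<lambda>\<omega>. (S k \<omega>)\<^sup>2)) = sq_norm M (S k)" by (rule sq_norm_eq_integral[symmetric]) (use mom(5) in auto)
    also have "\<dots> = 2 * sq_norm lborel (g k)" by (rule mom(1))
    also have "sq_norm lborel (g k) = ennreal (\<integral>p. (g k p)\<^sup>2 \<partial>lborel)" by (rule sq_norm_eq_integral) (use gfin in auto)
    also have "2 * \<dots> = ennreal (2 * (\<integral>p. (g k p)\<^sup>2 \<partial>lborel))" by (simp add: ennreal_mult)
    finally show ?thesis by (subst (asm) ennreal_inj) auto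
  qed
  show "expectation (\<lambda>\<omega>. (Z \<omega>)\<^sup>2) = 2 * (\<integral>p. (f p)\<^sup>2 \<partial>lborel)"
    by (rule LIMSEQ_unique[OF lim2]) (unfold eq2, intro tendsto_mult tendsto_const glim2)
  \<comment> \<open>The second moments converge and so are bounded; one constant then bounds all
    fourth moments.\<close>
  obtain B0 where B0: "\<And>k. norm (expectation (\<lambda>\<omega>. (S k \<omega>)\<^sup>2)) \<le> B0"
    using convergent_imp_Bseq[OF convergentI[OF lim2]] by (auto simp: Bseq_def)
  define B where "B = 27 * B0\<^sup>2"
  have B: "0 \<le> B" by (simp add: B_def)
  have SB: "(\<integral>\<^sup>+\<omega>. ennreal (S k \<omega> ^ 4) \<partial>M) \<le> ennreal B" for k
  proof -
    have "(\<integral>\<^sup>+\<omega>. ennreal (S k \<omega> ^ 4) \<partial>M) = ennreal (expectation (\<lambda>\<omega>. S k \<omega> ^ 4))"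
      by (rule nn_integral_eq_integral[OF mom(3)]) auto
    also have "\<dots> \<le> ennreal B"
    proof (rule ennreal_leI)
      have "(expectation (\<lambda>\<omega>. (S k \<omega>)\<^sup>2))\<^sup>2 \<le> B0\<^sup>2"
        using power_mono[OF B0[of k] norm_ge_zero, of 2] by simp
      then show "expectation (\<lambda>\<omega>. S k \<omega> ^ 4) \<le> B" unfolding B_def using mom(4)[of k] by simp
    qed
    finally show ?thesis .
  qed
  \<comment> \<open>An almost surely convergent subsequence, along which Fatou's lemma carries the
    bound of the fourth moments over to \<open>Z\<close>.\<close>
  have "\<exists>r :: nat \<Rightarrow> nat. strict_mono r \<and> (AE \<omega> in M. (\<lambda>k. (S (r k) \<omega> - Z \<omega>)\<^sup>2) \<longlonglongrightarrow> 0)"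
  proof -
    have dfin: "sq_norm M (\<lambda>\<omega>. S k \<omega> - Z \<omega>) < \<infinity>" for k
    proof -
      have "sq_norm M (\<lambda>\<omega>. S k \<omega> - Z \<omega>) \<le> 2 * sq_norm M (S k) + 2 * sq_norm M (\<lambda>\<omega>. - Z \<omega>)"
        using sq_norm_add[of "S k" M "\<lambda>\<omega>. - Z \<omega>"] by simp
      also have "\<dots> < \<infinity>" using mom(5)[of k] Zfin by (simp add: ennreal_mult_less_top sq_norm_def)
      finally show ?thesis .
    qed
    have "(\<lambda>k. ennreal (expectation (\<lambda>\<omega>. (S k \<omega> - Z \<omega>)\<^sup>2))) \<longlonglongrightarrow> 0"
      using slim dfin by (simp add: sq_norm_eq_integral)
    then have "(\<lambda>k. expectation (\<lambda>\<omega>. (S k \<omega> - Z \<omega>)\<^sup>2)) \<longlonglongrightarrow> 0"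
      by (subst (asm) ennreal_tendsto_0_iff) auto
    then show ?thesis
      using dfin by (intro tendsto_L1_AE_subseq[where u="\<lambda>k \<omega>. (S k \<omega> - Z \<omega>)\<^sup>2"] sq_norm_integrable) auto
  qed
  then obtain r :: "nat \<Rightarrow> nat" where r: "AE \<omega> in M. (\<lambda>k. (S (r k) \<omega> - Z \<omega>)\<^sup>2) \<longlonglongrightarrow> 0" by blast
  have ZB: "(\<integral>\<^sup>+\<omega>. ennreal (Z \<omega> ^ 4) \<partial>M) \<le> ennreal B"
  proof -
    have "(\<integral>\<^sup>+\<omega>. ennreal (Z \<omega> ^ 4) \<partial>M) = (\<integral>\<^sup>+\<omega>. liminf (\<lambda>k. ennreal (S (r k) \<omega> ^ 4)) \<partial>M)"
    proof (rule nn_integral_cong_AE, use r in eventually_elim)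
      fix \<omega> assume "(\<lambda>k. (S (r k) \<omega> - Z \<omega>)\<^sup>2) \<longlonglongrightarrow> 0"
      then have "(\<lambda>k. sqrt ((S (r k) \<omega> - Z \<omega>)\<^sup>2)) \<longlonglongrightarrow> sqrt 0" by (rule tendsto_real_sqrt)
      then have "(\<lambda>k. \<bar>S (r k) \<omega> - Z \<omega>\<bar>) \<longlonglongrightarrow> 0" by simp
      then have "(\<lambda>k. S (r k) \<omega> - Z \<omega>) \<longlonglongrightarrow> 0" by (rule tendsto_rabs_zero_cancel)
      then have "(\<lambda>k. S (r k) \<omega>) \<longlonglongrightarrow> Z \<omega>" by (rule LIM_zero_cancel)
      then have "(\<lambda>k. ennreal (S (r k) \<omega> ^ 4)) \<longlonglongrightarrow> ennreal (Z \<omega> ^ 4)" by (intro tendsto_ennrealI tendsto_power)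
      then show "ennreal (Z \<omega> ^ 4) = liminf (\<lambda>k. ennreal (S (r k) \<omega> ^ 4))"
        by (intro lim_imp_Liminf[symmetric]) auto
    qed
    also have "\<dots> \<le> liminf (\<lambda>k. \<integral>\<^sup>+\<omega>. ennreal (S (r k) \<omega> ^ 4) \<partial>M)"
      by (rule nn_integral_liminf) measurable
    also have "\<dots> \<le> ennreal B" by (rule Liminf_le) (simp_all add: SB)
    finally show ?thesis .
  qed
  have L4Z: "fourth_integrable M Z" unfolding fourth_integrable_def
    by (intro conjI Zm integrableI_nonneg) (use ZB in \<open>auto intro: le_less_trans\<close>)
  have iZ3: "integrable M (\<lambda>\<omega>. Z \<omega> ^ 3)"
    using integrable_prod3[OF L4Z L4Z L4Z] by (simp add: power3_eq_cube)
  have lim3: "(\<lambda>k. expectation (\<lambda>\<omega>. S k \<omega> ^ 3)) \<longlonglongrightarrow> expectation (\<lambda>\<omega>. Z \<omega> ^ 3)"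
  proof (rule tendsto_L1_int)
    show "integrable M (\<lambda>\<omega>. S k \<omega> ^ 3)" for k using mom(2)[of k] by (simp add: has_bochner_integral_iff)
    show "integrable M (\<lambda>\<omega>. Z \<omega> ^ 3)" by (rule iZ3)
    \<comment> \<open>A bound for the L1 distance of the cubes, from the factorisation of
      \<open>a ^ 3 - b ^ 3\<close>. Cauchy-Schwarz separates the L2 distance, which tends to 0, from
      fourth moments; the 16 below is 8 for \<open>S k\<close> and 8 for \<open>Z\<close>.\<close>
    let ?c = "\<lambda>k. \<integral>\<^sup>+\<omega>. ennreal \<bar>S k \<omega> - Z \<omega>\<bar> * ennreal (2 * ((S k \<omega>)\<^sup>2 + (Z \<omega>)\<^sup>2)) \<partial>M"
    have "(\<lambda>k. sq_norm M (\<lambda>\<omega>. S k \<omega> - Z \<omega>) * ennreal (16 * B)) \<longlonglongrightarrow> 0 * ennreal (16 * B)"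
      by (intro tendsto_mult_ennreal slim tendsto_const) auto
    then have lim0: "(\<lambda>k. sq_norm M (\<lambda>\<omega>. S k \<omega> - Z \<omega>) * ennreal (16 * B)) \<longlonglongrightarrow> 0" by simp
    have cle: "(?c k)\<^sup>2 \<le> sq_norm M (\<lambda>\<omega>. S k \<omega> - Z \<omega>) * ennreal (16 * B)" for k
    proof -
      have "(?c k)\<^sup>2 \<le> sq_norm M (\<lambda>\<omega>. S k \<omega> - Z \<omega>) * (\<integral>\<^sup>+\<omega>. (ennreal (2 * ((S k \<omega>)\<^sup>2 + (Z \<omega>)\<^sup>2)))\<^sup>2 \<partial>M)"
        using nn_integral_Cauchy_Schwarz[of "\<lambda>\<omega>. ennreal \<bar>S k \<omega> - Z \<omega>\<bar>" M "\<lambda>\<omega>. ennreal (2 * ((S k \<omega>)\<^sup>2 + (Z \<omega>)\<^sup>2))"]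
        by (simp add: sq_norm_abs)
      also have "(\<integral>\<^sup>+\<omega>. (ennreal (2 * ((S k \<omega>)\<^sup>2 + (Z \<omega>)\<^sup>2)))\<^sup>2 \<partial>M) \<le> (\<integral>\<^sup>+\<omega>. ennreal 8 * ennreal (S k \<omega> ^ 4) + ennreal 8 * ennreal (Z \<omega> ^ 4) \<partial>M)"
      proof (rule nn_integral_mono)
        fix \<omega>
        have "(2 * (a\<^sup>2 + b\<^sup>2))\<^sup>2 \<le> 8 * a ^ 4 + 8 * b ^ 4" for a b :: real
          using zero_le_power2[of "a\<^sup>2 - b\<^sup>2"] by (simp add: power2_eq_square power4_eq_xxxx algebra_simps)
        then have "ennreal ((2 * ((S k \<omega>)\<^sup>2 + (Z \<omega>)\<^sup>2))\<^sup>2) \<le> ennreal (8 * S k \<omega> ^ 4 + 8 * Z \<omega> ^ 4)" by (rule ennreal_leI)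
        also have "\<dots> = ennreal 8 * ennreal (S k \<omega> ^ 4) + ennreal 8 * ennreal (Z \<omega> ^ 4)"
          by (subst ennreal_plus) (simp_all add: ennreal_mult del: ennreal_numeral)
        finally show "(ennreal (2 * ((S k \<omega>)\<^sup>2 + (Z \<omega>)\<^sup>2)))\<^sup>2 \<le> ennreal 8 * ennreal (S k \<omega> ^ 4) + ennreal 8 * ennreal (Z \<omega> ^ 4)"
          by (subst ennreal_power) auto
      qed
      also have "\<dots> = ennreal 8 * (\<integral>\<^sup>+\<omega>. ennreal (S k \<omega> ^ 4) \<partial>M) + ennreal 8 * (\<integral>\<^sup>+\<omega>. ennreal (Z \<omega> ^ 4) \<partial>M)"
        by (subst nn_integral_add) (simp_all add: nn_integral_cmult)
      also have "\<dots> \<le> ennreal 8 * ennreal B + ennreal 8 * ennreal B"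
        by (intro add_mono mult_left_mono SB ZB) auto
      also have "\<dots> = ennreal (16 * B)" using B by (simp add: ennreal_mult[symmetric] ennreal_plus[symmetric] del: ennreal_plus ennreal_numeral)
      finally show ?thesis by (simp add: mult_left_mono)
    qed
    have "?c \<longlonglongrightarrow> 0" by (rule ennreal_power2_tendsto_0, rule ennreal_tendsto_0_le[OF lim0 cle])
    then show "(\<lambda>k. \<integral>\<^sup>+\<omega>. ennreal (norm (S k \<omega> ^ 3 - Z \<omega> ^ 3)) \<partial>M) \<longlonglongrightarrow> 0"
    proof (rule ennreal_tendsto_0_le)
      fix k
      show "(\<integral>\<^sup>+\<omega>. ennreal (norm (S k \<omega> ^ 3 - Z \<omega> ^ 3)) \<partial>M) \<le> ?c k"
      proof (rule nn_integral_mono)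
        fix \<omega>
        have "\<bar>a ^ 3 - b ^ 3\<bar> \<le> \<bar>a - b\<bar> * (2 * (a\<^sup>2 + b\<^sup>2))" for a b :: real
        proof -
          have "a ^ 3 - b ^ 3 = (a - b) * (a\<^sup>2 + a * b + b\<^sup>2)" by (simp add: power2_eq_square power3_eq_cube algebra_simps)
          then have "\<bar>a ^ 3 - b ^ 3\<bar> = \<bar>a - b\<bar> * \<bar>a\<^sup>2 + a * b + b\<^sup>2\<bar>" by (simp add: abs_mult)
          also have "\<bar>a\<^sup>2 + a * b + b\<^sup>2\<bar> \<le> 2 * (a\<^sup>2 + b\<^sup>2)"
          proof (rule abs_leI)
            have lin: "p + m + q \<le> 2 * (p + q)" "- (p + m + q) \<le> 2 * (p + q)"
              if "2 * m \<le> p + q" "- (2 * m) \<le> p + q" "0 \<le> p" "0 \<le> q" for p q m :: real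
              using that by simp_all
            have ab: "2 * (a * b) \<le> a\<^sup>2 + b\<^sup>2" "- (2 * (a * b)) \<le> a\<^sup>2 + b\<^sup>2"
              using zero_le_power2[of "a - b"] zero_le_power2[of "a + b"] by (simp_all add: power2_diff power2_sum algebra_simps)
            show "a\<^sup>2 + a * b + b\<^sup>2 \<le> 2 * (a\<^sup>2 + b\<^sup>2)" by (rule lin(1)[OF ab zero_le_power2 zero_le_power2])
            show "- (a\<^sup>2 + a * b + b\<^sup>2) \<le> 2 * (a\<^sup>2 + b\<^sup>2)" by (rule lin(2)[OF ab zero_le_power2 zero_le_power2])
          qed
          finally show ?thesis by (simp add: mult_left_mono)
        qed
        from ennreal_leI[OF this[of "S k \<omega>" "Z \<omega>"]]
        show "ennreal (norm (S k \<omega> ^ 3 - Z \<omega> ^ 3)) \<le> ennreal \<bar>S k \<omega> - Z \<omega>\<bar> * ennreal (2 * ((S k \<omega>)\<^sup>2 + (Z \<omega>)\<^sup>2))"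
          by (simp add: ennreal_mult)
      qed
    qed
  qed
  have clim: "(\<lambda>k. \<integral>p. cyclic_prod (g k) p \<partial>(lborel \<Otimes>\<^sub>M (lborel \<Otimes>\<^sub>M lborel))) \<longlonglongrightarrow> (\<integral>p. cyclic_prod f p \<partial>(lborel \<Otimes>\<^sub>M (lborel \<Otimes>\<^sub>M lborel)))"
    by (rule cyclic_prod_tendsto) (use glim fin gfin in \<open>auto simp: lborel_prod intro: lborel.sigma_finite_measure_axioms\<close>)
  have "expectation (\<lambda>\<omega>. S k \<omega> ^ 3) = 8 * (\<integral>p. cyclic_prod (g k) p \<partial>(lborel \<Otimes>\<^sub>M (lborel \<Otimes>\<^sub>M lborel)))" for k
    by (rule has_bochner_integral_integral_eq[OF mom(2)])
  with lim3 have "(\<lambda>k. 8 * (\<integral>p. cyclic_prod (g k) p \<partial>(lborel \<Otimes>\<^sub>M (lborel \<Otimes>\<^sub>M lborel)))) \<longlonglongrightarrow> expectation (\<lambda>\<omega>. Z \<omega> ^ 3)" by simp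
  then have "expectation (\<lambda>\<omega>. Z \<omega> ^ 3) = 8 * (\<integral>p. cyclic_prod f p \<partial>(lborel \<Otimes>\<^sub>M (lborel \<Otimes>\<^sub>M lborel)))"
    by (rule LIMSEQ_unique) (intro tendsto_mult tendsto_const clim)
  with iZ3 show "has_bochner_integral M (\<lambda>\<omega>. Z \<omega> ^ 3) (8 * (\<integral>p. cyclic_prod f p \<partial>(lborel \<Otimes>\<^sub>M (lborel \<Otimes>\<^sub>M lborel))))"
    by (simp add: has_bochner_integral_iff)
qed

end

section \<open>Beta integrals and traces\<close>

lemma pos_powr_nonneg [simp]: "0 \<le> pos_powr x p"
  by (simp add: pos_powr_def)

lemma pos_powr_measurable [measurable (raw)]:
  assumes [measurable]: "f \<in> borel_measurable N" "h \<in> borel_measurable N"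
  shows "(\<lambda>z. pos_powr (f z) (h z)) \<in> borel_measurable N"
  unfolding pos_powr_def by measurable

section \<open>Overlap integrals of truncated powers\<close>

lemma nn_integral_Gamma:
  assumes a: "0 < a" and c: "0 < c"
  shows "(\<integral>\<^sup>+w. ennreal (pos_powr w (a - 1) * exp (- (c * w))) \<partial>lborel) = ennreal (Gamma a * c powr (- a))" (is "?I = _")
proof -
  have "ennreal (Gamma a) = (\<integral>\<^sup>+t. ennreal (indicator {0..} t * t powr (a - 1) / exp t) \<partial>lborel)"
    by (rule Gamma_conv_nn_integral_real[OF a])
  also have "\<dots> = ennreal \<bar>c\<bar> * (\<integral>\<^sup>+w. ennreal (indicator {0..} (0 + c * w) * (0 + c * w) powr (a - 1) / exp (0 + c * w)) \<partial>lborel)"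
    by (rule nn_integral_real_affine) (use c in auto)
  also have "(\<integral>\<^sup>+w. ennreal (indicator {0..} (0 + c * w) * (0 + c * w) powr (a - 1) / exp (0 + c * w)) \<partial>lborel)
    = (\<integral>\<^sup>+w. ennreal (c powr (a - 1)) * ennreal (pos_powr w (a - 1) * exp (- (c * w))) \<partial>lborel)"
    using c by (intro nn_integral_cong) (auto simp: indicator_def pos_powr_def ennreal_mult[symmetric] powr_mult exp_minus field_simps zero_le_mult_iff)
  also have "\<dots> = ennreal (c powr (a - 1)) * ?I"
    by (rule nn_integral_cmult) measurable
  also have "ennreal \<bar>c\<bar> * (ennreal (c powr (a - 1)) * ?I) = ennreal (c powr a) * ?I"
    using c by (simp add: mult.assoc[symmetric] ennreal_mult[symmetric] powr_diff)
  finally have "ennreal (c powr (- a)) * ennreal (Gamma a) = (ennreal (c powr (- a)) * ennreal (c powr a)) * ?I"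
    by (simp add: mult.assoc)
  also have "ennreal (c powr (- a)) * ennreal (c powr a) = 1"
    using c by (simp add: ennreal_mult[symmetric] powr_add[symmetric])
  finally show ?thesis using Gamma_real_pos[OF a] by (simp add: ennreal_mult[symmetric] mult.commute)
qed

text \<open>The factor \<open>(u + d) powr \<beta>\<close> is written as a Gamma integral, which turns the integral over \<open>u\<close> into one too.\<close>

lemma nn_integral_pos_powr_shift:
  assumes ab: "- 1 < \<alpha>" "\<beta> < 0" "\<alpha> + \<beta> < - 1" and d: "0 < d"
  shows "(\<integral>\<^sup>+u. ennreal (pos_powr u \<alpha>) * ennreal (pos_powr (u + d) \<beta>) \<partial>lborel)
    = ennreal (Beta (\<alpha> + 1) (- \<alpha> - \<beta> - 1) * d powr (\<alpha> + \<beta> + 1))" (is "?I = _")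
proof -
  have G: "0 < Gamma (- \<beta>)" "0 < Gamma (\<alpha> + 1)" "0 < Gamma (- \<alpha> - \<beta> - 1)" using ab by auto
  have "ennreal (Gamma (- \<beta>)) * ?I = (\<integral>\<^sup>+u. ennreal (Gamma (- \<beta>)) * (ennreal (pos_powr u \<alpha>) * ennreal (pos_powr (u + d) \<beta>)) \<partial>lborel)"
    by (rule nn_integral_cmult[symmetric]) measurable
  also have "\<dots> = (\<integral>\<^sup>+u. (\<integral>\<^sup>+w. ennreal (pos_powr u \<alpha>) * ennreal (pos_powr w (- \<beta> - 1) * exp (- ((u + d) * w))) \<partial>lborel) \<partial>lborel)"
  proof (rule nn_integral_cong)
    fix u :: real
    show "ennreal (Gamma (- \<beta>)) * (ennreal (pos_powr u \<alpha>) * ennreal (pos_powr (u + d) \<beta>))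
      = (\<integral>\<^sup>+w. ennreal (pos_powr u \<alpha>) * ennreal (pos_powr w (- \<beta> - 1) * exp (- ((u + d) * w))) \<partial>lborel)"
    proof (cases "0 < u")
      case True
      have "(\<integral>\<^sup>+w. ennreal (pos_powr w (- \<beta> - 1) * exp (- ((u + d) * w))) \<partial>lborel) = ennreal (Gamma (- \<beta>) * (u + d) powr \<beta>)"
        using nn_integral_Gamma[of "- \<beta>" "u + d"] True ab d by simp
      then show ?thesis using True d G
        by (subst nn_integral_cmult) (auto simp: pos_powr_def ennreal_mult mult_ac)
    qed (simp add: pos_powr_def)
  qed
  also have "\<dots> = (\<integral>\<^sup>+w. (\<integral>\<^sup>+u. ennreal (pos_powr u \<alpha>) * ennreal (pos_powr w (- \<beta> - 1) * exp (- ((u + d) * w))) \<partial>lborel) \<partial>lborel)"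
    by (rule lborel_pair.Fubini'[symmetric]) measurable
  \<comment> \<open>The integral over \<open>u\<close> yields
    \<open>Gamma (\<alpha> + 1) * w powr (- (\<alpha> + 1))\<close>. The remaining power of
    \<open>w\<close> belongs to a Gamma integral with parameter
    \<open>- \<alpha> - \<beta> - 1\<close> and rate \<open>d\<close>; its exponent ends in
    \<open>- 1\<close> to match \<open>nn_integral_Gamma\<close>.\<close>
  also have "\<dots> = (\<integral>\<^sup>+w. ennreal (Gamma (\<alpha> + 1)) * ennreal (pos_powr w (- \<alpha> - \<beta> - 1 - 1) * exp (- (d * w))) \<partial>lborel)"
  proof (rule nn_integral_cong)
    fix w :: real
    show "(\<integral>\<^sup>+u. ennreal (pos_powr u \<alpha>) * ennreal (pos_powr w (- \<beta> - 1) * exp (- ((u + d) * w))) \<partial>lborel)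
      = ennreal (Gamma (\<alpha> + 1)) * ennreal (pos_powr w (- \<alpha> - \<beta> - 1 - 1) * exp (- (d * w)))"
    proof (cases "0 < w")
      case True
      have "(\<integral>\<^sup>+u. ennreal (pos_powr u \<alpha>) * ennreal (pos_powr w (- \<beta> - 1) * exp (- ((u + d) * w))) \<partial>lborel)
        = (\<integral>\<^sup>+u. ennreal (pos_powr w (- \<beta> - 1) * exp (- (d * w))) * ennreal (pos_powr u (\<alpha> + 1 - 1) * exp (- (w * u))) \<partial>lborel)"
        by (intro nn_integral_cong) (simp add: ennreal_mult[symmetric] algebra_simps exp_add[symmetric])
      also have "\<dots> = ennreal (pos_powr w (- \<beta> - 1) * exp (- (d * w))) * ennreal (Gamma (\<alpha> + 1) * w powr (- (\<alpha> + 1)))"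
        using nn_integral_Gamma[of "\<alpha> + 1" w] ab True by (subst nn_integral_cmult) auto
      also have "\<dots> = ennreal (Gamma (\<alpha> + 1)) * ennreal (pos_powr w (- \<alpha> - \<beta> - 1 - 1) * exp (- (d * w)))"
      proof -
        have "w powr (- \<alpha> - \<beta> - 1 - 1) = w powr (- \<beta> - 1) * w powr (- (\<alpha> + 1))"
          by (simp add: powr_add[symmetric] algebra_simps)
        then show ?thesis using True G by (simp add: pos_powr_def ennreal_mult[symmetric] mult_ac)
      qed
      finally show ?thesis .
    qed (simp add: pos_powr_def)
  qed
  also have "\<dots> = ennreal (Gamma (\<alpha> + 1)) * ennreal (Gamma (- \<alpha> - \<beta> - 1) * d powr (- (- \<alpha> - \<beta> - 1)))"
    using nn_integral_Gamma[of "- \<alpha> - \<beta> - 1" d] ab d by (subst nn_integral_cmult) auto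
  finally have "ennreal (1 / Gamma (- \<beta>)) * (ennreal (Gamma (- \<beta>)) * ?I)
    = ennreal (1 / Gamma (- \<beta>)) * (ennreal (Gamma (\<alpha> + 1)) * ennreal (Gamma (- \<alpha> - \<beta> - 1) * d powr (- (- \<alpha> - \<beta> - 1))))"
    by simp
  moreover have "ennreal (1 / Gamma (- \<beta>)) * (ennreal (Gamma (- \<beta>)) * ?I) = ?I"
    using G by (simp add: mult.assoc[symmetric] ennreal_mult[symmetric])
  ultimately show ?thesis using G by (simp add: ennreal_mult[symmetric] Beta_def algebra_simps)
qed

text \<open>The integrand lives below the earlier of the two points, so the first argument of Beta
  carries the exponent of that point.\<close>

definition pair_const :: "real \<Rightarrow> real \<Rightarrow> real \<Rightarrow> real \<Rightarrow> real" where
  "pair_const \<alpha> \<beta> s t = (if s < t then Beta (\<alpha> + 1) (- \<alpha> - \<beta> - 1) else Beta (\<beta> + 1) (- \<alpha> - \<beta> - 1))"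

text \<open>The reflection \<open>y = s - u\<close> at the earlier point leads to
  \<open>nn_integral_pos_powr_shift\<close> with the gap as the shift; the other order is reduced to
  this one by exchanging the roles.\<close>

lemma nn_integral_pos_powr_pair:
  assumes ab: "- 1 < \<alpha>" "\<alpha> < - 1 / 2" "- 1 < \<beta>" "\<beta> < - 1 / 2" and st: "s \<noteq> t"
  shows "(\<integral>\<^sup>+y. ennreal (pos_powr (s - y) \<alpha>) * ennreal (pos_powr (t - y) \<beta>) \<partial>lborel)
    = ennreal (pair_const \<alpha> \<beta> s t * \<bar>t - s\<bar> powr (\<alpha> + \<beta> + 1))"
proof -
  have main: "(\<integral>\<^sup>+y. ennreal (pos_powr (s - y) \<alpha>) * ennreal (pos_powr (t - y) \<beta>) \<partial>lborel)
    = ennreal (Beta (\<alpha> + 1) (- \<alpha> - \<beta> - 1) * (t - s) powr (\<alpha> + \<beta> + 1))"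
    if ab: "- 1 < \<alpha>" "\<alpha> < - 1 / 2" "- 1 < \<beta>" "\<beta> < - 1 / 2" and "s < t" for s t \<alpha> \<beta> :: real
  proof -
    have "(\<integral>\<^sup>+y. ennreal (pos_powr (s - y) \<alpha>) * ennreal (pos_powr (t - y) \<beta>) \<partial>lborel)
      = ennreal \<bar>-1\<bar> * (\<integral>\<^sup>+u. ennreal (pos_powr (s - (s + (-1) * u)) \<alpha>) * ennreal (pos_powr (t - (s + (-1) * u)) \<beta>) \<partial>lborel)"
      by (rule nn_integral_real_affine) auto
    also have "\<dots> = (\<integral>\<^sup>+u. ennreal (pos_powr u \<alpha>) * ennreal (pos_powr (u + (t - s)) \<beta>) \<partial>lborel)"
      by (simp add: algebra_simps)
    also have "\<dots> = ennreal (Beta (\<alpha> + 1) (- \<alpha> - \<beta> - 1) * (t - s) powr (\<alpha> + \<beta> + 1))"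
      by (rule nn_integral_pos_powr_shift) (use that in auto)
    finally show ?thesis .
  qed
  show ?thesis
  proof (cases "s < t")
    case True then show ?thesis using main[OF ab True] by (simp add: pair_const_def)
  next
    case False
    then have "t < s" using st by simp
    have e: "- \<beta> - \<alpha> - 1 = - \<alpha> - \<beta> - 1" by simp
    show ?thesis using main[OF ab(3,4,1,2) \<open>t < s\<close>, unfolded e] \<open>t < s\<close>
      by (simp add: pair_const_def mult.commute add.commute)
  qed
qed

section \<open>Beta integrals over ordered points\<close>

lemma Beta_pos: "0 < a \<Longrightarrow> 0 < b \<Longrightarrow> 0 < Beta a (b :: real)"
  by (simp add: Beta_def)

lemma nn_integral_Beta_unit:
  assumes "- 1 < q" "- 1 < r"
  shows "(\<integral>\<^sup>+t. ennreal (pos_powr t q * pos_powr (1 - t) r) \<partial>lborel) = ennreal (Beta (q + 1) (r + 1))"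
proof -
  have "((\<lambda>t. t powr q * (1 - t) powr r) has_integral Beta (q + 1) (r + 1)) {0..1}"
    using has_integral_Beta_real[of "q + 1" "r + 1"] assms by simp
  then have "((\<lambda>t. if t \<in> {0..1} then t powr q * (1 - t) powr r else 0) has_integral Beta (q + 1) (r + 1)) UNIV"
    by (subst has_integral_restrict_UNIV)
  \<comment> \<open>The two sides agree even at the endpoints, since \<open>0 powr q = 0\<close>
    whatever the exponent.\<close>
  also have "(\<lambda>t. if t \<in> {0..1} then t powr q * (1 - t) powr r else 0) = (\<lambda>t. pos_powr t q * pos_powr (1 - t) r)"
    by (auto simp: fun_eq_iff pos_powr_def)
  finally show ?thesis by (intro nn_integral_has_integral_lborel) auto
qed

lemma nn_integral_pos_powr_between:
  assumes qr: "- 1 < q" "- 1 < r" and st: "s < u"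
  shows "(\<integral>\<^sup>+t. ennreal (pos_powr (t - s) q * pos_powr (u - t) r) \<partial>lborel)
    = ennreal (Beta (q + 1) (r + 1) * pos_powr (u - s) (q + r + 1))"
proof -
  let ?d = "u - s"
  have d: "0 < ?d" using st by simp
  have sc: "pos_powr (?d * x) p = ?d powr p * pos_powr x p" for x p
    using d by (auto simp: pos_powr_def powr_mult zero_less_mult_iff)
  have "(\<integral>\<^sup>+t. ennreal (pos_powr (t - s) q * pos_powr (u - t) r) \<partial>lborel)
    = ennreal \<bar>?d\<bar> * (\<integral>\<^sup>+t. ennreal (pos_powr (s + ?d * t - s) q * pos_powr (u - (s + ?d * t)) r) \<partial>lborel)"
    by (rule nn_integral_real_affine) (use d in auto)
  also have "(\<integral>\<^sup>+t. ennreal (pos_powr (s + ?d * t - s) q * pos_powr (u - (s + ?d * t)) r) \<partial>lborel)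
    = (\<integral>\<^sup>+t. ennreal (?d powr q * ?d powr r) * ennreal (pos_powr t q * pos_powr (1 - t) r) \<partial>lborel)"
  proof (rule nn_integral_cong)
    fix t
    have "s + ?d * t - s = ?d * t" "u - (s + ?d * t) = ?d * (1 - t)" by (simp_all add: algebra_simps)
    then show "ennreal (pos_powr (s + ?d * t - s) q * pos_powr (u - (s + ?d * t)) r)
      = ennreal (?d powr q * ?d powr r) * ennreal (pos_powr t q * pos_powr (1 - t) r)"
      by (simp only: sc) (simp add: ennreal_mult[symmetric] mult_ac)
  qed
  also have "\<dots> = ennreal (?d powr q * ?d powr r) * ennreal (Beta (q + 1) (r + 1))"
    by (subst nn_integral_cmult) (use nn_integral_Beta_unit[OF qr] in auto)
  also have "ennreal \<bar>?d\<bar> * (ennreal (?d powr q * ?d powr r) * ennreal (Beta (q + 1) (r + 1)))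
    = ennreal (Beta (q + 1) (r + 1) * pos_powr ?d (q + r + 1))"
    using d Beta_pos[of "q + 1" "r + 1"] qr by (simp add: ennreal_mult[symmetric] pos_powr_def powr_add mult_ac)
  finally show ?thesis .
qed

lemma Beta_1_right: "0 < a \<Longrightarrow> Beta a 1 = 1 / (a :: real)"
  using Gamma_plus1[of a] by (auto simp: Beta_def nonpos_Ints_def Gamma_eq_zero_iff)

text \<open>The interval is open so that its indicator is \<open>pos_powr s 0 * pos_powr (1 - s) 0\<close>, a Beta integrand.\<close>

abbreviation I01 :: "real \<Rightarrow> ennreal" where "I01 s \<equiv> indicator {0<..<1} s"

lemma nn_integral_triangle:
  assumes p: "- 1 < p"
  shows "(\<integral>\<^sup>+s. \<integral>\<^sup>+u. I01 s * I01 u * ennreal (pos_powr (u - s) p) \<partial>lborel \<partial>lborel) = ennreal (1 / ((p + 1) * (p + 2)))"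
proof -
  have "(\<integral>\<^sup>+s. \<integral>\<^sup>+u. I01 s * I01 u * ennreal (pos_powr (u - s) p) \<partial>lborel \<partial>lborel)
    = (\<integral>\<^sup>+s. ennreal (1 / (p + 1)) * ennreal (pos_powr s 0 * pos_powr (1 - s) (p + 1)) \<partial>lborel)"
  proof (rule nn_integral_cong)
    fix s :: real
    show "(\<integral>\<^sup>+u. I01 s * I01 u * ennreal (pos_powr (u - s) p) \<partial>lborel) = ennreal (1 / (p + 1)) * ennreal (pos_powr s 0 * pos_powr (1 - s) (p + 1))"
    proof (cases "0 < s \<and> s < 1")
      case True
      have "(\<integral>\<^sup>+u. I01 s * I01 u * ennreal (pos_powr (u - s) p) \<partial>lborel) = (\<integral>\<^sup>+u. ennreal (pos_powr (u - s) p * pos_powr (1 - u) 0) \<partial>lborel)"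
        using True by (intro nn_integral_cong) (auto simp: indicator_def pos_powr_def)
      also have "\<dots> = ennreal (Beta (p + 1) (0 + 1) * pos_powr (1 - s) (p + 0 + 1))"
        by (rule nn_integral_pos_powr_between) (use p True in auto)
      finally show ?thesis using p True by (simp add: Beta_1_right ennreal_mult[symmetric] pos_powr_def)
    next
      case False then show ?thesis by (auto simp: indicator_def pos_powr_def)
    qed
  qed
  also have "\<dots> = ennreal (1 / (p + 1)) * ennreal (Beta (0 + 1) (p + 1 + 1))"
    by (subst nn_integral_cmult) (use nn_integral_Beta_unit[of 0 "p + 1"] p in auto)
  also have "\<dots> = ennreal (1 / ((p + 1) * (p + 2)))"
    using p Beta_1_right[of "p + 2"] by (simp add: Beta_commute[of 1] ennreal_mult[symmetric] add.assoc)
  finally show ?thesis .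
qed

text \<open>The middle point is integrated first: the two gaps beside it give the Beta value and a
  power of the outer gap, which merges with the factor in \<open>u - s\<close> and leaves
  \<open>nn_integral_triangle\<close>.\<close>

lemma nn_integral_simplex:
  assumes "- 1 < q" "- 1 < r" "- 1 < p + q + r + 1"
  shows "(\<integral>\<^sup>+s. \<integral>\<^sup>+t. \<integral>\<^sup>+u. I01 s * I01 t * I01 u * ennreal (pos_powr (t - s) q * pos_powr (u - t) r * pos_powr (u - s) p) \<partial>lborel \<partial>lborel \<partial>lborel)
    = ennreal (Beta (q + 1) (r + 1) / ((p + q + r + 2) * (p + q + r + 3)))"
proof -
  have B: "0 < Beta (q + 1) (r + 1)" using assms by (intro Beta_pos) auto
  have "(\<integral>\<^sup>+s. \<integral>\<^sup>+t. \<integral>\<^sup>+u. I01 s * I01 t * I01 u * ennreal (pos_powr (t - s) q * pos_powr (u - t) r * pos_powr (u - s) p) \<partial>lborel \<partial>lborel \<partial>lborel)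
    = (\<integral>\<^sup>+s. \<integral>\<^sup>+u. \<integral>\<^sup>+t. I01 s * I01 t * I01 u * ennreal (pos_powr (t - s) q * pos_powr (u - t) r * pos_powr (u - s) p) \<partial>lborel \<partial>lborel \<partial>lborel)"
    by (rule nn_integral_cong, rule lborel_pair.Fubini'[symmetric]) measurable
  also have "\<dots> = (\<integral>\<^sup>+s. \<integral>\<^sup>+u. ennreal (Beta (q + 1) (r + 1)) * (I01 s * I01 u * ennreal (pos_powr (u - s) (p + q + r + 1))) \<partial>lborel \<partial>lborel)"
  proof (intro nn_integral_cong)
    fix s u :: real
    show "(\<integral>\<^sup>+t. I01 s * I01 t * I01 u * ennreal (pos_powr (t - s) q * pos_powr (u - t) r * pos_powr (u - s) p) \<partial>lborel)
      = ennreal (Beta (q + 1) (r + 1)) * (I01 s * I01 u * ennreal (pos_powr (u - s) (p + q + r + 1)))"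
    proof (cases "0 < s \<and> s < u \<and> u < 1")
      case True
      have "(\<integral>\<^sup>+t. I01 s * I01 t * I01 u * ennreal (pos_powr (t - s) q * pos_powr (u - t) r * pos_powr (u - s) p) \<partial>lborel)
        = (\<integral>\<^sup>+t. ennreal (pos_powr (u - s) p) * ennreal (pos_powr (t - s) q * pos_powr (u - t) r) \<partial>lborel)"
        using True by (intro nn_integral_cong) (auto simp: indicator_def pos_powr_def ennreal_mult[symmetric] mult_ac)
      also have "\<dots> = ennreal (pos_powr (u - s) p) * ennreal (Beta (q + 1) (r + 1) * pos_powr (u - s) (q + r + 1))"
        by (subst nn_integral_cmult) (use nn_integral_pos_powr_between[OF assms(1,2)] True in auto)
      also have "\<dots> = ennreal (Beta (q + 1) (r + 1)) * (I01 s * I01 u * ennreal (pos_powr (u - s) (p + q + r + 1)))"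
        using True B by (simp add: ennreal_mult[symmetric] pos_powr_def powr_add[symmetric] mult_ac add_ac)
      finally show ?thesis .
    next
      case False
      then have "I01 s * I01 t * I01 u * ennreal (pos_powr (t - s) q * pos_powr (u - t) r * pos_powr (u - s) p) = 0" for t
        by (auto simp: indicator_def pos_powr_def)
      then have "(\<integral>\<^sup>+t. I01 s * I01 t * I01 u * ennreal (pos_powr (t - s) q * pos_powr (u - t) r * pos_powr (u - s) p) \<partial>lborel) = 0"
        by (simp only: nn_integral_const) simp
      moreover have "I01 s * I01 u * ennreal (pos_powr (u - s) (p + q + r + 1)) = 0" using False by (auto simp: indicator_def pos_powr_def)
      ultimately show ?thesis by simp
    qed
  qed
  also have "\<dots> = ennreal (Beta (q + 1) (r + 1)) * (\<integral>\<^sup>+s. \<integral>\<^sup>+u. I01 s * I01 u * ennreal (pos_powr (u - s) (p + q + r + 1)) \<partial>lborel \<partial>lborel)"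
    by (simp add: nn_integral_cmult)
  also have "\<dots> = ennreal (Beta (q + 1) (r + 1)) * ennreal (1 / ((p + q + r + 2) * (p + q + r + 3)))"
    using nn_integral_triangle[OF assms(3)] by (simp add: add.assoc)
  also have "\<dots> = ennreal (Beta (q + 1) (r + 1) / ((p + q + r + 2) * (p + q + r + 3)))"
    using B assms by (simp add: ennreal_mult[symmetric])
  finally show ?thesis .
qed

section \<open>Symmetric integrands on the square and the cube\<close>

lemma nn_integral_square_sym:
  fixes X :: "real \<Rightarrow> real \<Rightarrow> ennreal"
  assumes [measurable]: "case_prod X \<in> borel_measurable (borel \<Otimes>\<^sub>M borel)" and sym: "\<And>s t. X s t = X t s"
  shows "(\<integral>\<^sup>+s. \<integral>\<^sup>+t. X s t \<partial>lborel \<partial>lborel) = 2 * (\<integral>\<^sup>+s. \<integral>\<^sup>+t. X s t * indicator {s<..} t \<partial>lborel \<partial>lborel)"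
proof -
  define R where "R s t = X s t * of_bool (s < t)" for s t
  have Xm: "(\<lambda>p. X (f p) (g p)) \<in> borel_measurable N"
    if [measurable]: "f \<in> borel_measurable N" "g \<in> borel_measurable N" for f g and N :: "'z measure"
    using measurable_compose[of "\<lambda>p. (f p, g p)" N _ "case_prod X", OF _ assms(1)] by simp
  have Rm [measurable (raw)]: "(\<lambda>p. R (f p) (g p)) \<in> borel_measurable N"
    if [measurable]: "f \<in> borel_measurable N" "g \<in> borel_measurable N" for f g and N :: "'z measure"
    unfolding R_def using Xm[OF that] by measurable
  have "(\<integral>\<^sup>+s. \<integral>\<^sup>+t. X s t \<partial>lborel \<partial>lborel) = (\<integral>\<^sup>+s. \<integral>\<^sup>+t. R s t + R t s \<partial>lborel \<partial>lborel)"
  proof (rule nn_integral_cong, rule nn_integral_cong_AE)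
    fix s :: real
    show "AE t in lborel. X s t = R s t + R t s"
      using AE_lborel_singleton[of s] by eventually_elim (use sym in \<open>auto simp: R_def\<close>)
  qed
  also have "\<dots> = (\<integral>\<^sup>+s. \<integral>\<^sup>+t. R s t \<partial>lborel \<partial>lborel) + (\<integral>\<^sup>+s. \<integral>\<^sup>+t. R t s \<partial>lborel \<partial>lborel)"
    by (simp add: nn_integral_add)
  also have "(\<integral>\<^sup>+s. \<integral>\<^sup>+t. R t s \<partial>lborel \<partial>lborel) = (\<integral>\<^sup>+s. \<integral>\<^sup>+t. R s t \<partial>lborel \<partial>lborel)"
    by (rule lborel_pair.Fubini') measurable
  also have "R = (\<lambda>s t. X s t * indicator {s<..} t)" by (auto simp: R_def fun_eq_iff)
  finally show ?thesis by (simp add: mult_2)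
qed

text \<open>Outside the null set of coinciding coordinates exactly one of six orderings holds. The
  cyclic shift and the reversal generate all permutations of three letters, so \<open>X\<close> is
  fully symmetric and every ordering contributes the same.\<close>

lemma nn_integral_cube_sym:
  fixes X :: "real \<Rightarrow> real \<Rightarrow> real \<Rightarrow> ennreal"
  assumes X [measurable]: "(\<lambda>(s, t, u). X s t u) \<in> borel_measurable (borel \<Otimes>\<^sub>M (borel \<Otimes>\<^sub>M borel))"
    and cyc: "\<And>s t u. X t u s = X s t u" and rev: "\<And>s t u. X u t s = X s t u"
  shows "(\<integral>\<^sup>+s. \<integral>\<^sup>+t. \<integral>\<^sup>+u. X s t u \<partial>lborel \<partial>lborel \<partial>lborel)
    = 6 * (\<integral>\<^sup>+s. \<integral>\<^sup>+t. \<integral>\<^sup>+u. X s t u * of_bool (s < t \<and> t < u) \<partial>lborel \<partial>lborel \<partial>lborel)"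
proof -
  define R where "R s t u = X s t u * of_bool (s < t \<and> t < u)" for s t u
  have Xm: "(\<lambda>p. X (f p) (g p) (h p)) \<in> borel_measurable N"
    if [measurable]: "f \<in> borel_measurable N" "g \<in> borel_measurable N" "h \<in> borel_measurable N" for f g h N
    using measurable_compose[of "\<lambda>p. (f p, g p, h p)" N _ "\<lambda>(s, t, u). X s t u", OF _ X] by simp
  have Rm [measurable]: "(\<lambda>p. R (f p) (g p) (h p)) \<in> borel_measurable N"
    if [measurable]: "f \<in> borel_measurable N" "g \<in> borel_measurable N" "h \<in> borel_measurable N" for f g h N
    unfolding R_def using Xm[OF that] by measurable
  have X1: "X s u t = X s t u" "X t s u = X s t u" "X u s t = X s t u" for s t u
    using cyc[of s t u] cyc[of t u s] cyc[of u s t] rev[of s t u] rev[of t u s] rev[of u s t] cyc[of s u t] by metis+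
  let ?I = "\<integral>\<^sup>+s. \<integral>\<^sup>+t. \<integral>\<^sup>+u. R s t u \<partial>lborel \<partial>lborel \<partial>lborel"
  \<comment> \<open>\<open>sw1\<close> exchanges the last two and \<open>sw2\<close> the first two
    variables; every other order is composed of these.\<close>
  have sw1: "(\<integral>\<^sup>+s. \<integral>\<^sup>+t. \<integral>\<^sup>+u. F s u t \<partial>lborel \<partial>lborel \<partial>lborel) = (\<integral>\<^sup>+s. \<integral>\<^sup>+t. \<integral>\<^sup>+u. F s t u \<partial>lborel \<partial>lborel \<partial>lborel)"
    if F: "(\<lambda>(s, t, u). F s t u) \<in> borel_measurable (borel \<Otimes>\<^sub>M (borel \<Otimes>\<^sub>M borel))" for F :: "real \<Rightarrow> real \<Rightarrow> real \<Rightarrow> ennreal"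
  proof (rule nn_integral_cong, rule lborel_pair.Fubini')
    fix s :: real
    show "(\<lambda>(x, y). F s x y) \<in> borel_measurable (lborel \<Otimes>\<^sub>M lborel)"
      using measurable_compose[of "\<lambda>p. (s, fst p, snd p)" "lborel \<Otimes>\<^sub>M lborel" _ "\<lambda>(s, t, u). F s t u", OF _ F] by (simp add: split_def)
  qed
  have sw2: "(\<integral>\<^sup>+s. \<integral>\<^sup>+t. \<integral>\<^sup>+u. F t s u \<partial>lborel \<partial>lborel \<partial>lborel) = (\<integral>\<^sup>+s. \<integral>\<^sup>+t. \<integral>\<^sup>+u. F s t u \<partial>lborel \<partial>lborel \<partial>lborel)"
    if F: "(\<lambda>(s, t, u). F s t u) \<in> borel_measurable (borel \<Otimes>\<^sub>M (borel \<Otimes>\<^sub>M borel))" for F :: "real \<Rightarrow> real \<Rightarrow> real \<Rightarrow> ennreal"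
  proof (rule lborel_pair.Fubini')
    have [measurable]: "(\<lambda>p. F (fst (fst p)) (snd (fst p)) (snd p)) \<in> borel_measurable ((lborel \<Otimes>\<^sub>M lborel) \<Otimes>\<^sub>M lborel)"
      using measurable_compose[of "\<lambda>p. (fst (fst p), snd (fst p), snd p)" "(lborel \<Otimes>\<^sub>M lborel) \<Otimes>\<^sub>M lborel" _ "\<lambda>(s, t, u). F s t u", OF _ F] by (simp add: split_def)
    show "(\<lambda>(x, y). \<integral>\<^sup>+u. F x y u \<partial>lborel) \<in> borel_measurable (lborel \<Otimes>\<^sub>M lborel)"
      unfolding split_def by (rule lborel.borel_measurable_nn_integral) (simp add: split_def)
  qed
  have RF: "(\<lambda>(s, t, u). R s t u) \<in> borel_measurable (borel \<Otimes>\<^sub>M (borel \<Otimes>\<^sub>M borel))"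
    "(\<lambda>(s, t, u). R s u t) \<in> borel_measurable (borel \<Otimes>\<^sub>M (borel \<Otimes>\<^sub>M borel))"
    "(\<lambda>(s, t, u). R t s u) \<in> borel_measurable (borel \<Otimes>\<^sub>M (borel \<Otimes>\<^sub>M borel))"
    "(\<lambda>(s, t, u). R u s t) \<in> borel_measurable (borel \<Otimes>\<^sub>M (borel \<Otimes>\<^sub>M borel))"
    "(\<lambda>(s, t, u). R t u s) \<in> borel_measurable (borel \<Otimes>\<^sub>M (borel \<Otimes>\<^sub>M borel))"
    unfolding split_def by (rule Rm; measurable)+
  have i1: "(\<integral>\<^sup>+s. \<integral>\<^sup>+t. \<integral>\<^sup>+u. R s u t \<partial>lborel \<partial>lborel \<partial>lborel) = ?I" by (rule sw1[OF RF(1)])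
  have i2: "(\<integral>\<^sup>+s. \<integral>\<^sup>+t. \<integral>\<^sup>+u. R t s u \<partial>lborel \<partial>lborel \<partial>lborel) = ?I" by (rule sw2[OF RF(1)])
  have i3: "(\<integral>\<^sup>+s. \<integral>\<^sup>+t. \<integral>\<^sup>+u. R t u s \<partial>lborel \<partial>lborel \<partial>lborel) = ?I" using sw2[OF RF(2)] i1 by simp
  have i4: "(\<integral>\<^sup>+s. \<integral>\<^sup>+t. \<integral>\<^sup>+u. R u s t \<partial>lborel \<partial>lborel \<partial>lborel) = ?I" using sw1[OF RF(3)] i2 by simp
  have i5: "(\<integral>\<^sup>+s. \<integral>\<^sup>+t. \<integral>\<^sup>+u. R u t s \<partial>lborel \<partial>lborel \<partial>lborel) = ?I" using sw1[OF RF(5)] i3 by simp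
  have "(\<integral>\<^sup>+s. \<integral>\<^sup>+t. \<integral>\<^sup>+u. X s t u \<partial>lborel \<partial>lborel \<partial>lborel)
    = (\<integral>\<^sup>+s. \<integral>\<^sup>+t. \<integral>\<^sup>+u. R s t u + (R s u t + (R t s u + (R t u s + (R u s t + R u t s)))) \<partial>lborel \<partial>lborel \<partial>lborel)"
  proof (rule nn_integral_cong, rule nn_integral_cong_AE)
    fix s :: real
    show "AE t in lborel. (\<integral>\<^sup>+u. X s t u \<partial>lborel) = (\<integral>\<^sup>+u. R s t u + (R s u t + (R t s u + (R t u s + (R u s t + R u t s)))) \<partial>lborel)"
      using AE_lborel_singleton[of s]
    proof eventually_elim
      case (elim t)
      show ?case
      proof (rule nn_integral_cong_AE, use AE_lborel_singleton[of s] AE_lborel_singleton[of t] in eventually_elim)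
        fix u assume u: "u \<noteq> s" "u \<noteq> t"
        have x: "X s u t = X s t u" "X t s u = X s t u" "X u s t = X s t u" "X t u s = X s t u" "X u t s = X s t u"
          using X1[of s t u] cyc[of s t u] rev[of s t u] by metis+
        consider "s < t" "t < u" | "s < u" "u < t" | "t < s" "s < u" | "t < u" "u < s" | "u < s" "s < t" | "u < t" "t < s"
          using u elim by linarith
        then show "X s t u = R s t u + (R s u t + (R t s u + (R t u s + (R u s t + R u t s))))"
          by cases (simp_all add: R_def x)
      qed
    qed
  qed
  also have "\<dots> = ?I + (?I + (?I + (?I + (?I + ?I))))"
    by (simp add: nn_integral_add i1 i2 i3 i4 i5)
  also have "\<dots> = (1 + (1 + (1 + (1 + (1 + 1))))) * ?I" by (simp only: distrib_right mult_1)
  also have "(1 + (1 + (1 + (1 + (1 + 1))))) = (6 :: ennreal)" by simp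
  finally show ?thesis by (simp add: R_def)
qed

section \<open>Traces of kernels that factor through an auxiliary space\<close>

context
  fixes P :: "'p measure" and L :: "'a measure" and \<Phi> \<Psi> :: "'p \<times> 'a \<Rightarrow> ennreal"
  assumes P: "sigma_finite_measure P" and L: "sigma_finite_measure L"
    and Phi [measurable]: "\<Phi> \<in> borel_measurable (P \<Otimes>\<^sub>M L)" and Psi [measurable]: "\<Psi> \<in> borel_measurable (P \<Otimes>\<^sub>M L)"
begin

text \<open>
  With integrals as sums, the kernel is the matrix product \<open>\<Phi>\<^sup>T \<Psi>\<close> and \<open>fgram\<close> is \<open>\<Psi> \<Phi>\<^sup>T\<close>, so that their powers
  have the same traces.
\<close>

definition fkernel :: "'a \<Rightarrow> 'a \<Rightarrow> ennreal" where
  "fkernel x y = (\<integral>\<^sup>+p. \<Phi> (p, x) * \<Psi> (p, y) \<partial>P)"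

definition fgram :: "'p \<Rightarrow> 'p \<Rightarrow> ennreal" where
  "fgram p q = (\<integral>\<^sup>+y. \<Psi> (p, y) * \<Phi> (q, y) \<partial>L)"

interpretation P: sigma_finite_measure P by (rule P)
interpretation L: sigma_finite_measure L by (rule L)
interpretation PL: pair_sigma_finite P L by standard

lemma fkernel_measurable [measurable (raw)]:
  assumes [measurable]: "f \<in> N \<rightarrow>\<^sub>M L" "g \<in> N \<rightarrow>\<^sub>M L"
  shows "(\<lambda>z. fkernel (f z) (g z)) \<in> borel_measurable N"
  unfolding fkernel_def by measurable

lemma fgram_measurable [measurable (raw)]:
  assumes [measurable]: "f \<in> N \<rightarrow>\<^sub>M P" "g \<in> N \<rightarrow>\<^sub>M P"
  shows "(\<lambda>z. fgram (f z) (g z)) \<in> borel_measurable N"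
  unfolding fgram_def by measurable

text \<open>In matrix terms, (Phi^T Psi) g = Phi^T (Psi g).\<close>

lemma fkernel_apply:
  assumes [measurable]: "g \<in> borel_measurable L" and x: "x \<in> space L"
  shows "(\<integral>\<^sup>+y. fkernel x y * g y \<partial>L) = (\<integral>\<^sup>+p. \<Phi> (p, x) * (\<integral>\<^sup>+y. \<Psi> (p, y) * g y \<partial>L) \<partial>P)"
proof -
  note [measurable] = x
  have "(\<integral>\<^sup>+y. fkernel x y * g y \<partial>L) = (\<integral>\<^sup>+y. \<integral>\<^sup>+p. \<Phi> (p, x) * (\<Psi> (p, y) * g y) \<partial>P \<partial>L)"
    unfolding fkernel_def by (intro nn_integral_cong) (simp add: nn_integral_multc[symmetric] mult.assoc)
  also have "\<dots> = (\<integral>\<^sup>+p. \<integral>\<^sup>+y. \<Phi> (p, x) * (\<Psi> (p, y) * g y) \<partial>L \<partial>P)"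
    by (rule PL.Fubini') measurable
  also have "\<dots> = (\<integral>\<^sup>+p. \<Phi> (p, x) * (\<integral>\<^sup>+y. \<Psi> (p, y) * g y \<partial>L) \<partial>P)"
    by (intro nn_integral_cong) (simp add: nn_integral_cmult)
  finally show ?thesis .
qed

text \<open>In matrix terms, Psi (Phi^T Psi) = (Psi Phi^T) Psi; each use turns one kernel factor
  into a gram factor.\<close>

lemma fkernel_row:
  assumes p: "p \<in> space P" and x: "x \<in> space L"
  shows "(\<integral>\<^sup>+y. \<Psi> (p, y) * fkernel y x \<partial>L) = (\<integral>\<^sup>+q. fgram p q * \<Psi> (q, x) \<partial>P)"
proof -
  note [measurable] = p x
  have "(\<integral>\<^sup>+y. \<Psi> (p, y) * fkernel y x \<partial>L) = (\<integral>\<^sup>+y. \<integral>\<^sup>+q. \<Psi> (p, y) * \<Phi> (q, y) * \<Psi> (q, x) \<partial>P \<partial>L)"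
    unfolding fkernel_def by (intro nn_integral_cong) (simp add: nn_integral_cmult[symmetric] mult.assoc)
  also have "\<dots> = (\<integral>\<^sup>+q. \<integral>\<^sup>+y. \<Psi> (p, y) * \<Phi> (q, y) * \<Psi> (q, x) \<partial>L \<partial>P)"
    by (rule PL.Fubini') measurable
  also have "\<dots> = (\<integral>\<^sup>+q. fgram p q * \<Psi> (q, x) \<partial>P)"
    unfolding fgram_def by (intro nn_integral_cong) (simp add: nn_integral_multc)
  finally show ?thesis .
qed

lemma trace2:
  "(\<integral>\<^sup>+x. \<integral>\<^sup>+y. fkernel x y * fkernel y x \<partial>L \<partial>L) = (\<integral>\<^sup>+p. \<integral>\<^sup>+q. fgram p q * fgram q p \<partial>P \<partial>P)"
proof -
  have "(\<integral>\<^sup>+x. \<integral>\<^sup>+y. fkernel x y * fkernel y x \<partial>L \<partial>L) = (\<integral>\<^sup>+x. \<integral>\<^sup>+p. \<Phi> (p, x) * (\<integral>\<^sup>+q. fgram p q * \<Psi> (q, x) \<partial>P) \<partial>P \<partial>L)"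
  proof (rule nn_integral_cong)
    fix x assume x [measurable]: "x \<in> space L"
    show "(\<integral>\<^sup>+y. fkernel x y * fkernel y x \<partial>L) = (\<integral>\<^sup>+p. \<Phi> (p, x) * (\<integral>\<^sup>+q. fgram p q * \<Psi> (q, x) \<partial>P) \<partial>P)"
      by (subst fkernel_apply[OF _ x]) (auto intro!: nn_integral_cong simp: fkernel_row x)
  qed
  also have "\<dots> = (\<integral>\<^sup>+p. \<integral>\<^sup>+x. \<Phi> (p, x) * (\<integral>\<^sup>+q. fgram p q * \<Psi> (q, x) \<partial>P) \<partial>L \<partial>P)"
    by (rule PL.Fubini') measurable
  also have "\<dots> = (\<integral>\<^sup>+p. \<integral>\<^sup>+q. fgram p q * fgram q p \<partial>P \<partial>P)"
  proof (rule nn_integral_cong)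
    fix p assume p [measurable]: "p \<in> space P"
    have "(\<integral>\<^sup>+x. \<Phi> (p, x) * (\<integral>\<^sup>+q. fgram p q * \<Psi> (q, x) \<partial>P) \<partial>L) = (\<integral>\<^sup>+x. \<integral>\<^sup>+q. fgram p q * (\<Psi> (q, x) * \<Phi> (p, x)) \<partial>P \<partial>L)"
      by (intro nn_integral_cong) (simp add: nn_integral_cmult[symmetric] mult_ac)
    also have "\<dots> = (\<integral>\<^sup>+q. \<integral>\<^sup>+x. fgram p q * (\<Psi> (q, x) * \<Phi> (p, x)) \<partial>L \<partial>P)"
      by (rule PL.Fubini') measurable
    also have "\<dots> = (\<integral>\<^sup>+q. fgram p q * fgram q p \<partial>P)"
      unfolding fgram_def[of _ p] by (intro nn_integral_cong) (simp add: nn_integral_cmult)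
    finally show "(\<integral>\<^sup>+x. \<Phi> (p, x) * (\<integral>\<^sup>+q. fgram p q * \<Psi> (q, x) \<partial>P) \<partial>L) = (\<integral>\<^sup>+q. fgram p q * fgram q p \<partial>P)" .
  qed
  finally show ?thesis .
qed

lemma trace3:
  "(\<integral>\<^sup>+x. \<integral>\<^sup>+y. \<integral>\<^sup>+z. fkernel x y * fkernel y z * fkernel z x \<partial>L \<partial>L \<partial>L) = (\<integral>\<^sup>+p. \<integral>\<^sup>+q. \<integral>\<^sup>+r. fgram p q * fgram q r * fgram r p \<partial>P \<partial>P \<partial>P)"
proof -
  \<comment> \<open>The square of the kernel from \<open>y\<close> to \<open>x\<close>, with its
    outermost \<open>\<Phi>\<close> exposed so that it can pair with the \<open>\<Psi>\<close> of
    the remaining kernel factor to another \<open>fgram\<close>.\<close>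
  define K2 where "K2 x y = (\<integral>\<^sup>+q. \<Phi> (q, y) * (\<integral>\<^sup>+r. fgram q r * \<Psi> (r, x) \<partial>P) \<partial>P)" for x y
  have [measurable]: "K2 x \<in> borel_measurable L" if [measurable]: "x \<in> space L" for x unfolding K2_def by measurable
  have inner: "(\<integral>\<^sup>+z. fkernel y z * fkernel z x \<partial>L) = K2 x y" if x [measurable]: "x \<in> space L" and y: "y \<in> space L" for x y
    unfolding K2_def by (subst fkernel_apply[OF _ y]) (auto intro!: nn_integral_cong simp: fkernel_row x)
  have "(\<integral>\<^sup>+x. \<integral>\<^sup>+y. \<integral>\<^sup>+z. fkernel x y * fkernel y z * fkernel z x \<partial>L \<partial>L \<partial>L) = (\<integral>\<^sup>+x. \<integral>\<^sup>+y. fkernel x y * K2 x y \<partial>L \<partial>L)"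
  proof (intro nn_integral_cong)
    fix x y assume [measurable]: "x \<in> space L" "y \<in> space L"
    show "(\<integral>\<^sup>+z. fkernel x y * fkernel y z * fkernel z x \<partial>L) = fkernel x y * K2 x y"
      unfolding inner[OF \<open>x \<in> space L\<close> \<open>y \<in> space L\<close>, symmetric] by (subst nn_integral_cmult[symmetric]) (auto simp: mult.assoc)
  qed
  also have "\<dots> = (\<integral>\<^sup>+x. \<integral>\<^sup>+p. \<Phi> (p, x) * (\<integral>\<^sup>+q. fgram p q * (\<integral>\<^sup>+r. fgram q r * \<Psi> (r, x) \<partial>P) \<partial>P) \<partial>P \<partial>L)"
  proof (rule nn_integral_cong)
    fix x assume x [measurable]: "x \<in> space L"
    have "(\<integral>\<^sup>+y. \<Psi> (p, y) * K2 x y \<partial>L) = (\<integral>\<^sup>+q. fgram p q * (\<integral>\<^sup>+r. fgram q r * \<Psi> (r, x) \<partial>P) \<partial>P)" if p [measurable]: "p \<in> space P" for p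
    proof -
      have "(\<integral>\<^sup>+y. \<Psi> (p, y) * K2 x y \<partial>L) = (\<integral>\<^sup>+y. \<integral>\<^sup>+q. \<Psi> (p, y) * \<Phi> (q, y) * (\<integral>\<^sup>+r. fgram q r * \<Psi> (r, x) \<partial>P) \<partial>P \<partial>L)"
        unfolding K2_def by (intro nn_integral_cong) (simp add: nn_integral_cmult[symmetric] mult.assoc)
      also have "\<dots> = (\<integral>\<^sup>+q. \<integral>\<^sup>+y. \<Psi> (p, y) * \<Phi> (q, y) * (\<integral>\<^sup>+r. fgram q r * \<Psi> (r, x) \<partial>P) \<partial>L \<partial>P)"
        by (rule PL.Fubini') measurable
      also have "\<dots> = (\<integral>\<^sup>+q. fgram p q * (\<integral>\<^sup>+r. fgram q r * \<Psi> (r, x) \<partial>P) \<partial>P)"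
        unfolding fgram_def[of p] by (intro nn_integral_cong) (simp add: nn_integral_multc)
      finally show ?thesis .
    qed
    then show "(\<integral>\<^sup>+y. fkernel x y * K2 x y \<partial>L) = (\<integral>\<^sup>+p. \<Phi> (p, x) * (\<integral>\<^sup>+q. fgram p q * (\<integral>\<^sup>+r. fgram q r * \<Psi> (r, x) \<partial>P) \<partial>P) \<partial>P)"
      by (subst fkernel_apply[OF _ x]) (auto intro!: nn_integral_cong)
  qed
  also have "\<dots> = (\<integral>\<^sup>+p. \<integral>\<^sup>+x. \<Phi> (p, x) * (\<integral>\<^sup>+q. fgram p q * (\<integral>\<^sup>+r. fgram q r * \<Psi> (r, x) \<partial>P) \<partial>P) \<partial>L \<partial>P)"
    by (rule PL.Fubini') measurable
  also have "\<dots> = (\<integral>\<^sup>+p. \<integral>\<^sup>+q. \<integral>\<^sup>+r. fgram p q * fgram q r * fgram r p \<partial>P \<partial>P \<partial>P)"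
  proof (rule nn_integral_cong)
    fix p assume p [measurable]: "p \<in> space P"
    have "(\<integral>\<^sup>+x. \<Phi> (p, x) * (\<integral>\<^sup>+q. fgram p q * (\<integral>\<^sup>+r. fgram q r * \<Psi> (r, x) \<partial>P) \<partial>P) \<partial>L)
      = (\<integral>\<^sup>+x. \<integral>\<^sup>+q. fgram p q * (\<integral>\<^sup>+r. fgram q r * (\<Psi> (r, x) * \<Phi> (p, x)) \<partial>P) \<partial>P \<partial>L)"
    proof (rule nn_integral_cong)
      fix x assume x [measurable]: "x \<in> space L"
      have "\<Phi> (p, x) * (\<integral>\<^sup>+q. fgram p q * (\<integral>\<^sup>+r. fgram q r * \<Psi> (r, x) \<partial>P) \<partial>P)
        = (\<integral>\<^sup>+q. fgram p q * ((\<integral>\<^sup>+r. fgram q r * \<Psi> (r, x) \<partial>P) * \<Phi> (p, x)) \<partial>P)"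
        by (subst nn_integral_cmult[symmetric]) (auto simp: mult_ac)
      also have "\<dots> = (\<integral>\<^sup>+q. fgram p q * (\<integral>\<^sup>+r. fgram q r * (\<Psi> (r, x) * \<Phi> (p, x)) \<partial>P) \<partial>P)"
        by (intro nn_integral_cong) (simp add: nn_integral_multc[symmetric] mult.assoc)
      finally show "\<Phi> (p, x) * (\<integral>\<^sup>+q. fgram p q * (\<integral>\<^sup>+r. fgram q r * \<Psi> (r, x) \<partial>P) \<partial>P)
        = (\<integral>\<^sup>+q. fgram p q * (\<integral>\<^sup>+r. fgram q r * (\<Psi> (r, x) * \<Phi> (p, x)) \<partial>P) \<partial>P)" .
    qed
    also have "\<dots> = (\<integral>\<^sup>+q. \<integral>\<^sup>+x. fgram p q * (\<integral>\<^sup>+r. fgram q r * (\<Psi> (r, x) * \<Phi> (p, x)) \<partial>P) \<partial>L \<partial>P)"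
      by (rule PL.Fubini') measurable
    also have "\<dots> = (\<integral>\<^sup>+q. \<integral>\<^sup>+r. fgram p q * fgram q r * fgram r p \<partial>P \<partial>P)"
    proof (rule nn_integral_cong)
      fix q assume q [measurable]: "q \<in> space P"
      have "(\<integral>\<^sup>+x. fgram p q * (\<integral>\<^sup>+r. fgram q r * (\<Psi> (r, x) * \<Phi> (p, x)) \<partial>P) \<partial>L)
        = fgram p q * (\<integral>\<^sup>+x. \<integral>\<^sup>+r. fgram q r * (\<Psi> (r, x) * \<Phi> (p, x)) \<partial>P \<partial>L)"
        by (rule nn_integral_cmult) measurable
      also have "(\<integral>\<^sup>+x. \<integral>\<^sup>+r. fgram q r * (\<Psi> (r, x) * \<Phi> (p, x)) \<partial>P \<partial>L) = (\<integral>\<^sup>+r. \<integral>\<^sup>+x. fgram q r * (\<Psi> (r, x) * \<Phi> (p, x)) \<partial>L \<partial>P)"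
        by (rule PL.Fubini') measurable
      also have "\<dots> = (\<integral>\<^sup>+r. fgram q r * fgram r p \<partial>P)"
        unfolding fgram_def[of _ p] by (intro nn_integral_cong) (simp add: nn_integral_cmult)
      also have "fgram p q * \<dots> = (\<integral>\<^sup>+r. fgram p q * fgram q r * fgram r p \<partial>P)"
        by (subst nn_integral_cmult[symmetric]) (auto simp: mult.assoc)
      finally show "(\<integral>\<^sup>+x. fgram p q * (\<integral>\<^sup>+r. fgram q r * (\<Psi> (r, x) * \<Phi> (p, x)) \<partial>P) \<partial>L) = (\<integral>\<^sup>+r. fgram p q * fgram q r * fgram r p \<partial>P)" .
    qed
    finally show "(\<integral>\<^sup>+x. \<Phi> (p, x) * (\<integral>\<^sup>+q. fgram p q * (\<integral>\<^sup>+r. fgram q r * \<Psi> (r, x) \<partial>P) \<partial>P) \<partial>L)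
      = (\<integral>\<^sup>+q. \<integral>\<^sup>+r. fgram p q * fgram q r * fgram r p \<partial>P \<partial>P)" .
  qed
  finally show ?thesis .
qed

end

section \<open>The Rosenblatt kernel\<close>

locale rosenblatt_exponents =
  fixes \<gamma>\<^sub>1 \<gamma>\<^sub>2 :: real
  assumes exps: "- 1 < \<gamma>\<^sub>1" "\<gamma>\<^sub>1 < - 1 / 2" "- 1 < \<gamma>\<^sub>2" "\<gamma>\<^sub>2 < - 1 / 2" "\<gamma>\<^sub>1 + \<gamma>\<^sub>2 > - 3 / 2"
begin

text \<open>With truth values in place of the indices 1 and 2, the passage from i to 3 - i is
  negation.\<close>

definition expo :: "bool \<Rightarrow> real" where "expo a = (if a then \<gamma>\<^sub>1 else \<gamma>\<^sub>2)"

lemma expo: "- 1 < expo a" "expo a < - 1 / 2"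
  using exps by (auto simp: expo_def)

lemma expo_not: "expo a + expo (\<not> a) = \<gamma>\<^sub>1 + \<gamma>\<^sub>2"
  by (auto simp: expo_def)

text \<open>The point \<open>(a, s)\<close> stands for the summand in which the exponent \<open>expo a\<close> goes with the first variable.\<close>

definition index_measure :: "(bool \<times> real) measure" where
  "index_measure = count_space UNIV \<Otimes>\<^sub>M lborel"

lemma sets_index_measure [measurable_cong]: "sets index_measure = sets (count_space UNIV \<Otimes>\<^sub>M borel)"
  unfolding index_measure_def by (intro sets_pair_measure_cong) auto

lemma space_index_measure: "space index_measure = UNIV"
  by (simp add: index_measure_def space_pair_measure)

lemma sigma_finite_index_measure: "sigma_finite_measure index_measure"
  unfolding index_measure_def
  by (intro sigma_finite_pair_measure sigma_finite_measure_count_space lborel.sigma_finite_measure_axioms)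

lemma nn_integral_index_measure:
  assumes F: "F \<in> borel_measurable index_measure"
  shows "(\<integral>\<^sup>+p. F p \<partial>index_measure) = (\<integral>\<^sup>+s. (\<Sum>a\<in>UNIV. F (a, s)) \<partial>lborel)"
proof -
  interpret C: sigma_finite_measure "count_space (UNIV :: bool set)" by (rule sigma_finite_measure_count_space)
  interpret CL: pair_sigma_finite "count_space (UNIV :: bool set)" "lborel :: real measure" by standard
  have "(\<integral>\<^sup>+p. F p \<partial>index_measure) = (\<integral>\<^sup>+s. \<integral>\<^sup>+a. F (a, s) \<partial>count_space UNIV \<partial>lborel)"
    unfolding index_measure_def by (rule CL.nn_integral_snd[symmetric]) (use F in \<open>simp add: index_measure_def\<close>)
  then show ?thesis by (simp add: nn_integral_count_space_finite)
qed

text \<open>The indicator of the range of \<open>s\<close> sits in only one of the two factors: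
  \<open>fg\<close> then carries the indicator of its second point, and round a cycle each point
  gets its own exactly once.\<close>

definition Phi :: "(bool \<times> real) \<times> real \<Rightarrow> ennreal" where
  "Phi = (\<lambda>((a, s), x). I01 s * ennreal (pos_powr (s - x) (expo a)))"

definition Psi :: "(bool \<times> real) \<times> real \<Rightarrow> ennreal" where
  "Psi = (\<lambda>((a, s), x). ennreal (pos_powr (s - x) (expo (\<not> a))))"

lemma expo_measurable [measurable]: "expo \<in> borel_measurable (count_space UNIV)" "(\<lambda>a. expo (\<not> a)) \<in> borel_measurable (count_space UNIV)"
  by auto

lemma Phi_measurable [measurable]: "Phi \<in> borel_measurable (index_measure \<Otimes>\<^sub>M lborel)"
  unfolding Phi_def split_def by measurable

lemma Psi_measurable [measurable]: "Psi \<in> borel_measurable (index_measure \<Otimes>\<^sub>M lborel)"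
proof -
  have [measurable]: "(\<lambda>z. expo (\<not> fst (fst z))) \<in> borel_measurable (index_measure \<Otimes>\<^sub>M lborel)"
    by (rule measurable_compose[OF _ expo_measurable(2)]) measurable
  show ?thesis unfolding Psi_def split_def by measurable
qed

abbreviation fk :: "real \<Rightarrow> real \<Rightarrow> ennreal" where "fk \<equiv> fkernel index_measure Phi Psi"
abbreviation fg :: "bool \<times> real \<Rightarrow> bool \<times> real \<Rightarrow> ennreal" where "fg \<equiv> fgram lborel Phi Psi"

lemmas fk_measurable [measurable (raw)] = fkernel_measurable[OF sigma_finite_index_measure lborel.sigma_finite_measure_axioms Phi_measurable Psi_measurable]
lemmas fg_measurable [measurable (raw)] = fgram_measurable[OF sigma_finite_index_measure lborel.sigma_finite_measure_axioms Phi_measurable Psi_measurable]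
lemmas fk_trace2 = trace2[OF sigma_finite_index_measure lborel.sigma_finite_measure_axioms Phi_measurable Psi_measurable]
lemmas fk_trace3 = trace3[OF sigma_finite_index_measure lborel.sigma_finite_measure_axioms Phi_measurable Psi_measurable]

lemma fk_eq: "fk x y = (\<integral>\<^sup>+s. I01 s * ennreal (pos_powr (s - x) \<gamma>\<^sub>1 * pos_powr (s - y) \<gamma>\<^sub>2 + pos_powr (s - x) \<gamma>\<^sub>2 * pos_powr (s - y) \<gamma>\<^sub>1) \<partial>lborel)"
  unfolding fkernel_def[OF sigma_finite_index_measure lborel.sigma_finite_measure_axioms Phi_measurable Psi_measurable]
proof (subst nn_integral_index_measure)
  show "(\<lambda>p. Phi (p, x) * Psi (p, y)) \<in> borel_measurable index_measure" by measurable
  show "(\<integral>\<^sup>+s. (\<Sum>a\<in>UNIV. Phi ((a, s), x) * Psi ((a, s), y)) \<partial>lborel)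
    = (\<integral>\<^sup>+s. I01 s * ennreal (pos_powr (s - x) \<gamma>\<^sub>1 * pos_powr (s - y) \<gamma>\<^sub>2 + pos_powr (s - x) \<gamma>\<^sub>2 * pos_powr (s - y) \<gamma>\<^sub>1) \<partial>lborel)"
    by (intro nn_integral_cong) (simp add: UNIV_bool Phi_def Psi_def expo_def ennreal_mult distrib_left mult_ac add.commute)
qed

lemma fk_sym: "fk x y = fk y x"
  unfolding fk_eq by (intro nn_integral_cong) (simp add: mult.commute add.commute)

text \<open>This holds on the diagonal too: where \<open>fk\<close> is infinite,
  \<open>enn2real\<close> gives 0, which is also the value of the divergent Bochner
  integral.\<close>

lemma rosenblatt_kernel_eq: "rosenblatt_kernel \<gamma>\<^sub>1 \<gamma>\<^sub>2 (x, y) = enn2real (fk x y)"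
proof -
  have "rosenblatt_kernel \<gamma>\<^sub>1 \<gamma>\<^sub>2 (x, y) = enn2real (\<integral>\<^sup>+s. ennreal (indicator {0..1} s *\<^sub>R
    (pos_powr (s - x) \<gamma>\<^sub>1 * pos_powr (s - y) \<gamma>\<^sub>2 + pos_powr (s - x) \<gamma>\<^sub>2 * pos_powr (s - y) \<gamma>\<^sub>1)) \<partial>lborel)"
    unfolding rosenblatt_kernel_def prod.case set_lebesgue_integral_def
    by (rule integral_eq_nn_integral) (auto intro!: AE_I2)
  also have "(\<integral>\<^sup>+s. ennreal (indicator {0..1} s *\<^sub>R
    (pos_powr (s - x) \<gamma>\<^sub>1 * pos_powr (s - y) \<gamma>\<^sub>2 + pos_powr (s - x) \<gamma>\<^sub>2 * pos_powr (s - y) \<gamma>\<^sub>1)) \<partial>lborel) = fk x y"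
    unfolding fk_eq
  proof (rule nn_integral_cong_AE, use AE_lborel_singleton[of 0] AE_lborel_singleton[of 1] in eventually_elim)
    fix s :: real assume "s \<noteq> 0" "s \<noteq> 1"
    then show "ennreal (indicator {0..1} s *\<^sub>R (pos_powr (s - x) \<gamma>\<^sub>1 * pos_powr (s - y) \<gamma>\<^sub>2 + pos_powr (s - x) \<gamma>\<^sub>2 * pos_powr (s - y) \<gamma>\<^sub>1))
      = I01 s * ennreal (pos_powr (s - x) \<gamma>\<^sub>1 * pos_powr (s - y) \<gamma>\<^sub>2 + pos_powr (s - x) \<gamma>\<^sub>2 * pos_powr (s - y) \<gamma>\<^sub>1)"
      by (auto simp: indicator_def)
  qed
  finally show ?thesis .
qed

section \<open>Traces as integrals of overlaps\<close>

definition overlap :: "bool \<Rightarrow> bool \<Rightarrow> real \<Rightarrow> real \<Rightarrow> ennreal" where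
  "overlap a b s t = (\<integral>\<^sup>+y. ennreal (pos_powr (s - y) (expo a)) * ennreal (pos_powr (t - y) (expo b)) \<partial>lborel)"

lemma overlap_sym: "overlap a b s t = overlap b a t s"
  by (simp add: overlap_def mult.commute)

lemma overlap_measurable [measurable (raw)]:
  assumes [measurable]: "f \<in> borel_measurable N" "g \<in> borel_measurable N"
  shows "(\<lambda>z. overlap a b (f z) (g z)) \<in> borel_measurable N"
  unfolding overlap_def by measurable

lemma fg_eq: "fg (a, s) (b, t) = I01 t * overlap (\<not> a) b s t"
  unfolding fgram_def[OF sigma_finite_index_measure lborel.sigma_finite_measure_axioms Phi_measurable Psi_measurable]
  by (simp add: Phi_def Psi_def overlap_def nn_integral_cmult[symmetric] mult_ac)

lemma overlap_less:
  assumes "s < t"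
  shows "overlap a b s t = ennreal (Beta (expo a + 1) (- expo a - expo b - 1) * pos_powr (t - s) (expo a + expo b + 1))"
  unfolding overlap_def using nn_integral_pos_powr_pair[OF expo[of a] expo[of b], of s t] assms
  by (simp add: pair_const_def pos_powr_def)

lemma Beta_expo_pos: "0 < Beta (expo a + 1) (- expo a - expo b - 1)"
  using expo[of a] expo[of b] by (intro Beta_pos) auto

abbreviation cycle2 :: "bool \<Rightarrow> bool \<Rightarrow> real \<Rightarrow> real \<Rightarrow> ennreal" where
  "cycle2 a b s t \<equiv> I01 s * I01 t * (overlap (\<not> a) b s t * overlap (\<not> b) a t s)"

abbreviation cycle3 :: "bool \<Rightarrow> bool \<Rightarrow> bool \<Rightarrow> real \<Rightarrow> real \<Rightarrow> real \<Rightarrow> ennreal" where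
  "cycle3 a b c s t u \<equiv> I01 s * I01 t * I01 u * (overlap (\<not> a) b s t * overlap (\<not> b) c t u * overlap (\<not> c) a u s)"

definition gram2 :: "real \<Rightarrow> real \<Rightarrow> ennreal" where
  "gram2 s t = (\<Sum>a\<in>UNIV. \<Sum>b\<in>UNIV. cycle2 a b s t)"

definition gram3 :: "real \<Rightarrow> real \<Rightarrow> real \<Rightarrow> ennreal" where
  "gram3 s t u = (\<Sum>a\<in>UNIV. \<Sum>b\<in>UNIV. \<Sum>c\<in>UNIV. cycle3 a b c s t u)"

lemma trace2_gram2: "(\<integral>\<^sup>+x. \<integral>\<^sup>+y. fk x y * fk y x \<partial>lborel \<partial>lborel) = (\<integral>\<^sup>+s. \<integral>\<^sup>+t. gram2 s t \<partial>lborel \<partial>lborel)"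
proof -
  have "(\<integral>\<^sup>+p. \<integral>\<^sup>+q. fg p q * fg q p \<partial>index_measure \<partial>index_measure) = (\<integral>\<^sup>+s. (\<Sum>a\<in>UNIV. \<integral>\<^sup>+q. fg (a, s) q * fg q (a, s) \<partial>index_measure) \<partial>lborel)"
    by (rule nn_integral_index_measure) (rule sigma_finite_measure.borel_measurable_nn_integral[OF sigma_finite_index_measure], measurable)
  also have "\<dots> = (\<integral>\<^sup>+s. (\<Sum>a\<in>UNIV. \<integral>\<^sup>+t. (\<Sum>b\<in>UNIV. cycle2 a b s t) \<partial>lborel) \<partial>lborel)"
  proof (intro nn_integral_cong sum.cong refl)
    fix s :: real and a :: bool
    show "(\<integral>\<^sup>+q. fg (a, s) q * fg q (a, s) \<partial>index_measure) = (\<integral>\<^sup>+t. (\<Sum>b\<in>UNIV. cycle2 a b s t) \<partial>lborel)"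
      by (subst nn_integral_index_measure) (auto simp: fg_eq mult_ac space_index_measure)
  qed
  also have "\<dots> = (\<integral>\<^sup>+s. \<integral>\<^sup>+t. gram2 s t \<partial>lborel \<partial>lborel)"
    unfolding gram2_def by (intro nn_integral_cong, subst nn_integral_sum) auto
  finally show ?thesis by (simp add: fk_trace2)
qed

lemma trace3_gram3: "(\<integral>\<^sup>+x. \<integral>\<^sup>+y. \<integral>\<^sup>+z. fk x y * fk y z * fk z x \<partial>lborel \<partial>lborel \<partial>lborel) = (\<integral>\<^sup>+s. \<integral>\<^sup>+t. \<integral>\<^sup>+u. gram3 s t u \<partial>lborel \<partial>lborel \<partial>lborel)"
proof -
  note [measurable (raw)] = sigma_finite_measure.borel_measurable_nn_integral[OF sigma_finite_index_measure]
  have "(\<integral>\<^sup>+p. \<integral>\<^sup>+q. \<integral>\<^sup>+r. fg p q * fg q r * fg r p \<partial>index_measure \<partial>index_measure \<partial>index_measure) = (\<integral>\<^sup>+s. (\<Sum>a\<in>UNIV. \<integral>\<^sup>+q. \<integral>\<^sup>+r. fg (a, s) q * fg q r * fg r (a, s) \<partial>index_measure \<partial>index_measure) \<partial>lborel)"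
    by (rule nn_integral_index_measure) measurable
  also have "\<dots> = (\<integral>\<^sup>+s. (\<Sum>a\<in>UNIV. \<integral>\<^sup>+t. (\<Sum>b\<in>UNIV. \<integral>\<^sup>+u. (\<Sum>c\<in>UNIV. cycle3 a b c s t u) \<partial>lborel) \<partial>lborel) \<partial>lborel)"
  proof (intro nn_integral_cong sum.cong refl)
    fix s :: real and a :: bool
    have [measurable]: "(a, s) \<in> space index_measure" by (simp add: space_index_measure)
    have "(\<integral>\<^sup>+q. \<integral>\<^sup>+r. fg (a, s) q * fg q r * fg r (a, s) \<partial>index_measure \<partial>index_measure) = (\<integral>\<^sup>+t. (\<Sum>b\<in>UNIV. \<integral>\<^sup>+r. fg (a, s) (b, t) * fg (b, t) r * fg r (a, s) \<partial>index_measure) \<partial>lborel)"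
      by (rule nn_integral_index_measure) measurable
    also have "\<dots> = (\<integral>\<^sup>+t. (\<Sum>b\<in>UNIV. \<integral>\<^sup>+u. (\<Sum>c\<in>UNIV. cycle3 a b c s t u) \<partial>lborel) \<partial>lborel)"
    proof (intro nn_integral_cong sum.cong refl)
      fix t :: real and b :: bool
      have [measurable]: "(b, t) \<in> space index_measure" by (simp add: space_index_measure)
      show "(\<integral>\<^sup>+r. fg (a, s) (b, t) * fg (b, t) r * fg r (a, s) \<partial>index_measure) = (\<integral>\<^sup>+u. (\<Sum>c\<in>UNIV. cycle3 a b c s t u) \<partial>lborel)"
        by (subst nn_integral_index_measure) (auto simp: fg_eq mult_ac)
    qed
    finally show "(\<integral>\<^sup>+q. \<integral>\<^sup>+r. fg (a, s) q * fg q r * fg r (a, s) \<partial>index_measure \<partial>index_measure) = (\<integral>\<^sup>+t. (\<Sum>b\<in>UNIV. \<integral>\<^sup>+u. (\<Sum>c\<in>UNIV. cycle3 a b c s t u) \<partial>lborel) \<partial>lborel)" .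
  qed
  also have "\<dots> = (\<integral>\<^sup>+s. (\<Sum>a\<in>UNIV. \<integral>\<^sup>+t. \<integral>\<^sup>+u. (\<Sum>b\<in>UNIV. \<Sum>c\<in>UNIV. cycle3 a b c s t u) \<partial>lborel \<partial>lborel) \<partial>lborel)"
    by (intro nn_integral_cong sum.cong refl nn_integral_sum[symmetric]) measurable
  also have "\<dots> = (\<integral>\<^sup>+s. \<integral>\<^sup>+t. (\<Sum>a\<in>UNIV. \<integral>\<^sup>+u. (\<Sum>b\<in>UNIV. \<Sum>c\<in>UNIV. cycle3 a b c s t u) \<partial>lborel) \<partial>lborel \<partial>lborel)"
    by (intro nn_integral_cong nn_integral_sum[symmetric]) measurable
  also have "\<dots> = (\<integral>\<^sup>+s. \<integral>\<^sup>+t. \<integral>\<^sup>+u. gram3 s t u \<partial>lborel \<partial>lborel \<partial>lborel)"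
    unfolding gram3_def by (intro nn_integral_cong nn_integral_sum[symmetric]) measurable
  finally show ?thesis by (simp add: fk_trace3)
qed

lemma gram2_sym: "gram2 s t = gram2 t s"
  by (simp add: gram2_def UNIV_bool overlap_sym[of _ _ t s] mult_ac add_ac)

text \<open>Shifting the points amounts to relabelling the summation indices.\<close>

lemma gram3_cyc: "gram3 t u s = gram3 s t u"
  by (simp add: gram3_def UNIV_bool mult_ac add_ac)

text \<open>Each overlap is turned round by \<open>overlap_sym\<close>; the summand of
  \<open>a\<close>, \<open>b\<close>, \<open>c\<close> then becomes that of \<open>\<not> c\<close>,
  \<open>\<not> b\<close>, \<open>\<not> a\<close>.\<close>

lemma gram3_rev: "gram3 u t s = gram3 s t u"
  by (simp add: gram3_def UNIV_bool overlap_sym[of _ _ t s] overlap_sym[of _ _ u t] overlap_sym[of _ _ u s] mult_ac add_ac)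

section \<open>Values of the two traces\<close>

lemma beta_bracket_pos: "0 < beta_bracket \<gamma>\<^sub>1 \<gamma>\<^sub>2"
proof -
  have "0 < Beta (\<gamma>\<^sub>1 + 1) (- \<gamma>\<^sub>1 - \<gamma>\<^sub>2 - 1)" "0 < Beta (\<gamma>\<^sub>2 + 1) (- \<gamma>\<^sub>1 - \<gamma>\<^sub>2 - 1)"
    "0 < Beta (\<gamma>\<^sub>1 + 1) (- 2 * \<gamma>\<^sub>1 - 1)" "0 < Beta (\<gamma>\<^sub>2 + 1) (- 2 * \<gamma>\<^sub>2 - 1)"
    by (rule Beta_pos; use exps in simp)+
  then show ?thesis unfolding beta_bracket_def by (intro add_pos_pos mult_pos_pos)
qed

lemma trace2_value: "(\<integral>\<^sup>+x. \<integral>\<^sup>+y. fk x y * fk y x \<partial>lborel \<partial>lborel)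
  = ennreal (2 * beta_bracket \<gamma>\<^sub>1 \<gamma>\<^sub>2 / ((2 * (\<gamma>\<^sub>1 + \<gamma>\<^sub>2) + 3) * (\<gamma>\<^sub>1 + \<gamma>\<^sub>2 + 2)))"
proof -
  let ?g = "\<gamma>\<^sub>1 + \<gamma>\<^sub>2"
  note br = beta_bracket_pos
  have "(\<integral>\<^sup>+x. \<integral>\<^sup>+y. fk x y * fk y x \<partial>lborel \<partial>lborel) = 2 * (\<integral>\<^sup>+s. \<integral>\<^sup>+t. gram2 s t * indicator {s<..} t \<partial>lborel \<partial>lborel)"
    unfolding trace2_gram2
  proof (rule nn_integral_square_sym)
    show "case_prod gram2 \<in> borel_measurable (borel \<Otimes>\<^sub>M borel)" unfolding gram2_def split_def by measurable
  qed (rule gram2_sym)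
  also have "(\<integral>\<^sup>+s. \<integral>\<^sup>+t. gram2 s t * indicator {s<..} t \<partial>lborel \<partial>lborel)
    = (\<integral>\<^sup>+s. \<integral>\<^sup>+t. ennreal (2 * beta_bracket \<gamma>\<^sub>1 \<gamma>\<^sub>2) * (I01 s * I01 t * ennreal (pos_powr (t - s) (2 * ?g + 2))) \<partial>lborel \<partial>lborel)"
  proof (intro nn_integral_cong)
    fix s t :: real
    show "gram2 s t * indicator {s<..} t = ennreal (2 * beta_bracket \<gamma>\<^sub>1 \<gamma>\<^sub>2) * (I01 s * I01 t * ennreal (pos_powr (t - s) (2 * ?g + 2)))"
    proof (cases "s < t")
      case True
      have single: "overlap (\<not> a) b s t * overlap (\<not> b) a t s = ennreal (Beta (expo (\<not> a) + 1) (- expo (\<not> a) - expo b - 1) * Beta (expo a + 1) (- expo a - expo (\<not> b) - 1)) * ennreal (pos_powr (t - s) (2 * ?g + 2))" for a b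
      proof -
        \<comment> \<open>Each of \<open>a\<close> and \<open>b\<close> occurs once plain and once
          negated in the cycle, so the total power is the same for all four choices.\<close>
        have e: "2 * ?g + 2 = (expo (\<not> a) + expo b + 1) + (expo a + expo (\<not> b) + 1)" using expo_not[of a] expo_not[of b] by simp
        have "pos_powr (t - s) (p + q) = pos_powr (t - s) p * pos_powr (t - s) q" for p q
          using True by (simp add: pos_powr_def powr_add)
        then have "pos_powr (t - s) (2 * ?g + 2) = pos_powr (t - s) (expo (\<not> a) + expo b + 1) * pos_powr (t - s) (expo a + expo (\<not> b) + 1)"
          unfolding e by blast
        then show ?thesis
          unfolding overlap_sym[of "\<not> b" a t s] overlap_less[OF True] using Beta_expo_pos[of "\<not> a" b] Beta_expo_pos[of a "\<not> b"]
          by (simp add: ennreal_mult[symmetric] mult_ac)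
      qed
      have e: "- \<gamma>\<^sub>1 - \<gamma>\<^sub>1 = - 2 * \<gamma>\<^sub>1" "- \<gamma>\<^sub>2 - \<gamma>\<^sub>2 = - 2 * \<gamma>\<^sub>2" "- \<gamma>\<^sub>2 - \<gamma>\<^sub>1 = - \<gamma>\<^sub>1 - \<gamma>\<^sub>2" by simp_all
      have B: "0 < Beta (\<gamma>\<^sub>1 + 1) (- \<gamma>\<^sub>1 - \<gamma>\<^sub>2 - 1)" "0 < Beta (\<gamma>\<^sub>2 + 1) (- \<gamma>\<^sub>1 - \<gamma>\<^sub>2 - 1)" "0 < Beta (\<gamma>\<^sub>1 + 1) (- 2 * \<gamma>\<^sub>1 - 1)" "0 < Beta (\<gamma>\<^sub>2 + 1) (- 2 * \<gamma>\<^sub>2 - 1)"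
        using exps by (auto intro!: Beta_pos)
      have "(\<Sum>a\<in>UNIV. \<Sum>b\<in>UNIV. ennreal (Beta (expo (\<not> a) + 1) (- expo (\<not> a) - expo b - 1) * Beta (expo a + 1) (- expo a - expo (\<not> b) - 1)))
        = ennreal (\<Sum>a\<in>UNIV. \<Sum>b\<in>UNIV. Beta (expo (\<not> a) + 1) (- expo (\<not> a) - expo b - 1) * Beta (expo a + 1) (- expo a - expo (\<not> b) - 1))"
        using Beta_expo_pos by (simp add: sum_nonneg less_imp_le)
      \<comment> \<open>The choice \<open>b = a\<close> gives the first product of the bracket and
        \<open>b = (\<not> a)\<close> the second, each for two values of \<open>a\<close>.\<close>
      also have "(\<Sum>a\<in>UNIV. \<Sum>b\<in>UNIV. Beta (expo (\<not> a) + 1) (- expo (\<not> a) - expo b - 1) * Beta (expo a + 1) (- expo a - expo (\<not> b) - 1)) = 2 * beta_bracket \<gamma>\<^sub>1 \<gamma>\<^sub>2"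
        by (simp add: UNIV_bool expo_def beta_bracket_def e mult_ac)
      finally have sum: "(\<Sum>a\<in>UNIV. \<Sum>b\<in>UNIV. ennreal (Beta (expo (\<not> a) + 1) (- expo (\<not> a) - expo b - 1) * Beta (expo a + 1) (- expo a - expo (\<not> b) - 1))) = ennreal (2 * beta_bracket \<gamma>\<^sub>1 \<gamma>\<^sub>2)" .
      have "gram2 s t = (\<Sum>a\<in>UNIV. \<Sum>b\<in>UNIV. ennreal (Beta (expo (\<not> a) + 1) (- expo (\<not> a) - expo b - 1) * Beta (expo a + 1) (- expo a - expo (\<not> b) - 1))) * (I01 s * I01 t * ennreal (pos_powr (t - s) (2 * ?g + 2)))"
        unfolding gram2_def single sum_distrib_right by (simp only: mult_ac)
      then show ?thesis using True unfolding sum by simp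
    qed (simp add: pos_powr_def)
  qed
  also have "\<dots> = ennreal (2 * beta_bracket \<gamma>\<^sub>1 \<gamma>\<^sub>2) * (\<integral>\<^sup>+s. \<integral>\<^sup>+t. I01 s * I01 t * ennreal (pos_powr (t - s) (2 * ?g + 2)) \<partial>lborel \<partial>lborel)"
    by (simp add: nn_integral_cmult)
  also have "(\<integral>\<^sup>+s. \<integral>\<^sup>+t. I01 s * I01 t * ennreal (pos_powr (t - s) (2 * ?g + 2)) \<partial>lborel \<partial>lborel) = ennreal (1 / ((2 * ?g + 2 + 1) * (2 * ?g + 2 + 2)))"
    \<comment> \<open>The exponent exceeds -1 precisely because
      \<open>\<gamma>\<^sub>1 + \<gamma>\<^sub>2 > - 3 / 2\<close>.\<close>
    by (rule nn_integral_triangle) (use exps in auto)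
  also have "2 * (ennreal (2 * beta_bracket \<gamma>\<^sub>1 \<gamma>\<^sub>2) * \<dots>) = ennreal (2 * (2 * beta_bracket \<gamma>\<^sub>1 \<gamma>\<^sub>2 * (1 / ((2 * ?g + 2 + 1) * (2 * ?g + 2 + 2)))))"
  proof -
    have "2 * (ennreal x * ennreal y) = ennreal (2 * (x * y))" if "0 \<le> x" "0 \<le> y" for x y :: real
      using that by (simp add: ennreal_mult)
    moreover have "0 \<le> 2 * beta_bracket \<gamma>\<^sub>1 \<gamma>\<^sub>2" using br by simp
    moreover have "0 \<le> 1 / ((2 * ?g + 2 + 1) * (2 * ?g + 2 + 2))"
      using exps by (intro divide_nonneg_nonneg mult_nonneg_nonneg) auto
    ultimately show ?thesis by blast
  qed
  also have "2 * (2 * beta_bracket \<gamma>\<^sub>1 \<gamma>\<^sub>2 * (1 / ((2 * ?g + 2 + 1) * (2 * ?g + 2 + 2)))) = 2 * beta_bracket \<gamma>\<^sub>1 \<gamma>\<^sub>2 / ((2 * ?g + 3) * (?g + 2))"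
  proof -
    have e: "(2 * ?g + 2 + 1) * (2 * ?g + 2 + 2) = 2 * ((2 * ?g + 3) * (?g + 2))" by (simp add: algebra_simps)
    have "2 * (2 * B * (1 / (2 * X))) = 2 * B / X" for B X :: real by simp
    then show ?thesis unfolding e by blast
  qed
  finally show ?thesis .
qed

text \<open>For \<open>s < t < u\<close>, the constants of the overlaps over the pairs
  \<open>(s, u)\<close>, \<open>(s, t)\<close> and \<open>(t, u)\<close>, in the order of the
  factors of \<open>F\<^sub>2\<close>.\<close>

definition beta_triple :: "bool \<Rightarrow> bool \<Rightarrow> bool \<Rightarrow> real" where
  "beta_triple a b c = Beta (expo a + 1) (- expo a - expo (\<not> c) - 1) * Beta (expo (\<not> a) + 1) (- expo (\<not> a) - expo b - 1)
    * Beta (expo (\<not> b) + 1) (- expo (\<not> b) - expo c - 1)"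

lemma F2_bool: "F\<^sub>2 \<gamma>\<^sub>1 \<gamma>\<^sub>2 = (\<Sum>a\<in>UNIV. \<Sum>b\<in>UNIV. \<Sum>c\<in>UNIV. beta_triple a b c * Beta (expo (\<not> a) + expo b + 2) (expo (\<not> b) + expo c + 2))"
proof -
  have s: "(\<Sum>(i, j, k)\<in>{1, 2} \<times> {1, 2} \<times> {1, 2 :: nat}. f i j k) = (\<Sum>i\<in>{1, 2 :: nat}. \<Sum>j\<in>{1, 2 :: nat}. \<Sum>k\<in>{1, 2}. f i j k)" for f :: "nat \<Rightarrow> nat \<Rightarrow> nat \<Rightarrow> real"
    by (simp only: sum.cartesian_product)
  show ?thesis unfolding F\<^sub>2_def Let_def s by (simp add: UNIV_bool beta_triple_def expo_def)
qed

lemma beta_triple_pos: "0 < beta_triple a b c"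
  unfolding beta_triple_def by (intro mult_pos_pos Beta_expo_pos)

lemma trace3_value: "(\<integral>\<^sup>+x. \<integral>\<^sup>+y. \<integral>\<^sup>+z. fk x y * fk y z * fk z x \<partial>lborel \<partial>lborel \<partial>lborel)
  = ennreal (2 * F\<^sub>2 \<gamma>\<^sub>1 \<gamma>\<^sub>2 / ((3 * (\<gamma>\<^sub>1 + \<gamma>\<^sub>2) + 5) * (\<gamma>\<^sub>1 + \<gamma>\<^sub>2 + 2)))"
proof -
  let ?g = "\<gamma>\<^sub>1 + \<gamma>\<^sub>2"
  \<comment> \<open>What the two outer integrations of \<open>nn_integral_simplex\<close> leave; the
    three gap exponents add up to \<open>3 * ?g + 3\<close> for all choices of indices.\<close>
  let ?D = "(3 * ?g + 5) * (3 * ?g + 6)"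
  have D: "0 < ?D" using exps by (intro mult_pos_pos) auto
  let ?q = "\<lambda>a b. expo (\<not> a) + expo b + 1" and ?p = "\<lambda>a c. expo a + expo (\<not> c) + 1"
  let ?J = "\<lambda>a b c s t u. I01 s * I01 t * I01 u * ennreal (pos_powr (t - s) (?q a b) * pos_powr (u - t) (?q b c) * pos_powr (u - s) (?p a c))"
  have "(\<integral>\<^sup>+x. \<integral>\<^sup>+y. \<integral>\<^sup>+z. fk x y * fk y z * fk z x \<partial>lborel \<partial>lborel \<partial>lborel)
    = 6 * (\<integral>\<^sup>+s. \<integral>\<^sup>+t. \<integral>\<^sup>+u. gram3 s t u * of_bool (s < t \<and> t < u) \<partial>lborel \<partial>lborel \<partial>lborel)"
    unfolding trace3_gram3
  proof (rule nn_integral_cube_sym)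
    show "(\<lambda>(s, t, u). gram3 s t u) \<in> borel_measurable (borel \<Otimes>\<^sub>M (borel \<Otimes>\<^sub>M borel))" unfolding gram3_def split_def by measurable
  qed (rule gram3_cyc, rule gram3_rev)
  also have "(\<integral>\<^sup>+s. \<integral>\<^sup>+t. \<integral>\<^sup>+u. gram3 s t u * of_bool (s < t \<and> t < u) \<partial>lborel \<partial>lborel \<partial>lborel)
    = (\<integral>\<^sup>+s. \<integral>\<^sup>+t. \<integral>\<^sup>+u. (\<Sum>a\<in>UNIV. \<Sum>b\<in>UNIV. \<Sum>c\<in>UNIV. ennreal (beta_triple a b c) * ?J a b c s t u) \<partial>lborel \<partial>lborel \<partial>lborel)"
  proof (intro nn_integral_cong)
    fix s t u :: real
    show "gram3 s t u * of_bool (s < t \<and> t < u) = (\<Sum>a\<in>UNIV. \<Sum>b\<in>UNIV. \<Sum>c\<in>UNIV. ennreal (beta_triple a b c) * ?J a b c s t u)"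
    proof (cases "s < t \<and> t < u")
      case True
      then have lt: "s < t" "t < u" "s < u" by auto
      have "overlap (\<not> a) b s t * overlap (\<not> b) c t u * overlap (\<not> c) a u s = ennreal (beta_triple a b c) * ennreal (pos_powr (t - s) (?q a b) * pos_powr (u - t) (?q b c) * pos_powr (u - s) (?p a c))" for a b c
        unfolding overlap_sym[of "\<not> c" a u s] overlap_less[OF lt(1)] overlap_less[OF lt(2)] overlap_less[OF lt(3)] beta_triple_def
        using Beta_expo_pos[of "\<not> a" b] Beta_expo_pos[of "\<not> b" c] Beta_expo_pos[of a "\<not> c"]
        by (simp add: ennreal_mult[symmetric] mult_ac)
      then show ?thesis using True by (simp add: gram3_def mult_ac)
    next
      case False
      then have "?J a b c s t u = 0" for a b c by (auto simp: pos_powr_def)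
      then show ?thesis using False by (simp only: mult_zero_right sum.neutral_const of_bool_eq)
    qed
  qed
  also have "\<dots> = (\<Sum>a\<in>UNIV. \<Sum>b\<in>UNIV. \<Sum>c\<in>UNIV. ennreal (beta_triple a b c) * (\<integral>\<^sup>+s. \<integral>\<^sup>+t. \<integral>\<^sup>+u. ?J a b c s t u \<partial>lborel \<partial>lborel \<partial>lborel))"
    by (simp add: nn_integral_sum nn_integral_cmult)
  also have "\<dots> = (\<Sum>a\<in>UNIV. \<Sum>b\<in>UNIV. \<Sum>c\<in>UNIV. ennreal (beta_triple a b c * Beta (expo (\<not> a) + expo b + 2) (expo (\<not> b) + expo c + 2) / ?D))"
  proof (intro sum.cong refl)
    fix a b c
    have e: "?p a c + ?q a b + ?q b c = 3 * ?g + 3" using expo_not[of a] expo_not[of b] expo_not[of c] by simp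
    have e': "?p a c + ?q a b + ?q b c + 2 = 3 * ?g + 5" "?p a c + ?q a b + ?q b c + 3 = 3 * ?g + 6"
      "?q a b + 1 = expo (\<not> a) + expo b + 2" "?q b c + 1 = expo (\<not> b) + expo c + 2" using e by simp_all
    have "(\<integral>\<^sup>+s. \<integral>\<^sup>+t. \<integral>\<^sup>+u. ?J a b c s t u \<partial>lborel \<partial>lborel \<partial>lborel)
      = ennreal (Beta (?q a b + 1) (?q b c + 1) / ((?p a c + ?q a b + ?q b c + 2) * (?p a c + ?q a b + ?q b c + 3)))"
      by (rule nn_integral_simplex) (use expo[of a] expo[of b] expo[of c] expo[of "\<not> a"] expo[of "\<not> b"] expo[of "\<not> c"] e exps in auto)
    then show "ennreal (beta_triple a b c) * (\<integral>\<^sup>+s. \<integral>\<^sup>+t. \<integral>\<^sup>+u. ?J a b c s t u \<partial>lborel \<partial>lborel \<partial>lborel)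
      = ennreal (beta_triple a b c * Beta (expo (\<not> a) + expo b + 2) (expo (\<not> b) + expo c + 2) / ?D)"
      unfolding e' using beta_triple_pos[of a b c] by (simp add: ennreal_mult'[symmetric])
  qed
  also have "\<dots> = ennreal (F\<^sub>2 \<gamma>\<^sub>1 \<gamma>\<^sub>2 / ?D)"
  proof -
    have nn: "0 \<le> beta_triple a b c * Beta (expo (\<not> a) + expo b + 2) (expo (\<not> b) + expo c + 2) / ?D" for a b c
      using D exps beta_triple_pos[of a b c] Beta_pos[of "expo (\<not> a) + expo b + 2" "expo (\<not> b) + expo c + 2"] expo[of a] expo[of b] expo[of c] expo[of "\<not> a"] expo[of "\<not> b"]
      by (intro divide_nonneg_nonneg mult_nonneg_nonneg) auto
    show ?thesis unfolding F2_bool sum_divide_distrib using nn by (simp add: sum_nonneg)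
  qed
  also have "6 * \<dots> = ennreal (6 * (F\<^sub>2 \<gamma>\<^sub>1 \<gamma>\<^sub>2 / ?D))"
    by (subst ennreal_mult') auto
  also have "6 * (F\<^sub>2 \<gamma>\<^sub>1 \<gamma>\<^sub>2 / ?D) = 2 * F\<^sub>2 \<gamma>\<^sub>1 \<gamma>\<^sub>2 / ((3 * ?g + 5) * (?g + 2))"
  proof -
    \<comment> \<open>The 6 of the orderings against the 3 in \<open>3 * ?g + 6\<close> leaves the
      factor 2.\<close>
    have e: "(3 * ?g + 5) * (3 * ?g + 6) = 3 * ((3 * ?g + 5) * (?g + 2))" by (simp add: algebra_simps)
    have "6 * (F / (3 * X)) = 2 * F / X" for F X :: real by simp
    then show ?thesis unfolding e by blast
  qed
  finally show ?thesis .
qed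

text \<open>Since \<open>fk\<close> is symmetric, the finite trace is the integral of its
  square.\<close>

lemma AE_fk_finite: "AE x in lborel. AE y in lborel. fk x y < \<infinity>"
proof -
  have "(\<integral>\<^sup>+x. \<integral>\<^sup>+y. fk x y * fk y x \<partial>lborel \<partial>lborel) \<noteq> \<infinity>" by (simp add: trace2_value)
  then have "AE x in lborel. (\<integral>\<^sup>+y. fk x y * fk y x \<partial>lborel) \<noteq> \<infinity>"
    by (intro nn_integral_PInf_AE) auto
  then show ?thesis
  proof eventually_elim
    case (elim x)
    then have "AE y in lborel. fk x y * fk y x \<noteq> \<infinity>" by (intro nn_integral_PInf_AE) auto
    then show ?case
      by eventually_elim (auto simp: fk_sym[of _ x] less_top[symmetric] ennreal_top_mult)
  qed
qed

section \<open>The real-valued kernel\<close>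

abbreviation rkernel :: "real \<times> real \<Rightarrow> real" where "rkernel \<equiv> rosenblatt_kernel \<gamma>\<^sub>1 \<gamma>\<^sub>2"

lemma rkernel_eq: "rkernel p = enn2real (fk (fst p) (snd p))"
  using rosenblatt_kernel_eq[of "fst p" "snd p"] by simp

lemma rkernel_measurable [measurable]: "rkernel \<in> borel_measurable borel"
proof -
  have "(\<lambda>p. enn2real (fk (fst p) (snd p))) \<in> borel_measurable (borel \<Otimes>\<^sub>M borel)" by measurable
  then show ?thesis unfolding borel_prod rkernel_eq[symmetric] .
qed

lemma rkernel_sym: "rkernel (x, y) = rkernel (y, x)"
  by (simp add: rosenblatt_kernel_eq fk_sym)

lemma sq_norm_rkernel: "sq_norm lborel rkernel = ennreal (2 * beta_bracket \<gamma>\<^sub>1 \<gamma>\<^sub>2 / ((2 * (\<gamma>\<^sub>1 + \<gamma>\<^sub>2) + 3) * (\<gamma>\<^sub>1 + \<gamma>\<^sub>2 + 2)))"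
proof -
  have [measurable]: "rkernel \<in> borel_measurable (borel \<Otimes>\<^sub>M borel)" by (simp add: borel_prod)
  have "sq_norm lborel rkernel = (\<integral>\<^sup>+p. ennreal ((rkernel p)\<^sup>2) \<partial>(lborel \<Otimes>\<^sub>M lborel))" by (simp add: sq_norm_def lborel_prod)
  also have "\<dots> = (\<integral>\<^sup>+x. \<integral>\<^sup>+y. ennreal ((rkernel (x, y))\<^sup>2) \<partial>lborel \<partial>lborel)"
    by (rule lborel.nn_integral_fst[symmetric]) measurable
  also have "\<dots> = (\<integral>\<^sup>+x. \<integral>\<^sup>+y. fk x y * fk y x \<partial>lborel \<partial>lborel)"
  proof (rule nn_integral_cong_AE, use AE_fk_finite in eventually_elim)
    fix x assume "AE y in lborel. fk x y < \<infinity>"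
    then show "(\<integral>\<^sup>+y. ennreal ((rkernel (x, y))\<^sup>2) \<partial>lborel) = (\<integral>\<^sup>+y. fk x y * fk y x \<partial>lborel)"
      by (intro nn_integral_cong_AE, eventually_elim)
        (simp add: rosenblatt_kernel_eq fk_sym[of _ x] power2_eq_square ennreal_mult)
  qed
  finally show ?thesis by (simp add: trace2_value)
qed

lemma integral_rkernel_power2: "(\<integral>p. (rkernel p)\<^sup>2 \<partial>lborel) = 2 * beta_bracket \<gamma>\<^sub>1 \<gamma>\<^sub>2 / ((2 * (\<gamma>\<^sub>1 + \<gamma>\<^sub>2) + 3) * (\<gamma>\<^sub>1 + \<gamma>\<^sub>2 + 2))"
proof -
  have nn: "0 \<le> 2 * beta_bracket \<gamma>\<^sub>1 \<gamma>\<^sub>2 / ((2 * (\<gamma>\<^sub>1 + \<gamma>\<^sub>2) + 3) * (\<gamma>\<^sub>1 + \<gamma>\<^sub>2 + 2))"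
    using exps beta_bracket_pos by (intro divide_nonneg_nonneg mult_nonneg_nonneg) auto
  have "(\<integral>p. (rkernel p)\<^sup>2 \<partial>lborel) = enn2real (sq_norm lborel rkernel)"
    unfolding sq_norm_def by (rule integral_eq_nn_integral) (auto intro!: AE_I2)
  then show ?thesis unfolding sq_norm_rkernel using nn by simp
qed

lemma F2_pos: "0 < F\<^sub>2 \<gamma>\<^sub>1 \<gamma>\<^sub>2"
  unfolding F2_bool
proof (intro sum_pos mult_pos_pos beta_triple_pos Beta_pos)
  fix a b show "0 < expo (\<not> a) + expo b + 2" using expo[of b] expo[of "\<not> a"] by simp
next
  fix a b show "0 < expo (\<not> a) + expo b + 2" using expo[of b] expo[of "\<not> a"] by simp
qed auto

lemma integral_cyclic_prod_rkernel: "(\<integral>p. cyclic_prod rkernel p \<partial>(lborel \<Otimes>\<^sub>M (lborel \<Otimes>\<^sub>M lborel))) = 2 * F\<^sub>2 \<gamma>\<^sub>1 \<gamma>\<^sub>2 / ((3 * (\<gamma>\<^sub>1 + \<gamma>\<^sub>2) + 5) * (\<gamma>\<^sub>1 + \<gamma>\<^sub>2 + 2))"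
proof -
  have RKm [measurable]: "rkernel \<in> borel_measurable (lborel \<Otimes>\<^sub>M lborel)" by (simp add: lborel_prod)
  have [measurable]: "cyclic_prod rkernel \<in> borel_measurable (lborel \<Otimes>\<^sub>M (lborel \<Otimes>\<^sub>M lborel))" by (rule cyclic_prod_measurable) (rule RKm)
  have nn: "0 \<le> 2 * F\<^sub>2 \<gamma>\<^sub>1 \<gamma>\<^sub>2 / ((3 * (\<gamma>\<^sub>1 + \<gamma>\<^sub>2) + 5) * (\<gamma>\<^sub>1 + \<gamma>\<^sub>2 + 2))"
    using exps F2_pos by (intro divide_nonneg_nonneg mult_nonneg_nonneg) auto
  have "(\<integral>\<^sup>+p. ennreal (cyclic_prod rkernel p) \<partial>(lborel \<Otimes>\<^sub>M (lborel \<Otimes>\<^sub>M lborel))) = (\<integral>\<^sup>+x. \<integral>\<^sup>+y. \<integral>\<^sup>+z. ennreal (cyclic_prod rkernel (x, y, z)) \<partial>lborel \<partial>lborel \<partial>lborel)"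
    by (rule nn_integral_triple[OF lborel.sigma_finite_measure_axioms]) measurable
  also have "\<dots> = (\<integral>\<^sup>+x. \<integral>\<^sup>+y. \<integral>\<^sup>+z. fk x y * fk y z * fk z x \<partial>lborel \<partial>lborel \<partial>lborel)"
  proof (rule nn_integral_cong_AE, use AE_fk_finite in eventually_elim)
    fix x assume x: "AE y in lborel. fk x y < \<infinity>"
    show "(\<integral>\<^sup>+y. \<integral>\<^sup>+z. ennreal (cyclic_prod rkernel (x, y, z)) \<partial>lborel \<partial>lborel) = (\<integral>\<^sup>+y. \<integral>\<^sup>+z. fk x y * fk y z * fk z x \<partial>lborel \<partial>lborel)"
    \<comment> \<open>One finiteness condition for each edge of the triangle \<open>x\<close>,
      \<open>y\<close>, \<open>z\<close>; the edge from \<open>z\<close> to \<open>x\<close> is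
      turned round by \<open>fk_sym\<close>.\<close>
    proof (rule nn_integral_cong_AE, use x AE_fk_finite in eventually_elim)
      fix y assume xy: "fk x y < \<infinity>" and y: "AE z in lborel. fk y z < \<infinity>"
      show "(\<integral>\<^sup>+z. ennreal (cyclic_prod rkernel (x, y, z)) \<partial>lborel) = (\<integral>\<^sup>+z. fk x y * fk y z * fk z x \<partial>lborel)"
      proof (rule nn_integral_cong_AE, use x y in eventually_elim)
        fix z assume "fk x z < \<infinity>" "fk y z < \<infinity>"
        then show "ennreal (cyclic_prod rkernel (x, y, z)) = fk x y * fk y z * fk z x"
          using xy by (simp add: cyclic_prod_def rosenblatt_kernel_eq fk_sym[of z x] ennreal_mult)
      qed
    qed
  qed
  finally have "(\<integral>\<^sup>+p. ennreal (cyclic_prod rkernel p) \<partial>(lborel \<Otimes>\<^sub>M (lborel \<Otimes>\<^sub>M lborel))) = ennreal (2 * F\<^sub>2 \<gamma>\<^sub>1 \<gamma>\<^sub>2 / ((3 * (\<gamma>\<^sub>1 + \<gamma>\<^sub>2) + 5) * (\<gamma>\<^sub>1 + \<gamma>\<^sub>2 + 2)))"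
    unfolding trace3_value .
  moreover have "(\<integral>p. cyclic_prod rkernel p \<partial>(lborel \<Otimes>\<^sub>M (lborel \<Otimes>\<^sub>M lborel))) = enn2real (\<integral>\<^sup>+p. ennreal (cyclic_prod rkernel p) \<partial>(lborel \<Otimes>\<^sub>M (lborel \<Otimes>\<^sub>M lborel)))"
    by (rule integral_eq_nn_integral) (auto intro!: AE_I2 simp: cyclic_prod_def rosenblatt_kernel_eq)
  ultimately show ?thesis using nn by simp
qed

end

theorem corollary2p2:
  fixes M :: "'a measure"
    and W :: "real set \<Rightarrow> 'a \<Rightarrow> real"
    and \<gamma>\<^sub>1 \<gamma>\<^sub>2 :: real
  assumes "brownian_random_measure M W"
    and "- 1 < \<gamma>\<^sub>1" and "\<gamma>\<^sub>1 < - 1 / 2"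
    and "- 1 < \<gamma>\<^sub>2" and "\<gamma>\<^sub>2 < - 1 / 2"
    and "\<gamma>\<^sub>1 + \<gamma>\<^sub>2 > - 3 / 2"
  shows "(\<integral>\<omega>. (rosenblatt_rv M W \<gamma>\<^sub>1 \<gamma>\<^sub>2 \<omega>)\<^sup>2 \<partial>M) = 1
    \<and> integrable M (\<lambda>\<omega>. rosenblatt_rv M W \<gamma>\<^sub>1 \<gamma>\<^sub>2 \<omega> ^ 3)
    \<and> (\<integral>\<omega>. rosenblatt_rv M W \<gamma>\<^sub>1 \<gamma>\<^sub>2 \<omega> ^ 3 \<partial>M) = F\<^sub>1 \<gamma>\<^sub>1 \<gamma>\<^sub>2 * F\<^sub>2 \<gamma>\<^sub>1 \<gamma>\<^sub>2 * F\<^sub>3 \<gamma>\<^sub>1 \<gamma>\<^sub>2"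
proof -
  interpret brownian_random_measure M W by fact
  interpret rosenblatt_exponents \<gamma>\<^sub>1 \<gamma>\<^sub>2 by standard (use assms in auto)
  define Z where "Z = double_wiener_ito M W rkernel"
  have fin: "sq_norm lborel rkernel < \<infinity>" by (simp add: sq_norm_rkernel)
  \<comment> \<open>Finiteness of the norm gives existence, so that the choice operator does return
    an integral of the kernel.\<close>
  have Z: "has_double_wiener_ito M W rkernel Z"
    unfolding Z_def double_wiener_ito_def by (rule someI_ex[OF has_double_wiener_ito_exists[OF rkernel_measurable fin]])
  note mom = double_wiener_ito_moments[OF Z fin rkernel_sym]
  let ?A = "rosenblatt_const \<gamma>\<^sub>1 \<gamma>\<^sub>2" and ?b = "beta_bracket \<gamma>\<^sub>1 \<gamma>\<^sub>2" and ?g = "\<gamma>\<^sub>1 + \<gamma>\<^sub>2"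
  have rv: "rosenblatt_rv M W \<gamma>\<^sub>1 \<gamma>\<^sub>2 \<omega> = ?A / 2 * Z \<omega>" for \<omega>
    by (simp add: rosenblatt_rv_def Z_def)
  note b = beta_bracket_pos
  have g: "0 < ?g + 2" "0 < 2 * ?g + 3" "0 < 3 * ?g + 5" using exps by auto
  let ?y = "(?g + 2) * (2 * ?g + 3) / ?b"
  have y: "0 < ?y" using b g by simp
  have A2: "?A\<^sup>2 = ?y"
  proof -
    have "(x powr (1 / 2))\<^sup>2 = x" if "0 < x" for x :: real using that by (simp add: powr_half_sqrt)
    from this[OF y] show ?thesis unfolding rosenblatt_const_def .
  qed
  have A3: "?A ^ 3 = (?g + 2) powr (3 / 2) * (2 * ?g + 3) powr (3 / 2) * ?b powr (- (3 / 2))"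
  proof -
    have "(x powr (1 / 2)) ^ 3 = x powr (3 / 2)" if "0 < x" for x :: real
      using that powr_numeral[of "x powr (1 / 2)" "num.Bit1 num.One"] by (simp add: powr_powr)
    from this[OF y] have "?A ^ 3 = ?y powr (3 / 2)" unfolding rosenblatt_const_def .
    also have "\<dots> = (?g + 2) powr (3 / 2) * (2 * ?g + 3) powr (3 / 2) * ?b powr (- (3 / 2))"
    proof -
      have "(u * w / x) powr a = u powr a * w powr a * x powr (- a)" if "0 < u" "0 < w" "0 < x" for u w x a :: real
        using that by (simp add: powr_divide powr_mult powr_minus_divide)
      from this[OF g(1,2) b] show ?thesis .
    qed
    finally show ?thesis .
  qed
  have "expectation (\<lambda>\<omega>. (rosenblatt_rv M W \<gamma>\<^sub>1 \<gamma>\<^sub>2 \<omega>)\<^sup>2) = ?A\<^sup>2 / 4 * expectation (\<lambda>\<omega>. (Z \<omega>)\<^sup>2)"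
    unfolding rv by (simp add: power_mult_distrib power_divide)
  \<comment> \<open>The 4 from squaring \<open>?A / 2\<close> is cancelled by the 2 of the isometry
    and the 2 in the norm of the kernel; the rest is the reciprocal of
    \<open>?A ^ 2\<close>.\<close>
  also have "\<dots> = 1"
  proof -
    have "u * w / x / 4 * (2 * (2 * x / (w * u))) = 1" if "0 < u" "0 < w" "0 < x" for u w x :: real
      using that by simp
    from this[OF g(1,2) b] show ?thesis unfolding mom(1) integral_rkernel_power2 A2 .
  qed
  finally have 1: "expectation (\<lambda>\<omega>. (rosenblatt_rv M W \<gamma>\<^sub>1 \<gamma>\<^sub>2 \<omega>)\<^sup>2) = 1" .
  \<comment> \<open>The cube of \<open>?A / 2\<close> brings an 8 that cancels the 8 of the third
    moment.\<close>
  have "has_bochner_integral M (\<lambda>\<omega>. (?A ^ 3 / 8) * Z \<omega> ^ 3) ((?A ^ 3 / 8) * (8 * (2 * F\<^sub>2 \<gamma>\<^sub>1 \<gamma>\<^sub>2 / ((3 * ?g + 5) * (?g + 2)))))"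
    using mom(2) unfolding integral_cyclic_prod_rkernel by (rule has_bochner_integral_mult_right)
  also have "(\<lambda>\<omega>. (?A ^ 3 / 8) * Z \<omega> ^ 3) = (\<lambda>\<omega>. rosenblatt_rv M W \<gamma>\<^sub>1 \<gamma>\<^sub>2 \<omega> ^ 3)"
    by (simp add: rv power_mult_distrib power_divide)
  also have "(?A ^ 3 / 8) * (8 * (2 * F\<^sub>2 \<gamma>\<^sub>1 \<gamma>\<^sub>2 / ((3 * ?g + 5) * (?g + 2)))) = F\<^sub>1 \<gamma>\<^sub>1 \<gamma>\<^sub>2 * F\<^sub>2 \<gamma>\<^sub>1 \<gamma>\<^sub>2 * F\<^sub>3 \<gamma>\<^sub>1 \<gamma>\<^sub>2"
  proof -
    \<comment> \<open>One power of \<open>?g + 2\<close> is split off to cancel against the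
      denominator of the trace, which leaves the exponent 1/2 of \<open>F\<^sub>1\<close>.\<close>
    have pw: "(?g + 2) powr (3 / 2) = (?g + 2) powr (1 / 2) * (?g + 2)"
      using g powr_add[of "?g + 2" "1 / 2" 1] by simp
    have "p * u * q * x / 8 * (8 * (2 * F / (w * u))) = 2 * p * q * inverse w * F * x" if "0 < u" "0 < w" for p q u w x F :: real
      using that by (simp add: field_simps)
    from this[OF g(1,3)] show ?thesis unfolding A3 pw F\<^sub>1_def F\<^sub>3_def .
  qed
  finally show ?thesis using 1 by (simp add: has_bochner_integral_iff)
qed

end
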